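(* Let $F_2$ be the graph with vertex set $\{1,2,3,4,5\}$ and edge set $\{12,15,23,24,34,35,45\}$ (the graph obtained from $K_4$ by subdividing one edge once). The problem $F_2$-Induced Minor is solvable in polynomial time.
   Context: All graphs are finite and simple. A graph $G$ contains $H$ as an induced minor if $H$ can be obtained from $G$ by vertex deletions and edge contractions. The problem $H$-Induced Minor takes a graph $G$ as input and asks whether $G$ contains $H$ as an induced minor. *)

theory Defs
  imports "HOL-Computational_Algebra.Polynomial"
begin

section \<open>Graphs and induced minors\<close>

record 'a ugraph =
  verts :: "'a set"
  edges :: "'a set set"

definition simple_graph :: "'a ugraph \<Rightarrow> bool" where
  "simple_graph G \<longleftrightarrow> finite (verts G) \<and> (\<forall>e\<in>edges G. e \<subseteq> verts G \<and> card e = 2)"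

definition graph_iso :: "'a ugraph \<Rightarrow> 'b ugraph \<Rightarrow> bool" where
  "graph_iso G H \<longleftrightarrow> (\<exists>f. bij_betw f (verts G) (verts H) \<and>
     (\<forall>u\<in>verts G. \<forall>v\<in>verts G. {u, v} \<in> edges G \<longleftrightarrow> {f u, f v} \<in> edges H))"

definition delete_vertex :: "'a \<Rightarrow> 'a ugraph \<Rightarrow> 'a ugraph" where
  "delete_vertex v G = \<lparr>verts = verts G - {v}, edges = {e \<in> edges G. v \<notin> e}\<rparr>"

text \<open>The vertex that results from contracting the edge \<open>uv\<close> keeps the name \<open>u\<close>; loops and
  parallel edges are suppressed.\<close>

definition contract_edge :: "'a \<Rightarrow> 'a \<Rightarrow> 'a ugraph \<Rightarrow> 'a ugraph" where
  "contract_edge u v G = \<lparr>verts = verts G - {v},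
     edges = {e \<in> edges G. v \<notin> e} \<union> {{u, w} | w. {v, w} \<in> edges G \<and> w \<noteq> u}\<rparr>"

inductive minor_step :: "'a ugraph \<Rightarrow> 'a ugraph \<Rightarrow> bool" where
  deletion: "v \<in> verts G \<Longrightarrow> minor_step G (delete_vertex v G)"
| contraction: "{u, v} \<in> edges G \<Longrightarrow> minor_step G (contract_edge u v G)"

definition contains_induced_minor :: "'a ugraph \<Rightarrow> 'b ugraph \<Rightarrow> bool" where
  "contains_induced_minor G H \<longleftrightarrow> (\<exists>G'. minor_step\<^sup>*\<^sup>* G G' \<and> graph_iso G' H)"

lemma minor_step_simple_graph:
  assumes "minor_step G G'" "simple_graph G"
  shows "simple_graph G'"
  using assms
proof cases
  case (deletion v)
  then show ?thesis
    using assms(2) by (auto simp: simple_graph_def delete_vertex_def)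
next
  case (contraction u v)
  have pair: "x \<in> verts G \<and> y \<in> verts G \<and> x \<noteq> y" if "{x, y} \<in> edges G" for x y
  proof -
    have "{x, y} \<subseteq> verts G" "card {x, y} = 2"
      using that assms(2) by (auto simp: simple_graph_def)
    then show ?thesis by (cases "x = y") simp_all
  qed
  have "e \<subseteq> verts G - {v} \<and> card e = 2"
    if e: "e \<in> {e \<in> edges G. v \<notin> e} \<union> {{u, w} | w. {v, w} \<in> edges G \<and> w \<noteq> u}" for e
    using e
  proof
    assume "e \<in> {e \<in> edges G. v \<notin> e}"
    then show ?thesis using assms(2) by (auto simp: simple_graph_def)
  next
    assume "e \<in> {{u, w} | w. {v, w} \<in> edges G \<and> w \<noteq> u}"
    then obtain w where "e = {u, w}" "{v, w} \<in> edges G" "w \<noteq> u" by blast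
    then show ?thesis using pair[of v w] pair[of u v] contraction(2) by auto
  qed
  then show ?thesis
    using assms(2) unfolding contraction(1) simple_graph_def contract_edge_def by simp
qed

definition F2 :: "nat ugraph" where
  "F2 = \<lparr>verts = {1, 2, 3, 4, 5},
     edges = {{1, 2}, {1, 5}, {2, 3}, {2, 4}, {3, 4}, {3, 5}, {4, 5}}\<rparr>"

lemma simple_graph_F2: "simple_graph F2"
  by (auto simp: simple_graph_def F2_def)


section \<open>Polynomial-time decidable languages\<close>

text \<open>The model of computation is a random access machine with unit cost, programmed in a
  structured language. Memory consists of arrays of natural numbers; a program mentions only
  finitely many of them, and a scalar is cell 0 of an array. Each executed assignment and each
  evaluated test costs one step: the expressions occurring in a program have constant size.
  There is no unit-cost multiplication, so the bit lengths of all numbers and addresses grow at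
  most linearly with the running time, and polynomial time has the same meaning as for
  Turing machines.\<close>

datatype expr =
    Const nat
  | Cell nat expr
  | Add expr expr
  | Sub expr expr

datatype com =
    Skip
  | Assign nat expr expr
  | Seq com com
  | Cond expr com com
  | Loop expr com

type_synonym memory = "nat \<Rightarrow> nat \<Rightarrow> nat"

fun val :: "expr \<Rightarrow> memory \<Rightarrow> nat" where
  "val (Const n) s = n"
| "val (Cell a e) s = s a (val e s)"
| "val (Add e e') s = val e s + val e' s"
| "val (Sub e e') s = val e s - val e' s"

text \<open>\<open>exec c s t s'\<close>: started in memory \<open>s\<close>, program \<open>c\<close> halts after \<open>t\<close> steps in memory \<open>s'\<close>.
  A test succeeds if its value is nonzero.\<close>

inductive exec :: "com \<Rightarrow> memory \<Rightarrow> nat \<Rightarrow> memory \<Rightarrow> bool" where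
  exec_Skip: "exec Skip s 1 s"
| exec_Assign: "exec (Assign a i e) s 1 (s(a := (s a)(val i s := val e s)))"
| exec_Seq: "exec c s t s' \<Longrightarrow> exec c' s' t' s'' \<Longrightarrow> exec (Seq c c') s (t + t') s''"
| exec_CondTrue: "val b s \<noteq> 0 \<Longrightarrow> exec c s t s' \<Longrightarrow> exec (Cond b c c') s (t + 1) s'"
| exec_CondFalse: "val b s = 0 \<Longrightarrow> exec c' s t s' \<Longrightarrow> exec (Cond b c c') s (t + 1) s'"
| exec_LoopTrue: "val b s \<noteq> 0 \<Longrightarrow> exec c s t s' \<Longrightarrow> exec (Loop b c) s' t' s'' \<Longrightarrow>
    exec (Loop b c) s (t + t' + 1) s''"
| exec_LoopFalse: "val b s = 0 \<Longrightarrow> exec (Loop b c) s 1 s"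

inductive_cases exec_SkipE: "exec Skip s t s'"
inductive_cases exec_AssignE: "exec (Assign a i e) s t s'"
inductive_cases exec_SeqE: "exec (Seq c c') s t s'"
inductive_cases exec_CondE: "exec (Cond b c c') s t s'"
inductive_cases exec_LoopE: "exec (Loop b c) s t s'"

lemma exec_deterministic:
  "exec c s t s' \<Longrightarrow> exec c s u r \<Longrightarrow> u = t \<and> r = s'"
proof (induction arbitrary: u r rule: exec.induct)
  case (exec_Skip s)
  then show ?case by (rule exec_SkipE) simp
next
  case (exec_Assign a i e s)
  then show ?case by (rule exec_AssignE) simp
next
  case (exec_Seq c s t s' c' t' s'')
  from exec_Seq.prems obtain t1 s1 t2
    where "exec c s t1 s1" "exec c' s1 t2 r" "u = t1 + t2"
    by (rule exec_SeqE)
  then show ?case using exec_Seq.IH by metis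
next
  case (exec_CondTrue b s c t s' c')
  from exec_CondTrue.prems exec_CondTrue.hyps(1) obtain t1
    where "exec c s t1 r" "u = t1 + 1"
    by (cases rule: exec_CondE) auto
  then show ?case using exec_CondTrue.IH by metis
next
  case (exec_CondFalse b s c' t s' c)
  from exec_CondFalse.prems exec_CondFalse.hyps(1) obtain t1
    where "exec c' s t1 r" "u = t1 + 1"
    by (cases rule: exec_CondE) auto
  then show ?case using exec_CondFalse.IH by metis
next
  case (exec_LoopTrue b s c t s' t' s'')
  from exec_LoopTrue.prems exec_LoopTrue.hyps(1) obtain t1 s1 t2
    where "exec c s t1 s1" "exec (Loop b c) s1 t2 r" "u = t1 + t2 + 1"
    by (cases rule: exec_LoopE) auto
  then show ?case using exec_LoopTrue.IH by metis
next
  case (exec_LoopFalse b s c)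
  from exec_LoopFalse.prems exec_LoopFalse.hyps show ?case
    by (cases rule: exec_LoopE) auto
qed

text \<open>Array 0 holds the input: its length in cell 0, then its bits. All other cells are zero.\<close>

definition input_memory :: "bool list \<Rightarrow> memory" where
  "input_memory x a i =
     (if a \<noteq> 0 then 0
      else if i = 0 then length x
      else if i \<le> length x then of_bool (x ! (i - 1))
      else 0)"

text \<open>The answer is read off cell 0 of array 1.\<close>

definition polytime_decidable :: "bool list set \<Rightarrow> bool" where
  "polytime_decidable L \<longleftrightarrow> (\<exists>(c :: com) (p :: nat poly). \<forall>x. \<exists>t s.
     exec c (input_memory x) t s \<and> t \<le> poly p (length x) \<and> (s 1 0 \<noteq> 0 \<longleftrightarrow> x \<in> L))"


section \<open>The problem \<open>H\<close>-Induced Minor\<close>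

text \<open>An input graph has vertex set \<open>{0..<n}\<close> and is encoded by its adjacency matrix, row by
  row. As the encoding has length \<open>n\<^sup>2\<close>, being polynomial in its length and in \<open>n\<close> are the same.\<close>

definition input_graph :: "nat ugraph \<Rightarrow> bool" where
  "input_graph G \<longleftrightarrow> simple_graph G \<and> verts G = {0..<card (verts G)}"

definition adjacency_string :: "nat ugraph \<Rightarrow> bool list" where
  "adjacency_string G = (let n = card (verts G) in
     map (\<lambda>k. {k div n, k mod n} \<in> edges G) [0..<n * n])"

definition induced_minor_problem :: "'a ugraph \<Rightarrow> bool list set" where
  "induced_minor_problem H =
     {adjacency_string G | G. input_graph G \<and> contains_induced_minor G H}"

lemma inj_on_adjacency_string: "inj_on adjacency_string {G. input_graph G}"
proof (rule inj_onI, clarify)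
  fix G G' :: "nat ugraph"
  assume G: "input_graph G" and G': "input_graph G'"
    and eq: "adjacency_string G = adjacency_string G'"
  define n where "n = card (verts G)"
  from arg_cong[OF eq, of length] have n': "card (verts G') = n"
    by (simp add: adjacency_string_def n_def Let_def flip: power2_eq_square)
  have V: "verts G = {0..<n}" "verts G' = {0..<n}"
    using G G' n' by (simp_all add: input_graph_def n_def)
  have edge: "{i, j} \<in> edges G \<longleftrightarrow> {i, j} \<in> edges G'" if "i < n" "j < n" for i j
  proof -
    have "i * n + j < n * n"
    proof -
      have "i * n + j < Suc i * n"
        using that by simp
      also have "\<dots> \<le> n * n"
        using that by (intro mult_right_mono) simp_all
      finally show ?thesis .
    qed
    moreover have "(i * n + j) div n = i" "(i * n + j) mod n = j"
      using that by simp_all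
    ultimately show ?thesis
      using arg_cong[OF eq, of "\<lambda>x. x ! (i * n + j)"] n'
      by (simp add: adjacency_string_def Let_def flip: n_def)
  qed
  have pair: "\<exists>i j. e = {i, j} \<and> i < n \<and> j < n" if "e \<in> edges G \<or> e \<in> edges G'" for e
  proof -
    have "e \<subseteq> {0..<n}" "card e = 2"
      using that G G' V by (auto simp: input_graph_def simple_graph_def)
    moreover obtain i j where "e = {i, j}"
      using \<open>card e = 2\<close> by (meson card_2_iff)
    ultimately show ?thesis
      by auto
  qed
  have "e \<in> edges G \<longleftrightarrow> e \<in> edges G'" for e
    using edge pair[of e] by metis
  then have "edges G = edges G'"
    by blast
  then show "G = G'"
    using V by simp
qed

end

theory Submission
  imports Defs
begin

text \<open>A model of \<open>F\<^sub>2\<close> with bags \<open>B\<^sub>1, \<dots>, B\<^sub>5\<close> is the same as a quadruple of connected sets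
  \<open>S = B\<^sub>2\<close>, \<open>T = B\<^sub>5\<close>, \<open>P = B\<^sub>1\<close>, \<open>K = B\<^sub>3 \<union> B\<^sub>4\<close> such that \<open>S\<close> and \<open>T\<close> are anticomplete, \<open>P\<close> is
  anticomplete to \<open>K\<close> and touches \<open>S\<close> and \<open>T\<close>, and no single vertex of \<open>K\<close> separates \<open>S\<close> from \<open>T\<close>
  within \<open>K\<close>: by Menger's theorem \<open>K\<close> then splits into two bags. Minimising the size of
  \<open>S \<union> T \<union> P\<close> shows that one of two kinds of quadruples exists: either \<open>S = {s}\<close>, \<open>T = {t}\<close> and
  \<open>K\<close> is a component of the graph without \<open>s\<close>, \<open>t\<close> and the closed neighbourhood of some \<open>v \<in> P\<close>
  adjacent to \<open>s\<close>, or \<open>S = {s}\<close>, \<open>P = {v}\<close> and \<open>T\<close> is a component of \<open>N(v) - N[s]\<close>. In both cases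
  the quadruple is determined by four vertices, up to taking connected components. Hence
  containment of \<open>F\<^sub>2\<close> is expressible in first-order logic with a reachability operator, and such
  formulas are evaluated in polynomial time by structural recursion.\<close>

section \<open>Connected sets\<close>

text \<open>The bags of a model can be arbitrarily large and cannot be enumerated; a formula can
  only name components of sets that are defined from boundedly many vertices. Two disjoint bags
  inside \<open>K\<close> cannot be named in this way, but the absence of a separating vertex can:
  it is tested for one deleted vertex \<open>c\<close> at a time, and it survives enlarging
  \<open>K\<close>, so \<open>K\<close> may be inflated to a whole component. The size that is
  minimised is weighted: 3 for a vertex of \<open>S\<close> or \<open>T\<close>, 2 for a vertex of
  \<open>P\<close>, and 0 for a vertex of \<open>K\<close>. Moving a vertex from a side into
  \<open>P\<close> is thus a gain, moving it into \<open>K\<close> a larger one, and shrinking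
  \<open>P\<close> is a gain as well. There are two minimisations. The first, over all quadruples,
  only shows that some quadruple has a singleton side. The second runs over the quadruples with such
  a side and produces one of the two kinds of witnesses.\<close>

locale sgraph =
  fixes E :: "'a \<Rightarrow> 'a \<Rightarrow> bool" and V :: "'a set"
  assumes finite_V: "finite V"
    and E_sym: "E a b \<Longrightarrow> E b a"
    and E_irrefl: "\<not> E a a"
    and E_V: "E a b \<Longrightarrow> a \<in> V"
begin

definition touch :: "'a set \<Rightarrow> 'a set \<Rightarrow> bool" where
  "touch A B \<longleftrightarrow> (\<exists>a\<in>A. \<exists>b\<in>B. E a b)"

text \<open>Stated by cuts, so that connectedness of a set is proved without building walks; walks
  enter only through \<open>cmp\<close>.\<close>

definition conn :: "'a set \<Rightarrow> bool" where
  "conn X \<longleftrightarrow> X \<noteq> {} \<and> (\<forall>Y. Y \<subset> X \<and> Y \<noteq> {} \<longrightarrow> touch Y (X - Y))"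

definition cmp :: "'a set \<Rightarrow> 'a \<Rightarrow> 'a set" where
  "cmp U x = {y. (\<lambda>a b. E a b \<and> a \<in> U \<and> b \<in> U)\<^sup>*\<^sup>* x y}"

lemma touch_commute: "touch A B \<longleftrightarrow> touch B A"
  unfolding touch_def using E_sym by blast

lemma touch_mono: "touch A B \<Longrightarrow> A \<subseteq> A' \<Longrightarrow> B \<subseteq> B' \<Longrightarrow> touch A' B'"
  unfolding touch_def by blast

lemma touch_empty [simp]: "\<not> touch {} B" "\<not> touch A {}"
  unfolding touch_def by auto

lemma touch_Un [simp]:
  "touch (A \<union> B) C \<longleftrightarrow> touch A C \<or> touch B C"
  "touch C (A \<union> B) \<longleftrightarrow> touch C A \<or> touch C B"
  unfolding touch_def by blast+

lemma touch_singletons [simp]: "touch {a} {b} \<longleftrightarrow> E a b"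
  unfolding touch_def by blast

lemma touchI: "E a b \<Longrightarrow> a \<in> A \<Longrightarrow> b \<in> B \<Longrightarrow> touch A B"
  unfolding touch_def by blast

lemma touchE:
  assumes "touch A B" obtains a b where "a \<in> A" "b \<in> B" "E a b"
  using assms unfolding touch_def by blast

lemma connD: "conn X \<Longrightarrow> Y \<subseteq> X \<Longrightarrow> Y \<noteq> X \<Longrightarrow> Y \<noteq> {} \<Longrightarrow> touch Y (X - Y)"
  unfolding conn_def by blast

lemma conn_nonempty: "conn X \<Longrightarrow> X \<noteq> {}"
  unfolding conn_def by blast

lemma conn_singleton [simp]: "conn {x}"
  unfolding conn_def by blast

lemma conn_Un:
  assumes A: "conn A" and B: "conn B" and AB: "touch A B \<or> A \<inter> B \<noteq> {}"
  shows "conn (A \<union> B)"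
  unfolding conn_def
proof (intro conjI allI impI)
  show "A \<union> B \<noteq> {}" using conn_nonempty[OF A] by blast
  fix Y assume Y: "Y \<subset> A \<union> B \<and> Y \<noteq> {}"
  show "touch Y (A \<union> B - Y)"
  proof (rule ccontr)
    assume n: "\<not> touch Y (A \<union> B - Y)"
    have key: "Y \<inter> Z = {} \<or> Z \<subseteq> Y" if Z: "conn Z" "Z \<subseteq> A \<union> B" for Z
    proof (rule ccontr)
      assume "\<not> ?thesis"
      then have "touch (Y \<inter> Z) (Z - Y \<inter> Z)" using Z by (intro connD) auto
      then have "touch Y (A \<union> B - Y)" by (rule touch_mono) (use Z in auto)
      then show False using n by blast
    qed
    have 1: "Y \<inter> A = {} \<or> A \<subseteq> Y" and 2: "Y \<inter> B = {} \<or> B \<subseteq> Y"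
      using key[OF A] key[OF B] by auto
    consider "A \<subseteq> Y" "Y \<inter> B = {}" | "B \<subseteq> Y" "Y \<inter> A = {}"
      using 1 2 Y by blast
    then show False
    proof cases
      case 1
      then have "touch A B" using AB by blast
      then have "touch Y (A \<union> B - Y)" by (rule touch_mono) (use 1 in auto)
      then show False using n by blast
    next
      case 2
      then have "touch B A" using AB touch_commute by blast
      then have "touch Y (A \<union> B - Y)" by (rule touch_mono) (use 2 in auto)
      then show False using n by blast
    qed
  qed
qed

lemma conn_insert:
  assumes "conn A" "touch {x} A"
  shows "conn (insert x A)"
  using conn_Un[OF conn_singleton[of x] assms(1)] assms(2) by simp

lemma conn_pair: "E a b \<Longrightarrow> conn {a, b}"
  by (rule conn_insert) simp_all

lemma conn_touch_Diff:
  assumes "conn X" "u \<in> X" "X \<noteq> {u}"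
  shows "touch {u} (X - {u})"
  using assms by (intro connD) auto

lemma conn_subset_closed:
  assumes "conn X" "\<not> touch C (U - C)" "X \<subseteq> U" "X \<inter> C \<noteq> {}"
  shows "X \<subseteq> C"
proof (rule ccontr)
  assume "\<not> X \<subseteq> C"
  then have "touch (X \<inter> C) (X - X \<inter> C)" using assms by (intro connD) auto
  then have "touch C (U - C)" using assms(3) by (elim touch_mono) auto
  then show False using assms by blast
qed

lemma cmp_refl [simp]: "x \<in> cmp U x"
  unfolding cmp_def by simp

lemma cmp_nonempty [simp]: "cmp U x \<noteq> {}"
  using cmp_refl[of x U] by blast

lemma cmp_subset: "x \<in> U \<Longrightarrow> cmp U x \<subseteq> U"
  unfolding cmp_def by (auto elim: rtranclp.cases)

lemma cmp_closed: "x \<in> U \<Longrightarrow> \<not> touch (cmp U x) (U - cmp U x)"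
proof
  assume x: "x \<in> U" and "touch (cmp U x) (U - cmp U x)"
  then obtain a b where ab: "a \<in> cmp U x" "b \<in> U" "b \<notin> cmp U x" "E a b"
    unfolding touch_def by blast
  have "a \<in> U" using cmp_subset[OF x] ab by blast
  then have "b \<in> cmp U x" using ab unfolding cmp_def by (auto intro: rtranclp.rtrancl_into_rtrancl)
  then show False using ab by blast
qed

lemma conn_cmp: "conn (cmp U x)"
proof -
  have reach: "cmp U x \<subseteq> Y" if x: "x \<in> Y" and Y: "\<not> touch Y (cmp U x - Y)" for Y
  proof
    fix z assume "z \<in> cmp U x"
    then have "(\<lambda>a b. E a b \<and> a \<in> U \<and> b \<in> U)\<^sup>*\<^sup>* x z" by (simp add: cmp_def)
    then have "z \<in> Y \<and> z \<in> cmp U x"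
    proof induction
      case base then show ?case using x by simp
    next
      case (step a b)
      then have "b \<in> cmp U x" unfolding cmp_def by (auto intro: rtranclp.rtrancl_into_rtrancl)
      moreover have "b \<in> Y"
      proof (rule ccontr)
        assume "b \<notin> Y"
        then have "touch Y (cmp U x - Y)" using step \<open>b \<in> cmp U x\<close> by (intro touchI[of a b]) auto
        then show False using Y by blast
      qed
      ultimately show ?case by blast
    qed
    then show "z \<in> Y" by blast
  qed
  show ?thesis unfolding conn_def
  proof (intro conjI allI impI)
    show "cmp U x \<noteq> {}" using cmp_refl by blast
    fix Y assume Y: "Y \<subset> cmp U x \<and> Y \<noteq> {}"
    show "touch Y (cmp U x - Y)"
    proof (cases "x \<in> Y")
      case True
      then show ?thesis using reach[of Y] Y by blast
    next
      case False
      \<comment> \<open>Contact is symmetric, so the cut may be read from the side that contains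
        \<open>x\<close>.\<close>
      have eq: "cmp U x - (cmp U x - Y) = Y" using Y by blast
      have "touch (cmp U x - Y) Y"
        using reach[of "cmp U x - Y", unfolded eq] False Y by auto
      then show ?thesis by (simp add: touch_commute)
    qed
  qed
qed

lemma conn_subset_cmp:
  assumes "conn X" "X \<subseteq> U" "x \<in> X"
  shows "X \<subseteq> cmp U x"
  using assms by (intro conn_subset_closed[OF assms(1) cmp_closed]) auto

text \<open>Take a maximal connected proper subset through \<open>r\<close>. It has a neighbour
  \<open>u\<close> in the rest of \<open>X\<close>; adding \<open>u\<close> keeps it connected, so
  by maximality \<open>u\<close> is all that was missing.\<close>

lemma obtain_noncut:
  assumes "conn X" "finite X" "r \<in> X" "X \<noteq> {r}"
  obtains u where "u \<in> X" "u \<noteq> r" "conn (X - {u})"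
proof -
  define P where "P Y \<longleftrightarrow> Y \<subset> X \<and> conn Y \<and> r \<in> Y" for Y
  have "P {r}" using assms by (auto simp: P_def)
  moreover have fin: "finite {Y. P Y}"
    by (rule finite_subset[of _ "Pow X"]) (use assms(2) in \<open>auto simp: P_def\<close>)
  ultimately obtain Y where Y: "P Y" and max: "\<And>Z. P Z \<Longrightarrow> Y \<subseteq> Z \<Longrightarrow> Z = Y"
    using finite_has_maximal[of "{Y. P Y}"] by blast
  have "touch Y (X - Y)" using Y assms(1) by (intro connD) (auto simp: P_def)
  then obtain u where u: "u \<in> X" "u \<notin> Y" "touch {u} Y"
    unfolding touch_def using E_sym by blast
  have "conn (insert u Y)" using conn_insert u Y by (simp add: P_def)
  then have "insert u Y = X" using max[of "insert u Y"] u Y by (auto simp: P_def)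
  then have "X - {u} = Y" using u by blast
  then show ?thesis using that[of u] u Y by (auto simp: P_def)
qed

lemma obtain_two_noncut:
  assumes "conn X" "finite X" "\<nexists>r. X = {r}"
  obtains u w where "u \<in> X" "w \<in> X" "u \<noteq> w" "conn (X - {u})" "conn (X - {w})"
proof -
  obtain r where r: "r \<in> X" using conn_nonempty[OF assms(1)] by blast
  obtain u where u: "u \<in> X" "conn (X - {u})"
    using obtain_noncut[OF assms(1,2) r] assms(3) by metis
  obtain w where "w \<in> X" "w \<noteq> u" "conn (X - {w})"
    using obtain_noncut[OF assms(1,2) u(1)] assms(3) by metis
  then show ?thesis using that u by blast
qed

text \<open>A minimal connected set meeting the neighbourhoods of \<open>A\<close> and \<open>B\<close> is a path; the lemma
  exposes its first vertex.\<close>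

lemma minimal_connector:
  assumes "conn R" "finite R" "touch R A" "touch R B"
    and minimal: "\<forall>R'. R' \<subset> R \<longrightarrow> conn R' \<longrightarrow> touch R' A \<longrightarrow> \<not> touch R' B"
  obtains x where "R = {x}"
  | x where "x \<in> R" "touch {x} A" "conn (R - {x})" "\<not> touch (R - {x}) A" "touch (R - {x}) B" "\<not> touch {x} B"
proof (cases "\<exists>r. R = {r}")
  case True
  then show ?thesis using that by blast
next
  case False
  note found = that
  have min: False if "R' \<subset> R" "conn R'" "touch R' A" "touch R' B" for R'
    using minimal that by blast
  obtain u w where uw: "u \<in> R" "w \<in> R" "u \<noteq> w" "conn (R - {u})" "conn (R - {w})"
    using obtain_two_noncut assms(1,2) False by metis
  have key: thesis if x: "x \<in> R" "conn (R - {x})" "\<not> touch (R - {x}) A" for x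
  proof -
    have R: "R = {x} \<union> (R - {x})" using x by blast
    have xA: "touch {x} A" using assms(3) x(3) R by (metis touch_Un(1))
    have "{x} \<subset> R" using False x(1) by blast
    then have "\<not> touch {x} B" using min[of "{x}"] xA by auto
    moreover from this have "touch (R - {x}) B" using assms(4) R by (metis touch_Un(1))
    ultimately show thesis using found(2)[of x] x xA by blast
  qed
  show ?thesis
  proof (cases "touch (R - {u}) A")
    case True
    \<comment> \<open>If deleting \<open>u\<close> keeps the contact with \<open>A\<close>,
      minimality makes \<open>u\<close> the only contact with \<open>B\<close>. Deleting
      \<open>w\<close> instead keeps \<open>u\<close>, so it must lose the contact with
      \<open>A\<close>.\<close>
    then have "\<not> touch (R - {u}) B" using min[of "R - {u}"] uw by blast
    moreover have "R = {u} \<union> (R - {u})" using uw by blast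
    ultimately have uB: "touch {u} B" using assms(4) by (metis touch_Un(1))
    have "touch (R - {w}) B" using uB by (rule touch_mono) (use uw in auto)
    then have "\<not> touch (R - {w}) A" using min[of "R - {w}"] uw by blast
    then show ?thesis using key uw by blast
  next
    case False
    then show ?thesis using key uw by blast
  qed
qed

section \<open>Menger's theorem for two disjoint connections\<close>

text \<open>Menger's hypothesis with connected sets in place of paths. A \<open>c\<close> outside
  \<open>K\<close> asks for a connection without any deletion.\<close>

definition robust :: "'a set \<Rightarrow> 'a set \<Rightarrow> 'a set \<Rightarrow> bool" where
  "robust K A B \<longleftrightarrow> (\<forall>c. \<exists>X \<subseteq> K - {c}. conn X \<and> X \<inter> A \<noteq> {} \<and> X \<inter> B \<noteq> {})"

lemma robust_commute: "robust K A B \<longleftrightarrow> robust K B A"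
  unfolding robust_def by (simp only: conj_ac)

lemma robustD: "robust K A B \<Longrightarrow> \<exists>X \<subseteq> K - {c}. conn X \<and> X \<inter> A \<noteq> {} \<and> X \<inter> B \<noteq> {}"
  unfolding robust_def by (rule spec)

text \<open>A connection from \<open>A\<close> to \<open>B\<close> that avoids \<open>c\<close> must
  meet \<open>{x, z}\<close>. Cut it at its first contact with this separator: the component of its
  start outside \<open>{x, z}\<close>, together with the vertex \<open>x\<close> or \<open>z\<close>
  through which it is left, stays in the half next to \<open>A\<close> and still avoids
  \<open>c\<close>.\<close>

lemma robust_side:
  assumes rob: "robust K A B"
    and sep: "\<And>X. X \<subseteq> K - {x, z} \<Longrightarrow> conn X \<Longrightarrow> X \<inter> A \<noteq> {} \<Longrightarrow> X \<inter> B \<noteq> {} \<Longrightarrow> False"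
  shows "robust (\<Union>{X. X \<subseteq> K - {x, z} \<and> conn X \<and> X \<inter> A \<noteq> {}} \<union> {x, z}) A {x, z}"
    (is "robust (?L \<union> _) _ _")
  unfolding robust_def
proof
  fix c
  obtain X where X: "X \<subseteq> K - {c}" "conn X" "X \<inter> A \<noteq> {}" "X \<inter> B \<noteq> {}"
    using robustD[OF rob, of c] by (elim exE conjE)
  obtain a where a: "a \<in> X" "a \<in> A" using X by blast
  show "\<exists>X' \<subseteq> ?L \<union> {x, z} - {c}. conn X' \<and> X' \<inter> A \<noteq> {} \<and> X' \<inter> {x, z} \<noteq> {}"
  proof (cases "a \<in> {x, z}")
    case True
    have "{a} \<subseteq> ?L \<union> {x, z} - {c}" using True a X(1) by blast
    then show ?thesis using True a by (intro exI[of _ "{a}"]) auto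
  next
    case False
    let ?C = "cmp (X - {x, z}) a"
    have aU: "a \<in> X - {x, z}" using False a by blast
    note CU = cmp_subset[OF aU]
    have aC: "a \<in> ?C" by simp
    have "?C \<noteq> X"
      using sep[of ?C] CU aC a X conn_cmp by blast
    then have "touch ?C (X - ?C)" using CU aC by (intro connD[OF X(2)]) auto
    then obtain d e where de: "d \<in> ?C" "e \<in> X" "e \<notin> ?C" "E d e" unfolding touch_def by blast
    have e: "e \<in> {x, z}"
    proof (rule ccontr)
      assume "e \<notin> {x, z}"
      then have "touch ?C (X - {x, z} - ?C)" using de by (intro touchI[of d e]) auto
      then show False using cmp_closed[OF aU] by blast
    qed
    have "conn (insert e ?C)"
      using de E_sym by (intro conn_insert conn_cmp) (auto simp: touch_def)
    moreover have "?C \<subseteq> ?L"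
    proof (rule Union_upper, rule CollectI, intro conjI)
      show "?C \<subseteq> K - {x, z}" using CU X(1) by blast
      show "?C \<inter> A \<noteq> {}" using aC a(2) by blast
    qed (rule conn_cmp)
    moreover have "e \<noteq> c" "c \<notin> ?C" using de(2) X(1) CU by blast+
    moreover have "insert e ?C \<inter> A \<noteq> {}" using aC a(2) by blast
    ultimately show ?thesis
      using e by (intro exI[of _ "insert e ?C"]) blast
  qed
qed

text \<open>Menger's theorem for two paths. A vertex outside \<open>A \<union> B\<close> is either superfluous or belongs
  to a separator of size two, along which the two halves are glued.\<close>

lemma menger_two:
  assumes "finite K" "robust K A B"
  shows "\<exists>X Y. X \<subseteq> K \<and> Y \<subseteq> K \<and> X \<inter> Y = {} \<and> conn X \<and> conn Y \<and>
    X \<inter> A \<noteq> {} \<and> X \<inter> B \<noteq> {} \<and> Y \<inter> A \<noteq> {} \<and> Y \<inter> B \<noteq> {}"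
  using assms
proof (induction "card K" arbitrary: K A B rule: less_induct)
  case less
  note rob = less.prems(2)
  have robD: "\<exists>X \<subseteq> K - {c}. conn X \<and> X \<inter> A \<noteq> {} \<and> X \<inter> B \<noteq> {}" for c
    by (rule robustD[OF rob])
  show ?case
  proof (cases "K \<subseteq> A \<union> B")
    case False
    then obtain x where x: "x \<in> K" "x \<notin> A" "x \<notin> B" by blast
    show ?thesis
    proof (cases "robust (K - {x}) A B")
      case True
      have "card (K - {x}) < card K" using card_Diff1_less[OF less.prems(1) x(1)] .
      from less.hyps[OF this _ True] less.prems(1) obtain X Y where
        "X \<subseteq> K - {x}" "Y \<subseteq> K - {x}" "X \<inter> Y = {}" "conn X" "conn Y"
        "X \<inter> A \<noteq> {}" "X \<inter> B \<noteq> {}" "Y \<inter> A \<noteq> {}" "Y \<inter> B \<noteq> {}"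
        by (auto simp del: disjoint_iff)
      then show ?thesis by (intro exI[of _ X] exI[of _ Y]) auto
    next
      case False
      then obtain z where z: "\<not> (\<exists>X \<subseteq> K - {x} - {z}. conn X \<and> X \<inter> A \<noteq> {} \<and> X \<inter> B \<noteq> {})"
        unfolding robust_def by blast
      have sep: False if "X \<subseteq> K - {x, z}" "conn X" "X \<inter> A \<noteq> {}" "X \<inter> B \<noteq> {}" for X
      proof -
        have "X \<subseteq> K - {x} - {z}" using that by blast
        then show False using z that by blast
      qed
      define L where "L = \<Union>{X. X \<subseteq> K - {x, z} \<and> conn X \<and> X \<inter> A \<noteq> {}}"
      define R where "R = \<Union>{X. X \<subseteq> K - {x, z} \<and> conn X \<and> X \<inter> B \<noteq> {}}"
      have disj: "L \<inter> R = {}"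
      proof (rule ccontr)
        assume "L \<inter> R \<noteq> {}"
        then obtain y X X' where y: "y \<in> X" "y \<in> X'" and X: "X \<subseteq> K - {x, z}" "conn X" "X \<inter> A \<noteq> {}"
          and X': "X' \<subseteq> K - {x, z}" "conn X'" "X' \<inter> B \<noteq> {}" unfolding L_def R_def by blast
        have "conn (X \<union> X')" using y X X' by (intro conn_Un) auto
        then show False using sep[of "X \<union> X'"] X X' by blast
      qed
      have xzK: "x \<in> K" "z \<in> K" "z \<noteq> x"
      proof -
        show "x \<in> K" by (rule x)
        \<comment> \<open>A connection that avoids \<open>x\<close> is forced through
          \<open>z\<close>.\<close>
        obtain X where X: "X \<subseteq> K - {x}" "conn X" "X \<inter> A \<noteq> {}" "X \<inter> B \<noteq> {}"
          using robD[of x] by (elim exE conjE)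
        then have "z \<in> X" using sep[of X] by blast
        then show "z \<in> K" "z \<noteq> x" using X by auto
      qed
      have LK: "L \<union> {x, z} \<subseteq> K" and RK: "R \<union> {x, z} \<subseteq> K" using xzK by (auto simp: L_def R_def)
      \<comment> \<open>The ends \<open>a\<close> and \<open>b\<close> of a connection avoiding
        \<open>z\<close> lie in different halves and outside \<open>{x, z}\<close>. So each half
        misses a vertex of \<open>K\<close>, and the induction hypothesis applies to both.\<close>
      obtain X where X: "X \<subseteq> K - {z}" "conn X" "X \<inter> A \<noteq> {}" "X \<inter> B \<noteq> {}"
        using robD[of z] by (elim exE conjE)
      then obtain a b where ab: "a \<in> X" "a \<in> A" "b \<in> X" "b \<in> B" by blast
      have nxz: "a \<noteq> x" "b \<noteq> x" "a \<noteq> z" "b \<noteq> z" "a \<in> K" "b \<in> K" using ab x X(1) by auto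
      have "a \<in> L"
        unfolding L_def by (rule UnionI[of "{a}"]) (use ab nxz in simp_all)
      have "b \<in> R"
        unfolding R_def by (rule UnionI[of "{b}"]) (use ab nxz in simp_all)
      have "b \<notin> L \<union> {x, z}" using disjoint_iff[THEN iffD1, OF disj] \<open>b \<in> R\<close> nxz by (metis Un_iff insertE singletonD)
      then have "L \<union> {x, z} \<subset> K" using LK nxz by blast
      then have cL: "card (L \<union> {x, z}) < card K" using less.prems(1) psubset_card_mono by blast
      have "a \<notin> R \<union> {x, z}" using disjoint_iff[THEN iffD1, OF disj] \<open>a \<in> L\<close> nxz by (metis Un_iff insertE singletonD)
      then have "R \<union> {x, z} \<subset> K" using RK nxz by blast
      then have cR: "card (R \<union> {x, z}) < card K" using less.prems(1) psubset_card_mono by blast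
      have fL: "finite (L \<union> {x, z})" and fR: "finite (R \<union> {x, z})"
        using LK RK less.prems(1) finite_subset by blast+
      have rL: "robust (L \<union> {x, z}) A {x, z}"
        by (unfold L_def, rule robust_side[OF rob]) (rule sep)
      have rR: "robust (R \<union> {x, z}) B {x, z}"
        unfolding R_def
      proof (rule robust_side[of K B A])
        show "robust K B A" using rob by (simp add: robust_commute)
      qed (rule sep)
      \<comment> \<open>Disjoint sets that both meet \<open>{x, z}\<close> contain exactly one of
        these vertices each. Naming them by that vertex tells which set of one half is to be glued
        to which set of the other.\<close>
      have pairing: "\<exists>Y1 Y2. Y1 \<subseteq> M \<union> {x} \<and> Y2 \<subseteq> M \<union> {z} \<and> Y1 \<inter> Y2 = {} \<and>
          conn Y1 \<and> conn Y2 \<and> x \<in> Y1 \<and> z \<in> Y2 \<and> Y1 \<inter> C \<noteq> {} \<and> Y2 \<inter> C \<noteq> {}"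
        if ex: "\<exists>X Y. X \<subseteq> M \<union> {x, z} \<and> Y \<subseteq> M \<union> {x, z} \<and> X \<inter> Y = {} \<and> conn X \<and> conn Y \<and>
          X \<inter> C \<noteq> {} \<and> X \<inter> {x, z} \<noteq> {} \<and> Y \<inter> C \<noteq> {} \<and> Y \<inter> {x, z} \<noteq> {}" for M C
      proof -
        obtain X Y where XY: "X \<subseteq> M \<union> {x, z}" "Y \<subseteq> M \<union> {x, z}" "X \<inter> Y = {}" "conn X" "conn Y"
          "X \<inter> C \<noteq> {}" "X \<inter> {x, z} \<noteq> {}" "Y \<inter> C \<noteq> {}" "Y \<inter> {x, z} \<noteq> {}" using ex by (elim exE conjE)
        show ?thesis
        proof (cases "x \<in> X")
          case True
          then have "x \<notin> Y" "z \<in> Y" "z \<notin> X" using XY by auto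
          then show ?thesis using XY True by (intro exI[of _ X] exI[of _ Y]) auto
        next
          case False
          then have "z \<in> X" "x \<in> Y" "z \<notin> Y" using XY by auto
          then show ?thesis using XY False by (intro exI[of _ Y] exI[of _ X]) auto
        qed
      qed
      obtain Y1 Y2 where Y: "Y1 \<subseteq> L \<union> {x}" "Y2 \<subseteq> L \<union> {z}" "Y1 \<inter> Y2 = {}" "conn Y1" "conn Y2"
        "x \<in> Y1" "z \<in> Y2" "Y1 \<inter> A \<noteq> {}" "Y2 \<inter> A \<noteq> {}"
        using pairing[OF less.hyps[OF cL fL rL]] by (elim exE conjE)
      obtain Z1 Z2 where Z: "Z1 \<subseteq> R \<union> {x}" "Z2 \<subseteq> R \<union> {z}" "Z1 \<inter> Z2 = {}" "conn Z1" "conn Z2"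
        "x \<in> Z1" "z \<in> Z2" "Z1 \<inter> B \<noteq> {}" "Z2 \<inter> B \<noteq> {}"
        using pairing[OF less.hyps[OF cR fR rR]] by (elim exE conjE)
      have xz: "x \<notin> L" "z \<notin> L" "x \<notin> R" "z \<notin> R" by (auto simp: L_def R_def)
      have "(Y1 \<union> Z1) \<inter> (Y2 \<union> Z2) = {}"
      proof -
        have "P \<inter> Q = {}" if "P \<subseteq> L \<union> {x}" "Q \<subseteq> R \<union> {z}" "L \<inter> R = {}" "x \<notin> R" "z \<notin> L" for P Q L R :: "'a set"
          using that xzK(3) by blast
        from this[OF Y(1) Z(2) disj xz(3,2)] this[OF Z(1) Y(2) _ xz(1,4)] disj
        show ?thesis using Y(3) Z(3) by (simp add: Int_Un_distrib Int_Un_distrib2 Int_commute)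
      qed
      moreover have "conn (Y1 \<union> Z1)" "conn (Y2 \<union> Z2)" using Y(4-7) Z(4-7) by (auto intro!: conn_Un)
      moreover have "Y1 \<union> Z1 \<subseteq> K" "Y2 \<union> Z2 \<subseteq> K" using Y(1,2) Z(1,2) LK RK by blast+
      moreover have "(Y1 \<union> Z1) \<inter> A \<noteq> {}" "(Y2 \<union> Z2) \<inter> A \<noteq> {}" using Y(8,9) by blast+
      moreover have "(Y1 \<union> Z1) \<inter> B \<noteq> {}" "(Y2 \<union> Z2) \<inter> B \<noteq> {}" using Z(8,9) by blast+
      ultimately show ?thesis by (intro exI[of _ "Y1 \<union> Z1"] exI[of _ "Y2 \<union> Z2"] conjI)
    qed
  next
    case KAB: True
    show ?thesis
    proof (cases "\<exists>w. w \<in> A \<and> w \<in> B \<and> w \<in> K")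
      case True
      then obtain w where w: "w \<in> A" "w \<in> B" "w \<in> K" by blast
      obtain X where "X \<subseteq> K - {w}" "conn X" "X \<inter> A \<noteq> {}" "X \<inter> B \<noteq> {}"
          using robD[of w] by (elim exE conjE)
      then show ?thesis using w by (intro exI[of _ X] exI[of _ "{w}"]) auto
    next
      case False
      \<comment> \<open>Inside \<open>K\<close> every vertex is now in exactly one of
        \<open>A\<close> and \<open>B\<close>, so a connection avoiding \<open>c\<close> contains an
        edge between the two.\<close>
      have edge: "\<exists>a b. a \<in> A \<inter> K \<and> b \<in> B \<inter> K \<and> a \<noteq> c \<and> b \<noteq> c \<and> E a b" for c
      proof -
        obtain X where X: "X \<subseteq> K - {c}" "conn X" "X \<inter> A \<noteq> {}" "X \<inter> B \<noteq> {}"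
          using robD[of c] by (elim exE conjE)
        have "touch (X \<inter> A) (X - X \<inter> A)" using X False by (intro connD) auto
        then show ?thesis using X(1) KAB unfolding touch_def by blast
      qed
      \<comment> \<open>Koenig's theorem in its smallest case: no single vertex covers all edges
        between \<open>A\<close> and \<open>B\<close>, hence two of them are disjoint.\<close>
      have "\<exists>a b a' b'. a \<in> A \<inter> K \<and> b \<in> B \<inter> K \<and> a' \<in> A \<inter> K \<and> b' \<in> B \<inter> K \<and> a \<noteq> a' \<and> b \<noteq> b' \<and> E a b \<and> E a' b'"
      proof -
        obtain a b where 1: "a \<in> A \<inter> K" "b \<in> B \<inter> K" "E a b" using edge by blast
        obtain a' b' where 2: "a' \<in> A \<inter> K" "b' \<in> B \<inter> K" "a' \<noteq> a" "E a' b'" using edge[of a] by blast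
        obtain a'' b'' where 3: "a'' \<in> A \<inter> K" "b'' \<in> B \<inter> K" "b'' \<noteq> b" "E a'' b''" using edge[of b] by blast
        show ?thesis
        proof (cases "a'' = a")
          case True
          then show ?thesis
            using 1 2 3 by (cases "b' = b") blast+
        next
          case False
          then show ?thesis using 1 3 by blast
        qed
      qed
      then obtain a b a' b' where "a \<in> A \<inter> K" "b \<in> B \<inter> K" "a' \<in> A \<inter> K" "b' \<in> B \<inter> K"
        "a \<noteq> a'" "b \<noteq> b'" "E a b" "E a' b'" by blast
      then show ?thesis using conn_pair False by (intro exI[of _ "{a, b}"] exI[of _ "{a', b'}"]) auto
    qed
  qed
qed

section \<open>Sets linked through a third set\<close>

text \<open>This is \<open>robust\<close> between the neighbourhoods of \<open>S\<close> and
  \<open>T\<close>, phrased by contact because \<open>K\<close> is to be disjoint from both.\<close>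

definition linked :: "'a set \<Rightarrow> 'a set \<Rightarrow> 'a set \<Rightarrow> bool" where
  "linked K S T \<longleftrightarrow> (\<forall>c. \<exists>X \<subseteq> K - {c}. conn X \<and> touch X S \<and> touch X T)"

lemma linkedD: "linked K S T \<Longrightarrow> \<exists>X \<subseteq> K - {c}. conn X \<and> touch X S \<and> touch X T"
  unfolding linked_def by (rule spec)

lemma linkedI:
  assumes "\<And>c. \<exists>X \<subseteq> K - {c}. conn X \<and> touch X S \<and> touch X T"
  shows "linked K S T"
  using assms unfolding linked_def by (rule allI)

lemma linked_commute: "linked K S T \<longleftrightarrow> linked K T S"
  unfolding linked_def by (simp only: conj_ac)

lemma linked_touch: "linked K S T \<Longrightarrow> touch K S" "linked K S T \<Longrightarrow> touch K T"
  unfolding linked_def touch_def by blast+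

text \<open>The easy half of Menger's theorem: \<open>c\<close> lies in at most one of
  \<open>X\<close> and \<open>Y\<close>, and the other one survives.\<close>

lemma linked_two:
  assumes "X \<subseteq> K" "Y \<subseteq> K" "X \<inter> Y = {}" "conn X" "conn Y"
    "touch X S" "touch X T" "touch Y S" "touch Y T"
  shows "linked K S T"
proof (rule linkedI)
  fix c
  show "\<exists>X \<subseteq> K - {c}. conn X \<and> touch X S \<and> touch X T"
  proof (cases "c \<in> X")
    case True
    then have "Y \<subseteq> K - {c}" using assms by blast
    then show ?thesis using assms by blast
  next
    case False
    then have "X \<subseteq> K - {c}" using assms by blast
    then show ?thesis using assms by blast
  qed
qed

lemma linked_split:
  assumes "linked K S T" "conn K" "finite K"
  obtains X Y where "X \<subseteq> K" "Y \<subseteq> K" "X \<inter> Y = {}" "conn X" "conn Y" "touch X Y"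
    "touch X S" "touch X T" "touch Y S" "touch Y T"
proof -
  define N where "N A = {k. touch {k} A}" for A
  have N: "X \<inter> N A \<noteq> {} \<longleftrightarrow> touch X A" for X A
    unfolding N_def touch_def by blast
  have "robust K (N S) (N T)"
    using assms(1) unfolding robust_def linked_def N by blast
  from menger_two[OF assms(3) this, unfolded N] obtain X Y where XY: "X \<subseteq> K" "Y \<subseteq> K" "X \<inter> Y = {}"
    "conn X" "conn Y" "touch X S" "touch X T" "touch Y S" "touch Y T" by blast
  obtain y where y: "y \<in> Y" using conn_nonempty[OF XY(5)] by blast
  \<comment> \<open>The sets from Menger's theorem need not touch each other. Enlarging
    \<open>Y\<close> to its component of \<open>K - X\<close> repairs this: \<open>K\<close> is
    connected, so the component can be left only into \<open>X\<close>.\<close>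
  let ?C = "cmp (K - X) y"
  have yU: "y \<in> K - X" using y XY by blast
  have YC: "Y \<subseteq> ?C" by (rule conn_subset_cmp) (use XY y in auto)
  have CU: "?C \<subseteq> K - X" by (rule cmp_subset[OF yU])
  have "touch ?C (K - ?C)"
  proof (rule connD[OF assms(2)])
    show "?C \<subseteq> K" "?C \<noteq> K" using CU XY(1) conn_nonempty[OF XY(4)] by blast+
    show "?C \<noteq> {}" using cmp_refl[of y] by blast
  qed
  moreover have "K - ?C = X \<union> (K - X - ?C)" using CU XY(1) by blast
  ultimately have "touch ?C X" using cmp_closed[OF yU] by (metis touch_Un(2))
  moreover have "touch ?C S" "touch ?C T" using touch_mono[OF XY(8) YC order_refl] touch_mono[OF XY(9) YC order_refl] .
  ultimately show ?thesis
    using that[of X ?C] XY CU conn_cmp touch_commute by blast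
qed

section \<open>Quadruples equivalent to models of \<open>F\<^sub>2\<close>\<close>

definition quad :: "'a set \<Rightarrow> 'a set \<Rightarrow> 'a set \<Rightarrow> 'a set \<Rightarrow> bool" where
  "quad S T P K \<longleftrightarrow> S \<subseteq> V \<and> T \<subseteq> V \<and> P \<subseteq> V \<and> K \<subseteq> V \<and>
     conn S \<and> conn T \<and> conn P \<and> conn K \<and>
     S \<inter> T = {} \<and> S \<inter> P = {} \<and> S \<inter> K = {} \<and> T \<inter> P = {} \<and> T \<inter> K = {} \<and> P \<inter> K = {} \<and>
     \<not> touch S T \<and> \<not> touch P K \<and> touch P S \<and> touch P T \<and> linked K S T"

definition split :: "'a set \<Rightarrow> 'a set \<Rightarrow> 'a set \<Rightarrow> 'a set \<Rightarrow> 'a set \<Rightarrow> bool" where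
  "split K S T X Y \<longleftrightarrow> X \<subseteq> K \<and> Y \<subseteq> K \<and> X \<inter> Y = {} \<and> conn X \<and> conn Y \<and> touch X Y \<and>
     touch X S \<and> touch X T \<and> touch Y S \<and> touch Y T"

lemma quadD:
  assumes "quad S T P K"
  shows "S \<subseteq> V" "T \<subseteq> V" "P \<subseteq> V" "K \<subseteq> V" "conn S" "conn T" "conn P" "conn K"
    "S \<inter> T = {}" "S \<inter> P = {}" "S \<inter> K = {}" "T \<inter> P = {}" "T \<inter> K = {}" "P \<inter> K = {}"
    "\<not> touch S T" "\<not> touch P K" "touch P S" "touch P T" "linked K S T"
    "finite S" "finite T" "finite P" "finite K"
  using assms finite_V unfolding quad_def by (auto intro: finite_subset)

lemma quad_commute: "quad S T P K \<Longrightarrow> quad T S P K"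
  unfolding quad_def by (simp add: Int_commute touch_commute linked_commute)

lemma quad_split: "quad S T P K \<Longrightarrow> \<exists>X Y. split K S T X Y"
  unfolding split_def using linked_split quadD(8,19,23) by metis

lemma touch_insert:
  "touch (insert a A) C \<longleftrightarrow> touch {a} C \<or> touch A C"
  "touch C (insert a A) \<longleftrightarrow> touch C {a} \<or> touch C A"
  unfolding touch_def by blast+

lemma touch_remove: "u \<in> S \<Longrightarrow> touch A S \<longleftrightarrow> touch A {u} \<or> touch A (S - {u})"
  unfolding touch_def by blast

lemma linked_mono:
  assumes "linked K S T" "\<And>X. X \<subseteq> K \<Longrightarrow> touch X S \<Longrightarrow> touch X S'"
  shows "linked K S' T"
  using assms unfolding linked_def by (meson Diff_subset order.trans)

section \<open>Exchange arguments in minimal quadruples\<close>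

text \<open>A vertex \<open>u\<close> whose removal leaves \<open>S\<close> connected can be moved
  into \<open>P\<close> or \<open>K\<close> or be dropped, unless all three claims hold.
  \<open>T\<close> stays fixed in the comparison, so that the lemma applies both to the global
  minimum and to the minimum among quadruples with a prescribed singleton side.\<close>

lemma minimal_quad_noncut:
  assumes q: "quad S T P K" and u: "u \<in> S" "conn (S - {u})"
    and le: "\<forall>S' P' K'. quad S' T P' K' \<longrightarrow>
      3 * card S + 2 * card P \<le> 3 * card S' + 2 * card P'"
  shows "touch P {u}" "touch K {u}" "split K S T X Y \<Longrightarrow> \<not> touch X (S - {u}) \<or> \<not> touch Y (S - {u})"
proof -
  note qd = quadD[OF q]
  have min: False if "quad S' T P' K'" "3 * card S' + 2 * card P' < 3 * card S + 2 * card P" for S' P' K'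
    using le that by (meson not_le)
  define R where "R = S - {u}"
  have R: "conn R" "R \<subseteq> S" "u \<notin> R" using u by (auto simp: R_def)
  have cS: "card S = Suc (card R)" using card_Suc_Diff1[OF qd(20) u(1)] unfolding R_def by simp
  have cR: "card R > 0" using R(1,2) conn_nonempty[OF R(1)] qd(20) by (simp add: card_gt_0_iff finite_subset)
  have uR: "touch {u} R"
    unfolding R_def by (rule conn_touch_Diff[OF qd(5) u(1)]) (use conn_nonempty[OF u(2)] in auto)
  have uR': "touch R {u}" using uR touch_commute by blast
  have S_iff: "touch A S \<longleftrightarrow> touch A {u} \<or> touch A R" for A
    unfolding R_def by (rule touch_remove[OF u(1)])
  have "touch S A \<longleftrightarrow> touch {u} A \<or> touch R A" for A
    using S_iff[of A] touch_commute by blast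
  then have nT: "\<not> touch {u} T" "\<not> touch R T" using qd(15) by auto
  have uP: "u \<notin> P" "u \<notin> T" "u \<notin> K" "u \<in> V" "R \<subseteq> V" "R \<inter> P = {}" "R \<inter> T = {}" "R \<inter> K = {}"
    using R(2,3) u(1) qd(1,9,10,11) by blast+
  then have RI: "P \<inter> R = {}" "T \<inter> R = {}" "K \<inter> R = {}" by blast+
  have cPu: "card (P \<union> {u}) = Suc (card P)" "card (P \<union> R) = card P + card R"
    using uP qd(22,20) R(2) by (auto simp: card_Un_disjoint Int_commute finite_subset)
  have KT: "touch K T" using linked_touch(2)[OF qd(19)] .
  \<comment> \<open>If \<open>P\<close> meets \<open>S\<close> only at \<open>u\<close>, there is a
    cheaper quadruple in each case. If \<open>K\<close> misses \<open>u\<close>, then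
    \<open>u\<close> joins \<open>P\<close>. Otherwise the side becomes \<open>{u}\<close>, and
    \<open>R\<close> joins \<open>K\<close> or is dropped according to whether \<open>K\<close>
    touches it.\<close>
  have PR: "touch P R"
  proof (rule ccontr)
    assume n: "\<not> touch P R"
    then have Pu: "touch P {u}" using S_iff qd(17) by blast
    show False
    proof (cases "touch K {u}")
      case False
      have "linked K R T"
        by (rule linked_mono[OF qd(19)]) (use False S_iff touch_mono[of _ "{u}" K] in blast)
      moreover have "conn (P \<union> {u})" using Pu by (intro conn_Un qd(7)) auto
      moreover have "\<not> touch {u} K" using False touch_commute by blast
      ultimately have "quad R T (P \<union> {u}) K"
        unfolding quad_def using qd uP nT R(1,3) uR by (simp add: touch_insert[where a = u and A = P])
      then show False using min cS cPu by force
    next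
      case True
      show False
      proof (cases "touch K R")
        case True': True
        have "linked (K \<union> R) {u} T"
        proof (rule linkedI)
          fix c
          show "\<exists>X \<subseteq> K \<union> R - {c}. conn X \<and> touch X {u} \<and> touch X T"
          proof (cases "c \<in> R")
            case False
            obtain X where X: "X \<subseteq> K - {c}" "conn X" "touch X S" "touch X T"
              using linkedD[OF qd(19), of c] by (elim exE conjE)
            show ?thesis
            proof (cases "touch X {u}")
              case True
              then show ?thesis using X by blast
            next
              case False': False
              then have "conn (X \<union> R)" using X S_iff R(1) by (intro conn_Un) auto
              then show ?thesis using X uR' False by (intro exI[of _ "X \<union> R"]) auto
            qed
          next
            case c: True
            then have "K \<subseteq> K \<union> R - {c}" using uP by blast
            then show ?thesis using KT True qd(8) by (intro exI[of _ K] conjI)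
          qed
        qed
        moreover have "conn (K \<union> R)" using True' R(1) by (intro conn_Un qd(8)) auto
        ultimately have "quad {u} T P (K \<union> R)"
          unfolding quad_def using qd uP RI nT(1) R(3) n Pu
          by (simp add: Int_Un_distrib Int_Un_distrib2)
        then show False using min cS cR by force
      next
        case F: False
        have "linked K {u} T"
          by (rule linked_mono[OF qd(19)]) (use F S_iff touch_mono[of _ R K] in blast)
        then have "quad {u} T P K"
          unfolding quad_def using qd uP nT Pu by auto
        then show False using min cS cR by force
      qed
    qed
  qed
  \<comment> \<open>Otherwise all of \<open>R\<close> could join \<open>P\<close>, which pays
    because a vertex weighs 2 in \<open>P\<close> and 3 in a side.\<close>
  have KR: "touch K R"
  proof (rule ccontr)
    assume n: "\<not> touch K R"
    have "linked K {u} T"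
      by (rule linked_mono[OF qd(19)]) (use n S_iff touch_mono[of _ R K] in blast)
    moreover have "conn (P \<union> R)" using PR R(1) by (intro conn_Un qd(7)) auto
    moreover have "\<not> touch R K" using n touch_commute by blast
    ultimately have "quad {u} T (P \<union> R) K"
      unfolding quad_def using qd uP RI nT(1) uR' R(3)
      by (simp add: Int_Un_distrib Int_Un_distrib2)
    then show False using min cS cPu cR by force
  qed
  \<comment> \<open>If both parts of a split kept contact with \<open>R\<close>, then
    \<open>u\<close> could simply be dropped.\<close>
  have sp: "\<not> touch X R \<or> \<not> touch Y R" if "split K S T X Y" for X Y
  proof (rule ccontr)
    assume "\<not> ?thesis"
    then have "linked K R T"
      using that by (intro linked_two[of X K Y]) (auto simp: split_def)
    then have "quad R T P K"
      unfolding quad_def using qd uP nT PR R(1) by auto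
    then show False using min cS by force
  qed
  obtain X Y where XY: "split K S T X Y" using quad_split[OF q] by blast
  then have "touch X {u} \<or> touch Y {u}" using sp[OF XY] S_iff by (auto simp: split_def)
  then show Ku: "touch K {u}" using XY touch_mono[of _ "{u}" K] by (auto simp: split_def)
  show "touch P {u}"
  proof (rule ccontr)
    assume n: "\<not> touch P {u}"
    \<comment> \<open>A vertex \<open>u\<close> that \<open>P\<close> does not touch could move into
      \<open>K\<close> at no cost: a connection that reaches \<open>S\<close> only at
      \<open>u\<close> is prolonged by \<open>u\<close> to reach \<open>R\<close>.\<close>
    have "linked (K \<union> {u}) R T"
    proof (rule linkedI)
      fix c
      show "\<exists>X \<subseteq> K \<union> {u} - {c}. conn X \<and> touch X R \<and> touch X T"
      proof (cases "c = u")
        case True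
        then have "K \<subseteq> K \<union> {u} - {c}" using uP by blast
        then show ?thesis using KT KR qd(8) by (intro exI[of _ K] conjI)
      next
        case c: False
        obtain X where X: "X \<subseteq> K - {c}" "conn X" "touch X S" "touch X T"
          using linkedD[OF qd(19), of c] by (elim exE conjE)
        show ?thesis
        proof (cases "touch X R")
          case True
          then show ?thesis using X by blast
        next
          case False
          then have "conn (X \<union> {u})" using X S_iff by (intro conn_Un) auto
          then show ?thesis using X uR c by (intro exI[of _ "X \<union> {u}"]) (auto simp: touch_insert[where a = u and A = X])
        qed
      qed
    qed
    moreover have "conn (K \<union> {u})" using Ku by (intro conn_Un qd(8)) auto
    ultimately have "quad R T P (K \<union> {u})"
      unfolding quad_def using qd uP nT R(1,3) PR n by (auto simp: touch_insert[where a = u and A = K])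
    then show False using min cS by force
  qed
  show "split K S T X Y \<Longrightarrow> \<not> touch X (S - {u}) \<or> \<not> touch Y (S - {u})" for X Y
    using sp unfolding R_def by blast
qed

text \<open>If \<open>P\<close> had more than one vertex, its end \<open>v\<close> at
  \<open>S\<close> could become the side, with all of \<open>S\<close> absorbed by \<open>K\<close>;
  two non-cut vertices of \<open>S\<close> keep the new \<open>K\<close> linked to \<open>v\<close>.
  The same two vertices must then be the sole contacts of the two parts of any split.\<close>

lemma minimal_quad_side:
  assumes q: "quad S T P K" and S: "\<nexists>r. S = {r}"
    and le: "\<forall>S' P' K'. quad S' T P' K' \<longrightarrow>
      3 * card S + 2 * card P \<le> 3 * card S' + 2 * card P'"
  obtains v where "P = {v}" "\<forall>X Y. split K S T X Y \<longrightarrow> (\<exists>u w. u \<in> S \<and> w \<in> S \<and> u \<noteq> w \<and>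
    conn (S - {u}) \<and> conn (S - {w}) \<and> E v u \<and> E v w \<and> \<not> touch X (S - {u}) \<and> \<not> touch Y (S - {w}))"
proof -
  note qd = quadD[OF q]
  have min: False if "quad S' T P' K'" "3 * card S' + 2 * card P' < 3 * card S + 2 * card P" for S' P' K'
    using le that by (meson not_le)
  obtain u w where uw: "u \<in> S" "w \<in> S" "u \<noteq> w" "conn (S - {u})" "conn (S - {w})"
    using obtain_two_noncut[OF qd(5,20) S] .
  note U = minimal_quad_noncut[OF q uw(1,4) le] and W = minimal_quad_noncut[OF q uw(2,5) le]
  have minP: "\<forall>P'. P' \<subset> P \<longrightarrow> conn P' \<longrightarrow> touch P' S \<longrightarrow> \<not> touch P' T"
  proof (intro allI impI notI)
    fix P' assume that: "P' \<subset> P" "conn P'" "touch P' S" "touch P' T"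
    have "\<not> touch P' K" using qd(16) that(1) touch_mono[of P' K P K] by blast
    then have "quad S T P' K" unfolding quad_def using qd that by auto
    moreover have "card P' < card P" using that(1) qd(22) psubset_card_mono by blast
    ultimately show False using min by force
  qed
  have "\<exists>v. P = {v}"
  proof (rule minimal_connector[OF qd(7,22,17,18) minP])
    fix v assume v: "v \<in> P" "touch {v} S" "conn (P - {v})" "\<not> touch (P - {v}) S"
      "touch (P - {v}) T" "\<not> touch {v} T"
    have P_iff: "touch P A \<longleftrightarrow> touch {v} A \<or> touch (P - {v}) A" for A
      using touch_remove[OF v(1)] touch_commute by blast
    have Ev: "E v x" if "x \<in> S" "touch P {x}" for x
    proof -
      have "\<not> touch (P - {v}) {x}" using v(4) that(1) touch_mono[of _ "{x}" _ S] by blast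
      then show ?thesis using that(2) P_iff by auto
    qed
    have vK: "\<not> touch {v} K" "\<not> touch (P - {v}) K" using P_iff qd(16) by auto
    have KS: "touch K S" using linked_touch(1)[OF qd(19)] .
    have conKS: "conn (K \<union> S)" using KS by (intro conn_Un qd(8) qd(5)) auto
    \<comment> \<open>If \<open>c\<close> is in \<open>K\<close>, all of \<open>S\<close> is
      available to reach \<open>v\<close>. If not, \<open>K\<close> is intact and reaches
      \<open>v\<close> through whichever of \<open>u\<close> and \<open>w\<close> is not
      \<open>c\<close>.\<close>
    have "linked (K \<union> S) {v} T"
    proof (rule linkedI)
      fix c
      show "\<exists>X \<subseteq> K \<union> S - {c}. conn X \<and> touch X {v} \<and> touch X T"
      proof (cases "c \<in> K")
        case True
        obtain X where X: "X \<subseteq> K - {c}" "conn X" "touch X S" "touch X T"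
          using linkedD[OF qd(19), of c] by (elim exE conjE)
        have "conn (X \<union> S)" using X qd(5) by (intro conn_Un) auto
        moreover have "touch S {v}" using v(2) touch_commute by blast
        moreover have "X \<union> S \<subseteq> K \<union> S - {c}" using X(1) True qd(11) by blast
        ultimately show ?thesis using X(4) by (intro exI[of _ "X \<union> S"]) auto
      next
        case False
        have *: ?thesis if x: "x \<in> S" "touch P {x}" "touch K {x}" "x \<noteq> c" for x
        proof -
          have "conn (K \<union> {x})" using x by (intro conn_Un qd(8)) auto
          moreover have "touch {x} {v}" using Ev[OF x(1,2)] E_sym by simp
          moreover have "touch K T" using linked_touch(2)[OF qd(19)] .
          moreover have "K \<union> {x} \<subseteq> K \<union> S - {c}" using False x by blast
          ultimately show ?thesis by (intro exI[of _ "K \<union> {x}"]) (auto simp: touch_def)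
        qed
        from *[OF uw(1) U(1,2)] *[OF uw(2) W(1,2)] uw(3) show ?thesis
          by (cases "u = c") (simp_all del: ex_simps)
      qed
    qed
    moreover have "v \<notin> S" "v \<notin> T" "v \<notin> K" "v \<in> V" using v(1) qd by auto
    moreover have "touch (P - {v}) {v}"
      using conn_touch_Diff[OF qd(7) v(1)] conn_nonempty[OF v(3)] touch_commute by blast
    ultimately have "quad {v} T (P - {v}) (K \<union> S)"
      unfolding quad_def using qd v vK conKS by auto
    moreover have "3 * card {v} + 2 * card (P - {v}) < 3 * card S + 2 * card P"
      using card_Diff1_less[OF qd(22) v(1)] card_gt_0_iff[of S] uw(1) qd(20) by auto
    ultimately show ?thesis using min by blast
  qed blast
  then obtain v where P: "P = {v}" by blast
  show ?thesis
  proof (rule that[OF P], intro allI impI)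
    fix X Y assume XY: "split K S T X Y"
    then have tS: "touch X S" "touch Y S" by (auto simp: split_def)
    \<comment> \<open>A part whose only contact in \<open>S\<close> is \<open>w\<close> keeps it
      when \<open>u\<close> is deleted, and conversely. So different parts lose contact at
      \<open>u\<close> and at \<open>w\<close>, and after renaming \<open>X\<close> belongs to
      \<open>u\<close>.\<close>
    have swap: "touch A (S - {u})" if "\<not> touch A (S - {w})" "touch A S" for A
    proof -
      have "touch A {w}" using touch_remove[OF uw(2), of A] that by blast
      then show ?thesis by (rule touch_mono) (use uw in auto)
    qed
    have swap': "touch A (S - {w})" if "\<not> touch A (S - {u})" "touch A S" for A
    proof -
      have "touch A {u}" using touch_remove[OF uw(1), of A] that by blast
      then show ?thesis by (rule touch_mono) (use uw in auto)
    qed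
    have Euw: "E v u" "E v w" using U(1) W(1) P by auto
    show "\<exists>u w. u \<in> S \<and> w \<in> S \<and> u \<noteq> w \<and> conn (S - {u}) \<and> conn (S - {w}) \<and>
      E v u \<and> E v w \<and> \<not> touch X (S - {u}) \<and> \<not> touch Y (S - {w})"
      using U(3)[OF XY] W(3)[OF XY] swap swap' tS uw Euw by metis
  qed
qed

section \<open>Witnesses given by four vertices\<close>

definition far :: "'a \<Rightarrow> 'a \<Rightarrow> 'a \<Rightarrow> 'a set" where
  "far v s t = {x \<in> V. x \<noteq> v \<and> \<not> E v x \<and> x \<noteq> s \<and> x \<noteq> t}"

definition away :: "'a set \<Rightarrow> 'a set" where
  "away K = {x \<in> V. x \<notin> K \<and> \<not> touch {x} K}"

text \<open>\<open>P\<close> is not stored but replaced by the component of \<open>v\<close> among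
  all vertices away from \<open>K\<close>. This is the largest candidate for \<open>P\<close>
  through \<open>v\<close>, so it reaches \<open>t\<close> if any candidate does.\<close>

definition long_witness :: "'a \<Rightarrow> 'a \<Rightarrow> 'a \<Rightarrow> 'a \<Rightarrow> bool" where
  "long_witness v s t y \<longleftrightarrow> E v s \<and> t \<in> V \<and> t \<noteq> v \<and> t \<noteq> s \<and> \<not> E s t \<and> y \<in> far v s t \<and>
     linked (cmp (far v s t) y) {s} {t} \<and> touch (cmp (away (cmp (far v s t) y)) v) {t}"

definition fan :: "'a \<Rightarrow> 'a \<Rightarrow> 'a set" where
  "fan v s = {x. E v x \<and> x \<noteq> s \<and> \<not> E s x}"

text \<open>\<open>far v s s\<close> removes only \<open>s\<close> besides the closed neighbourhood
  of \<open>v\<close>; the other side lies within the neighbours of \<open>v\<close> and is thereby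
  excluded already.\<close>

definition fan_witness :: "'a \<Rightarrow> 'a \<Rightarrow> 'a \<Rightarrow> 'a \<Rightarrow> bool" where
  "fan_witness v s q y \<longleftrightarrow> E v s \<and> q \<in> fan v s \<and> y \<in> far v s s \<and>
     linked (cmp (far v s s) y) {s} (cmp (fan v s) q)"

lemma long_witness_quad:
  assumes "long_witness v s t y"
  shows "\<exists>S T P K. quad S T P K"
proof -
  define K where "K = cmp (far v s t) y"
  define P where "P = cmp (away K) v"
  have w: "E v s" "t \<in> V" "t \<noteq> v" "t \<noteq> s" "\<not> E s t" "y \<in> far v s t" "linked K {s} {t}" "touch P {t}"
    using assms by (simp_all add: long_witness_def K_def P_def)
  have KU: "K \<subseteq> far v s t" unfolding K_def by (rule cmp_subset[OF w(6)])
  have v: "v \<in> away K"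
    using KU E_V[OF w(1)] unfolding away_def far_def touch_def by blast
  have PU: "P \<subseteq> away K" unfolding P_def by (rule cmp_subset[OF v])
  have vP: "v \<in> P" unfolding P_def by simp
  have "touch {s} K" "touch {t} K" using linked_touch[OF w(7)] touch_commute by blast+
  then have st: "s \<notin> P" "t \<notin> P" using PU unfolding away_def by auto
  have "touch P {s}" using vP w(1) by (auto simp: touch_def)
  moreover have "\<not> touch P K" using PU unfolding away_def touch_def by blast
  moreover have "s \<in> V" using E_V[OF E_sym[OF w(1)]] .
  moreover have "P \<inter> K = {}" "P \<subseteq> V" using PU unfolding away_def by blast+
  moreover have "s \<notin> K" "t \<notin> K" "K \<subseteq> V" using KU unfolding far_def by blast+
  moreover have "conn P" "conn K" unfolding P_def K_def by (rule conn_cmp)+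
  ultimately have "quad {s} {t} P K"
    unfolding quad_def using w st by simp
  then show ?thesis by blast
qed

lemma fan_witness_quad:
  assumes "fan_witness v s q y"
  shows "\<exists>S T P K. quad S T P K"
proof -
  define D where "D = cmp (far v s s) y"
  define Q where "Q = cmp (fan v s) q"
  have w: "E v s" "q \<in> fan v s" "y \<in> far v s s" "linked D {s} Q"
    using assms by (simp_all add: fan_witness_def D_def Q_def)
  have DU: "D \<subseteq> far v s s" unfolding D_def by (rule cmp_subset[OF w(3)])
  have QU: "Q \<subseteq> fan v s" unfolding Q_def by (rule cmp_subset[OF w(2)])
  have sv: "s \<in> V" "v \<in> V" "s \<noteq> v" using E_V[OF E_sym[OF w(1)]] E_V[OF w(1)] E_irrefl w(1) by auto
  have "q \<in> Q" unfolding Q_def by simp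
  have "\<not> touch {s} Q" using QU unfolding fan_def touch_def by blast
  moreover have "\<not> touch {v} D" using DU unfolding far_def touch_def by blast
  moreover have "touch {v} Q" using \<open>q \<in> Q\<close> w(2) unfolding fan_def touch_def by blast
  moreover have "Q \<subseteq> V" using QU E_V E_sym unfolding fan_def by blast
  moreover have "v \<notin> Q" "s \<notin> Q" "Q \<inter> D = {}" using QU DU E_irrefl unfolding fan_def far_def by blast+
  moreover have "s \<notin> D" "v \<notin> D" "D \<subseteq> V" using DU unfolding far_def by blast+
  moreover have "conn Q" "conn D" unfolding Q_def D_def by (rule conn_cmp)+
  ultimately have "quad {s} Q {v} D"
    unfolding quad_def using w sv by simp
  then show ?thesis by blast
qed

lemma split_commute: "split K S T X Y \<Longrightarrow> split K T S X Y"
  unfolding split_def by simp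

text \<open>If both sides of a minimal quadruple have at least two vertices, then \<open>P\<close> is a single vertex
  \<open>v\<close>, and with \<open>K\<close> split into \<open>X\<close> and \<open>Y\<close> some \<open>u \<in> S\<close> is the only contact of \<open>X\<close> in \<open>S\<close>. Then
  \<open>u\<close>, \<open>Y\<close>, \<open>X\<close> and what remains of \<open>S \<union> T \<union> P\<close> form a quadruple again.\<close>

lemma quad_singleton:
  assumes "quad S0 T0 P0 K0"
  shows "\<exists>s T P K. quad {s} T P K"
proof (rule ccontr)
  assume none: "\<nexists>s T P K. quad {s} T P K"
  define m where "m = (LEAST n. \<exists>S T P K. quad S T P K \<and> n = 3 * card S + 3 * card T + 2 * card P)"
  have "\<exists>S T P K. quad S T P K \<and> m = 3 * card S + 3 * card T + 2 * card P"
    unfolding m_def by (rule LeastI_ex) (use assms in blast)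
  then obtain S T P K where q: "quad S T P K" and m: "m = 3 * card S + 3 * card T + 2 * card P"
    by (elim exE conjE)
  have le: "m \<le> 3 * card S' + 3 * card T' + 2 * card P'" if "quad S' T' P' K'" for S' T' P' K'
    unfolding m_def by (rule Least_le) (use that in blast)
  have nS: "\<nexists>r. S = {r}" using q none by blast
  have nT: "\<nexists>r. T = {r}" using quad_commute[OF q] none by blast
  note qd = quadD[OF q]
  have leS: "\<forall>S' P' K'. quad S' T P' K' \<longrightarrow> 3 * card S + 2 * card P \<le> 3 * card S' + 2 * card P'"
    using le unfolding m by fastforce
  have leT: "\<forall>S' P' K'. quad S' S P' K' \<longrightarrow> 3 * card T + 2 * card P \<le> 3 * card S' + 2 * card P'"
    using le[OF quad_commute] unfolding m by fastforce
  obtain v where v: "P = {v}" and vS: "\<forall>X Y. split K S T X Y \<longrightarrow> (\<exists>u w. u \<in> S \<and> w \<in> S \<and> u \<noteq> w \<and>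
    conn (S - {u}) \<and> conn (S - {w}) \<and> E v u \<and> E v w \<and> \<not> touch X (S - {u}) \<and> \<not> touch Y (S - {w}))"
    using minimal_quad_side[OF q nS leS] .
  obtain v' where v': "P = {v'}" and vT: "\<forall>X Y. split K T S X Y \<longrightarrow> (\<exists>u w. u \<in> T \<and> w \<in> T \<and> u \<noteq> w \<and>
    conn (T - {u}) \<and> conn (T - {w}) \<and> E v' u \<and> E v' w \<and> \<not> touch X (T - {u}) \<and> \<not> touch Y (T - {w}))"
    using minimal_quad_side[OF quad_commute[OF q] nT leT] .
  have [simp]: "v' = v" using v v' by simp
  obtain X Y where XY: "split K S T X Y" using quad_split[OF q] by blast
  then have xy: "X \<subseteq> K" "Y \<subseteq> K" "X \<inter> Y = {}" "conn X" "conn Y" "touch X Y"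
    "touch X S" "touch X T" "touch Y S" "touch Y T" by (simp_all add: split_def)
  obtain u w where uw: "u \<in> S" "w \<in> S" "u \<noteq> w" "conn (S - {u})" "E v u" "E v w"
    "\<not> touch X (S - {u})" "\<not> touch Y (S - {w})" using vS[rule_format, OF XY] by (elim exE conjE)
  obtain u' w' where uw': "u' \<in> T" "w' \<in> T" "u' \<noteq> w'" "conn (T - {u'})" "E v u'" "E v w'"
    "\<not> touch X (T - {u'})" "\<not> touch Y (T - {w'})" using vT[rule_format, OF split_commute[OF XY], unfolded \<open>v' = v\<close>] by (elim exE conjE)
  define A where "A = S - {u}"
  define B where "B = T - {u'}"
  have AB: "A \<subseteq> S" "u \<notin> A" "w \<in> A" "B \<subseteq> T" "w' \<in> B" "conn A" "conn B"
    "\<not> touch X A" "\<not> touch X B" using uw uw' unfolding A_def B_def by auto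
  have Xu: "touch X {u}" using touch_remove[OF uw(1)] xy(7) uw(7) by blast
  have Yw: "touch Y {w}" using touch_remove[OF uw(2)] xy(9) uw(8) by blast
  have Yw': "touch Y {w'}" using touch_remove[OF uw'(2)] xy(10) uw'(8) by blast
  have YA: "touch A Y" using Yw AB(3) E_sym unfolding touch_def by blast
  have YB: "touch B Y" using Yw' AB(5) E_sym unfolding touch_def by blast
  have vA: "touch {v} A" "touch {v} B" using uw(6) uw'(6) AB unfolding touch_def by auto
  have nv: "\<not> touch {v} K" using qd(16) v by simp
  have vb: "conn ({v} \<union> B)" using vA AB by (intro conn_Un) auto
  have conn: "conn ({v} \<union> B \<union> A)" by (rule conn_Un[OF vb AB(6)]) (use vA in \<open>simp only: touch_Un simp_thms\<close>)
  have Xv: "\<not> touch X {v}" using nv xy(1) touch_commute touch_mono[of "{v}" X "{v}" K] by blast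
  \<comment> \<open>The only contact of \<open>Y\<close> in \<open>S\<close> is \<open>w\<close>,
    which differs from \<open>u\<close>.\<close>
  have uY: "\<not> touch {u} Y"
  proof
    assume "touch {u} Y"
    then have "touch Y (S - {w})" using uw E_sym unfolding touch_def by blast
    then show False using uw(8) by blast
  qed
  have Au: "touch A {u}"
    unfolding A_def using conn_touch_Diff[OF qd(5) uw(1)] nS touch_commute by blast
  have Vu: "touch ({v} \<union> B) {u}" using uw(5) unfolding touch_def by blast
  have VY: "touch ({v} \<union> B) Y" using YB by (simp only: touch_Un simp_thms)
  have dis: "u \<notin> K" "u \<notin> B" "u \<noteq> v" "v \<notin> K" "A \<inter> K = {}" "B \<inter> K = {}" "A \<inter> B = {}" "v \<notin> A" "v \<notin> B"
    using qd(9-14) AB uw(1) unfolding v by auto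
  \<comment> \<open>The two disjoint connections from \<open>u\<close> to \<open>Y\<close> are the
    rest \<open>A\<close> of \<open>S\<close>, and \<open>v\<close> together with the rest
    \<open>B\<close> of \<open>T\<close>.\<close>
  have lk: "linked ({v} \<union> B \<union> A) {u} Y"
    by (rule linked_two[of "{v} \<union> B" _ A]) (use vb AB Au Vu YA VY dis in auto)
  have "quad {u} Y X ({v} \<union> B \<union> A)"
    unfolding quad_def
  proof (intro conjI)
    show "{u} \<subseteq> V" "Y \<subseteq> V" "X \<subseteq> V" "{v} \<union> B \<union> A \<subseteq> V"
      using qd(1-4) v uw(1) xy(1,2) AB(1,4) by auto
    show "{u} \<inter> Y = {}" "{u} \<inter> X = {}" "Y \<inter> X = {}" using dis(1) xy(1-3) by auto
    show "{u} \<inter> ({v} \<union> B \<union> A) = {}" using dis AB by auto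
    show "Y \<inter> ({v} \<union> B \<union> A) = {}" "X \<inter> ({v} \<union> B \<union> A) = {}" using dis xy(1,2) by auto
    show "\<not> touch X ({v} \<union> B \<union> A)" using Xv AB(8,9) by (simp only: touch_Un simp_thms)
  qed (use xy Xu uY conn lk in simp_all)
  then show False using none by blast
qed

lemma linked_subset:
  assumes "linked K S T" "K \<subseteq> K'" "S \<subseteq> S'" "T \<subseteq> T'"
  shows "linked K' S' T'"
proof (rule linkedI)
  fix c
  obtain X where X: "X \<subseteq> K - {c}" "conn X" "touch X S" "touch X T"
    using linkedD[OF assms(1), of c] by (elim exE conjE)
  have "touch X S'" "touch X T'"
    using touch_mono[OF X(3) order_refl assms(3)] touch_mono[OF X(4) order_refl assms(4)] .
  then show "\<exists>X \<subseteq> K' - {c}. conn X \<and> touch X S' \<and> touch X T'"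
    using X assms(2) by (intro exI[of _ X]) auto
qed

text \<open>A component of \<open>X - {z}\<close> is a proper part of the connected set
  \<open>X\<close>, and the only vertex through which it can be left is \<open>z\<close>.\<close>

lemma conn_remove_touch:
  assumes "conn X" "z \<in> X" "w \<in> X" "w \<noteq> z"
  shows "touch (cmp (X - {z}) w) {z}"
proof -
  let ?C = "cmp (X - {z}) w"
  have w: "w \<in> X - {z}" using assms by blast
  have C: "?C \<subseteq> X - {z}" by (rule cmp_subset[OF w])
  have "touch ?C (X - ?C)"
    by (rule connD[OF assms(1)]) (use C assms(2) in auto)
  moreover have "X - ?C = {z} \<union> (X - {z} - ?C)" using C assms(2) by blast
  ultimately show ?thesis using cmp_closed[OF w] by (metis touch_Un(2))
qed

text \<open>If some vertex \<open>z\<close> of the path \<open>T\<close> is not adjacent to \<open>v\<close>, then the first such \<open>z\<close> takes the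
  role of \<open>P\<close> in a smaller quadruple whose sides are the predecessor of \<open>z\<close> and the rest of \<open>T\<close>
  beyond \<open>z\<close>.\<close>

lemma minimal_quad_fan:
  assumes q: "quad {s} T P K" and T: "\<nexists>r. T = {r}"
    and minimal: "\<forall>s' T' P' K'. quad {s'} T' P' K' \<longrightarrow>
      3 * card T + 2 * card P \<le> 3 * card T' + 2 * card P'"
  shows "\<exists>v q y. fan_witness v s q y"
proof -
  note qd = quadD[OF q]
  note le = minimal[rule_format]
  have leT: "\<forall>S' P' K'. quad S' {s} P' K' \<longrightarrow> 3 * card T + 2 * card P \<le> 3 * card S' + 2 * card P'"
    using le quad_commute by blast
  obtain v where v: "P = {v}" and vT: "\<forall>X Y. split K T {s} X Y \<longrightarrow> (\<exists>u w. u \<in> T \<and> w \<in> T \<and> u \<noteq> w \<and>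
    conn (T - {u}) \<and> conn (T - {w}) \<and> E v u \<and> E v w \<and> \<not> touch X (T - {u}) \<and> \<not> touch Y (T - {w}))"
    using minimal_quad_side[OF quad_commute[OF q] T leT] .
  obtain X Y where XY: "split K T {s} X Y" using quad_split[OF quad_commute[OF q]] by blast
  then have xy: "X \<subseteq> K" "Y \<subseteq> K" "X \<inter> Y = {}" "conn X" "conn Y" "touch X Y"
    "touch X T" "touch X {s}" "touch Y T" "touch Y {s}" by (simp_all add: split_def)
  obtain u w where uw: "u \<in> T" "w \<in> T" "u \<noteq> w" "E v u" "E v w"
    "\<not> touch X (T - {u})" "\<not> touch Y (T - {w})"
    using vT[rule_format, OF XY] by (elim exE conjE)
  have Xu: "touch X {u}" using touch_remove[OF uw(1)] xy(7) uw(6) by blast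
  have Yw: "touch Y {w}" using touch_remove[OF uw(2)] xy(9) uw(7) by blast
  have vs: "E v s" using qd(17) v by simp
  have nv: "\<not> touch {v} K" using qd(16) v by simp
  have TN: "T \<subseteq> {x. E v x}"
  proof (rule ccontr)
    assume TN: "\<not> T \<subseteq> {x. E v x}"
    let ?U = "T \<inter> {x. E v x}"
    let ?L = "cmp ?U u"
    have uU: "u \<in> ?U" using uw by blast
    have LU: "?L \<subseteq> ?U" by (rule cmp_subset[OF uU])
    have "touch ?L (T - ?L)"
      by (rule connD[OF qd(6)]) (use LU TN in auto)
    then obtain l z where lz: "l \<in> ?L" "z \<in> T" "z \<notin> ?L" "E l z" unfolding touch_def by blast
    have vz: "\<not> E v z"
    proof
      assume "E v z"
      then have "touch ?L (?U - ?L)" using lz by (intro touchI[of l z]) auto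
      then show False using cmp_closed[OF uU] by blast
    qed
    \<comment> \<open>A smallest connected set from \<open>u\<close> to a neighbour of
      \<open>z\<close> inside the neighbourhood of \<open>v\<close> plays the part of a shortest
      path: only its last vertex \<open>a\<close> touches \<open>z\<close>.\<close>
    define Q where "Q L \<longleftrightarrow> L \<subseteq> ?U \<and> conn L \<and> u \<in> L \<and> touch L {z}" for L
    have "Q ?L" unfolding Q_def using LU lz by (auto simp: conn_cmp touch_def)
    from ex_has_least_nat[of Q, OF this, of card] obtain L where
      L: "Q L" and Lmin: "\<And>L'. Q L' \<Longrightarrow> card L \<le> card L'" by blast
    then have L': "L \<subseteq> ?U" "conn L" "u \<in> L" "touch L {z}" unfolding Q_def by simp_all
    have finL: "finite L" using L'(1) qd(21) finite_subset by blast
    obtain a where a: "a \<in> L" "E a z" and M: "L - {a} = {} \<and> a = u \<or>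
      conn (L - {a}) \<and> u \<in> L - {a} \<and> \<not> touch (L - {a}) {z}"
    proof (cases "L = {u}")
      case True
      then show ?thesis using that[of u] L'(4) by simp
    next
      case False
      then obtain a where a: "a \<in> L" "a \<noteq> u" "conn (L - {a})"
        using obtain_noncut[OF L'(2) finL L'(3)] by blast
      have "\<not> touch (L - {a}) {z}"
      proof
        assume "touch (L - {a}) {z}"
        then have "Q (L - {a})" unfolding Q_def using L' a by auto
        then show False using Lmin[of "L - {a}"] card_Diff1_less[OF finL a(1)] by simp
      qed
      moreover have "E a z" using calculation L'(4) unfolding touch_def by blast
      ultimately show ?thesis using that[of a] a L'(3) by blast
    qed
    let ?C = "cmp (T - {z}) w"
    have zuw: "z \<noteq> u" "z \<noteq> w" using vz uw by auto
    have wz: "w \<in> T - {z}" using uw zuw by blast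
    have CT: "?C \<subseteq> T - {z}" by (rule cmp_subset[OF wz])
    have LT: "L \<subseteq> T - {z}" using L'(1) vz by blast
    have wC: "w \<in> ?C" by simp
    have cC: "card ?C < card T" by (rule psubset_card_mono[OF qd(21)]) (use CT lz(2) in blast)
    have vC: "touch {v} ?C" using wC uw(5) unfolding touch_def by blast
    have YC: "touch Y ?C" by (rule touch_mono[OF Yw]) (use wC in auto)
    \<comment> \<open>Otherwise the component \<open>?C\<close> would contain both \<open>u\<close>
      and \<open>w\<close>. Then \<open>X\<close> and \<open>Y\<close> would both keep contact with
      it, and it could replace \<open>T\<close>.\<close>
    have LC: "L \<inter> ?C = {}"
    proof (rule ccontr)
      assume "L \<inter> ?C \<noteq> {}"
      then have "L \<subseteq> ?C" by (intro conn_subset_closed[OF L'(2) cmp_closed[OF wz] LT])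
      then have "touch X ?C" using L'(3) by (intro touch_mono[OF Xu]) auto
      then have "linked K {s} ?C" using xy YC by (intro linked_two[of X K Y]) auto
      moreover have "\<not> touch {s} ?C" using qd(15) touch_mono[of "{s}" ?C "{s}" T] CT by blast
      moreover have "s \<notin> ?C" "?C \<inter> P = {}" "?C \<inter> K = {}" "?C \<subseteq> V" using CT qd(2,9,12,13) by auto
      ultimately have "quad {s} ?C P K"
        unfolding quad_def using qd vC v conn_cmp by simp
      then show False using le[of s ?C P K] cC by simp
    qed
    have LC': "\<not> touch ?C L"
    proof
      assume "touch ?C L"
      then have "touch ?C (T - {z} - ?C)" by (rule touch_mono) (use LT LC in auto)
      then show False using cmp_closed[OF wz] by blast
    qed
    define M where "M = L - {a}"
    \<comment> \<open>A connection from \<open>a\<close> to \<open>?C\<close> that avoids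
      \<open>v\<close>: it leads back along \<open>M\<close> to \<open>u\<close>, or starts at
      \<open>u = a\<close>, and then runs through \<open>X\<close> and \<open>Y\<close> to
      \<open>w\<close>.\<close>
    define W where "W = {s} \<union> X \<union> Y \<union> M"
    have Ma: "M = {} \<and> a = u \<or> conn M \<and> u \<in> M \<and> \<not> touch M {z}" using M unfolding M_def .
    have MsL: "M \<subseteq> L" "a \<notin> M" unfolding M_def by auto
    have "touch {s} X" using xy(8) touch_commute by blast
    then have "conn ({s} \<union> X)" using xy(4) by (intro conn_Un) auto
    then have sxy: "conn ({s} \<union> X \<union> Y)"
      by (rule conn_Un[OF _ xy(5)]) (use xy(6) in \<open>simp only: touch_Un simp_thms\<close>)
    have W: "conn W"
    proof (cases "M = {}")
      case True
      then show ?thesis unfolding W_def using sxy by simp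
    next
      case False
      then have "touch X M" using Ma by (intro touch_mono[OF Xu]) auto
      then show ?thesis unfolding W_def
        by (intro conn_Un[OF sxy]) (use Ma False in \<open>auto simp: touch_def\<close>)
    qed
    have Wa: "touch W {a}"
    proof (cases "M = {}")
      case True
      then have "a = u" using Ma by blast
      then show ?thesis using Xu unfolding W_def by (simp only: touch_Un simp_thms)
    next
      case False
      then have "touch {a} M" unfolding M_def by (intro conn_touch_Diff[OF L'(2) a(1)]) auto
      then have "touch M {a}" using touch_commute by blast
      then show ?thesis unfolding W_def by (simp only: touch_Un simp_thms)
    qed
    have WC: "touch W ?C" unfolding W_def using YC by (simp only: touch_Un simp_thms)
    have va: "E v a" "a \<in> T" using a(1) L'(1) by auto
    have dis: "v \<notin> T" "s \<notin> T" "T \<inter> K = {}" "v \<notin> K" "s \<notin> K" "v \<noteq> s" using qd(9-14) v by auto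
    have vW: "v \<notin> W" unfolding W_def using dis MsL LT xy(1,2) by auto
    have vWc: "conn ({v} \<union> W)"
      using W vs by (intro conn_Un) (auto simp: W_def touch_def)
    \<comment> \<open>\<open>v\<close> is adjacent to \<open>a\<close> and to \<open>w\<close>, so
      \<open>v\<close> alone is one connection from \<open>a\<close> to \<open>?C\<close>, and
      \<open>W\<close> is a second one.\<close>
    have lk: "linked ({v} \<union> W) {a} ?C"
      by (rule linked_two[of "{v}" _ W]) (use vW W vC va Wa WC in auto)
    have "quad {a} ?C {z} ({v} \<union> W)"
      unfolding quad_def
    proof (intro conjI)
      show "{a} \<subseteq> V" "?C \<subseteq> V" "{z} \<subseteq> V" using qd(2) va(2) CT lz(2) by auto
      show "{v} \<union> W \<subseteq> V" unfolding W_def using qd(1-4) v xy(1,2) LT MsL(1) by auto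
      show "{a} \<inter> ?C = {}" using LC a(1) by blast
      show "{a} \<inter> {z} = {}" using LT a(1) by blast
      show "{a} \<inter> ({v} \<union> W) = {}" unfolding W_def using va dis MsL(2) xy(1,2) by auto
      show "?C \<inter> {z} = {}" using CT by blast
      show "?C \<inter> ({v} \<union> W) = {}" unfolding W_def using CT dis LC MsL(1) xy(1,2) by auto
      show "{z} \<inter> ({v} \<union> W) = {}" unfolding W_def using lz(2) dis LT MsL(1) xy(1,2) by auto
      show "\<not> touch {a} ?C" using LC' a(1) E_sym unfolding touch_def by blast
      have "\<not> touch {z} {s}" using qd(15) lz(2) E_sym unfolding touch_def by blast
      moreover have "\<not> touch {z} X" using uw(6) lz(2) zuw E_sym unfolding touch_def by blast
      moreover have "\<not> touch {z} Y" using uw(7) lz(2) zuw E_sym unfolding touch_def by blast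
      moreover have "\<not> touch {z} M" using Ma touch_commute by auto
      moreover have "\<not> touch {z} {v}" using vz E_sym by auto
      ultimately show "\<not> touch {z} ({v} \<union> W)" unfolding W_def by (simp only: touch_Un simp_thms)
      show "touch {z} {a}" using a(2) E_sym by simp
      show "touch {z} ?C"
        using conn_remove_touch[OF qd(6) lz(2) uw(2)] zuw(2) touch_commute by blast
    qed (use vWc lk conn_cmp in simp_all)
    \<comment> \<open>Both quadruples have a single vertex as \<open>P\<close>, so the smaller side
      \<open>?C\<close> decides.\<close>
    then show False using le cC v by fastforce
  qed
  obtain y where y: "y \<in> K" using conn_nonempty[OF qd(8)] by blast
  have Tf: "T \<subseteq> cmp (fan v s) u"
    by (rule conn_subset_cmp[OF qd(6) _ uw(1)]) (use TN qd(9,15) in \<open>auto simp: fan_def touch_def\<close>)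
  have Kf: "K \<subseteq> far v s s"
    using qd(4,11,14) nv unfolding v far_def touch_def by blast
  have "K \<subseteq> cmp (far v s s) y"
    by (rule conn_subset_cmp[OF qd(8) Kf y])
  then have "linked (cmp (far v s s) y) {s} (cmp (fan v s) u)"
    by (intro linked_subset[OF qd(19) _ _ Tf]) auto
  moreover have "u \<in> fan v s" using uw TN qd(9,15) by (auto simp: fan_def touch_def)
  ultimately have "fan_witness v s u y" unfolding fan_witness_def using vs y Kf by blast
  then show ?thesis by blast
qed

text \<open>Let \<open>v \<in> P\<close> be the neighbour of \<open>s\<close> and \<open>x\<close> the next vertex of the path \<open>P\<close>. Since the
  quadruple is minimal, some \<open>c\<close> on the rest of the path up to \<open>t\<close> separates \<open>s\<close> from \<open>x\<close> in the
  component of \<open>K\<close> outside \<open>N[v]\<close>. Choosing \<open>c\<close> such that its side containing \<open>K\<close> is smallest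
  makes that side linked to \<open>s\<close> and \<open>c\<close>, so minimality of \<open>P\<close> forces \<open>c = t\<close>.\<close>

lemma minimal_quad_long:
  assumes q: "quad {s} {t} P K"
    and minimal: "\<forall>s' t' P' K'. quad {s'} {t'} P' K' \<longrightarrow> card P \<le> card P'"
  shows "\<exists>v y. long_witness v s t y"
proof -
  note qd = quadD[OF q] and le = minimal[rule_format]
  obtain y where y: "y \<in> K" using conn_nonempty[OF qd(8)] by blast
  have dis: "s \<noteq> t" "s \<notin> P" "s \<notin> K" "t \<notin> P" "t \<notin> K" "P \<inter> K = {}" "\<not> E s t" "s \<in> V" "t \<in> V"
    using qd(1,2,9-15) by auto
  have PK: "\<not> E p k" if "p \<in> P" "k \<in> K" for p k using qd(16) that unfolding touch_def by blast
  have Ks: "touch K {s}" "touch K {t}" using linked_touch[OF qd(19)] .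
  have minP: False if "P' \<subset> P" "conn P'" "touch P' {s}" "touch P' {t}" for P'
  proof -
    have "\<not> touch P' K" using qd(16) that(1) touch_mono[of P' K P K] by blast
    then have "quad {s} {t} P' K" unfolding quad_def using qd that by auto
    moreover have "card P' < card P" using that(1) qd(22) psubset_card_mono by blast
    ultimately show False using le by force
  qed
  have minP': "\<forall>P'. P' \<subset> P \<longrightarrow> conn P' \<longrightarrow> touch P' {s} \<longrightarrow> \<not> touch P' {t}"
    using minP by blast
  consider v where "P = {v}"
    | v where "v \<in> P" "touch {v} {s}" "conn (P - {v})" "\<not> touch (P - {v}) {s}"
      "touch (P - {v}) {t}" "\<not> touch {v} {t}"
    using minimal_connector[OF qd(7,22,17,18) minP'] by blast
  then show ?thesis
  proof cases
    case (1 v)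
    have vst: "E v s" "E v t" using qd(17,18) 1 by simp_all
    have Kf: "K \<subseteq> far v s t"
      using PK[of v] 1 dis qd(4) unfolding far_def by auto
    have "K \<subseteq> cmp (far v s t) y" by (rule conn_subset_cmp[OF qd(8) Kf y])
    then have "linked (cmp (far v s t) y) {s} {t}" by (intro linked_subset[OF qd(19)]) auto
    moreover have "touch (cmp (away (cmp (far v s t) y)) v) {t}"
      by (rule touch_mono[of "{v}" "{t}"]) (use vst in auto)
    moreover have "t \<noteq> v" using dis 1 by auto
    ultimately have "long_witness v s t y"
      unfolding long_witness_def using vst dis y Kf by auto
    then show ?thesis by blast
  next
    case (2 v)
    have vs: "E v s" and nvt: "\<not> E v t" using 2(2,6) by simp_all
    define R where "R = P - {v}"
    have R: "conn R" "\<not> touch R {s}" "touch R {t}" "v \<notin> R" "R \<subset> P" "P = insert v R"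
      using 2 unfolding R_def by auto
    have finR: "finite R" using R(5) qd(22) by (meson finite_subset psubset_imp_subset)
    have Rv: "touch R {v}"
      using conn_touch_Diff[OF qd(7) 2(1)] conn_nonempty[OF R(1)] touch_commute unfolding R_def by blast
    \<comment> \<open>Putting \<open>v\<close> back in front of a smaller \<open>R'\<close> would
      give a smaller \<open>P\<close>, so \<open>R\<close> inherits minimality between
      \<open>v\<close> and \<open>t\<close>.\<close>
    have minR: "\<forall>R'. R' \<subset> R \<longrightarrow> conn R' \<longrightarrow> touch R' {v} \<longrightarrow> \<not> touch R' {t}"
    proof (intro allI impI notI, rule minP)
      fix R' assume that: "R' \<subset> R" "conn R'" "touch R' {v}" "touch R' {t}"
      show "{v} \<union> R' \<subset> P" unfolding R(6) using that(1) R(4) by auto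
      show "conn ({v} \<union> R')" using that touch_commute by (intro conn_Un) auto
      show "touch ({v} \<union> R') {s}" using 2(2) by (simp only: touch_Un simp_thms)
      show "touch ({v} \<union> R') {t}" using that(4) by (simp only: touch_Un simp_thms)
    qed
    have "\<exists>x\<in>R. E v x \<and> \<not> touch (R - {x}) {v} \<and>
      conn ({t} \<union> (R - {x})) \<and> touch ({t} \<union> (R - {x})) {x}"
    proof (rule minimal_connector[OF R(1) finR Rv R(3) minR])
      fix x assume x: "R = {x}"
      then have "E t x" "E v x" using R(3) Rv E_sym by auto
      then show ?thesis using x by simp
    next
      fix x assume x: "x \<in> R" "touch {x} {v}" "conn (R - {x})" "\<not> touch (R - {x}) {v}"
        "touch (R - {x}) {t}" "\<not> touch {x} {t}"
      have "conn ({t} \<union> (R - {x}))" using x(3,5) touch_commute by (intro conn_Un) auto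
      moreover have "touch (R - {x}) {x}"
        using conn_touch_Diff[OF R(1) x(1)] conn_nonempty[OF x(3)] touch_commute by blast
      ultimately show ?thesis using x(1,2,4) E_sym by (intro bexI[of _ x]) (auto simp only: touch_Un touch_singletons)
    qed
    then obtain x where x: "x \<in> R" "E v x" "\<not> touch (R - {x}) {v}" "conn ({t} \<union> (R - {x}))"
      "touch ({t} \<union> (R - {x})) {x}" by blast
    \<comment> \<open>\<open>F\<close> is the path beyond \<open>x\<close> with \<open>t\<close>
      appended. \<open>U\<close> consists of the vertices other than \<open>s\<close> outside the
      closed neighbourhood of \<open>v\<close>. For \<open>c\<close> outside \<open>K\<close>,
      \<open>Kc c\<close> is the side of \<open>K\<close> after \<open>c\<close> is deleted from
      \<open>U\<close>.\<close>
    define F where "F = {t} \<union> (R - {x})"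
    define U where "U = far v s s"
    define Kc where "Kc c = cmp (U - {c}) y" for c
    have tF: "t \<in> F" "x \<notin> F" unfolding F_def using dis(4) x(1) R(5) by auto
    have F: "conn F" "touch F {x}" using x(4,5) unfolding F_def .
    have FK: "F \<inter> K = {}" unfolding F_def using dis R(5) by auto
    have U_iff: "z \<in> U \<longleftrightarrow> z \<in> V \<and> z \<noteq> v \<and> \<not> E v z \<and> z \<noteq> s" for z unfolding U_def far_def by auto
    have xU: "x \<notin> U" "s \<notin> U" "v \<notin> U" using x(2) U_iff by auto
    have KU: "K \<subseteq> U" using PK[OF 2(1)] dis 2(1) qd(4) unfolding U_iff subset_eq by blast
    have FU: "F \<subseteq> U"
    proof
      fix z assume "z \<in> F"
      then consider "z = t" | "z \<in> R" "z \<noteq> x" unfolding F_def by blast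
      then show "z \<in> U"
      proof cases
        case 1
        then show ?thesis using U_iff dis nvt 2(1) by auto
      next
        case 2
        then have "\<not> E v z" using x(3) E_sym unfolding touch_def by blast
        then show ?thesis using U_iff 2 R(4,5) qd(3) dis(2) by auto
      qed
    qed
    have KF: "conn (K \<union> F)" using Ks(2) tF by (intro conn_Un qd(8) F) (auto simp: touch_def)
    have Kc_sub: "Kc c \<subseteq> U - {c}" if "c \<notin> K" for c
      unfolding Kc_def by (rule cmp_subset) (use that y KU in blast)
    have KKc: "K \<subseteq> Kc c" if "c \<notin> K" for c
      unfolding Kc_def by (rule conn_subset_cmp[OF qd(8)]) (use that y KU in auto)
    have Kc_closed: "\<not> touch (Kc c) (U - {c} - Kc c)" if "c \<notin> K" for c
      unfolding Kc_def by (rule cmp_closed) (use that y KU in blast)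
    have conKc: "conn (Kc c)" for c unfolding Kc_def by (rule conn_cmp)
    have Kcs: "touch (Kc c) {s}" if "c \<notin> K" for c
      using touch_mono[OF Ks(1) KKc[OF that] order_refl] .
    define good where "good c \<longleftrightarrow> c \<in> F \<and> \<not> touch (Kc c) {x}" for c
    \<comment> \<open>If no vertex of \<open>F\<close> cut \<open>x\<close> off from
      \<open>K\<close>, then the component of \<open>K\<close> in \<open>U\<close> would be linked
      to \<open>s\<close> and \<open>x\<close>. So \<open>x\<close> could take the place of
      \<open>t\<close>, and \<open>v\<close> alone that of \<open>P\<close>, although
      \<open>P\<close> contains both \<open>v\<close> and \<open>x\<close>.\<close>
    have "\<exists>c. good c"
    proof (rule ccontr)
      assume bad: "\<nexists>c. good c"
      define D where "D = cmp U y"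
      have yU: "y \<in> U" using y KU by blast
      have DU: "D \<subseteq> U" unfolding D_def by (rule cmp_subset[OF yU])
      have in_D: "Z \<subseteq> D" if "conn Z" "Z \<subseteq> U" "y \<in> Z" for Z
        unfolding D_def by (rule conn_subset_cmp[OF that])
      have KFD: "K \<union> F \<subseteq> D" by (rule in_D[OF KF]) (use KU FU y in auto)
      have "linked D {s} {x}"
      proof (rule linkedI)
        fix c
        show "\<exists>X \<subseteq> D - {c}. conn X \<and> touch X {s} \<and> touch X {x}"
        proof (cases "c \<in> F")
          case True
          then have cK: "c \<notin> K" using FK by blast
          have "touch (Kc c) {x}" using bad True unfolding good_def by blast
          moreover have "Kc c \<subseteq> D"
            by (rule in_D[OF conKc]) (use Kc_sub[OF cK] KKc[OF cK] y in auto)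
          ultimately show ?thesis using conKc Kcs[OF cK] Kc_sub[OF cK] by (intro exI[of _ "Kc c"]) auto
        next
          case False
          obtain X where X: "X \<subseteq> K - {c}" "conn X" "touch X {s}" "touch X {t}"
            using linkedD[OF qd(19), of c] by (elim exE conjE)
          have "touch X F" using touch_mono[OF X(4) order_refl, of F] tF by simp
          then have "conn (X \<union> F)" by (intro conn_Un X F) auto
          moreover have "touch (X \<union> F) {s}" "touch (X \<union> F) {x}" using X(3) F(2) by simp_all
          moreover have "X \<union> F \<subseteq> D - {c}" using X(1) False KFD by blast
          ultimately show ?thesis by blast
        qed
      qed
      moreover have "\<not> touch {s} {x}" using R(2) x(1) touch_commute unfolding touch_def by blast
      moreover have "x \<in> V" "x \<noteq> s" "v \<in> V" "v \<noteq> s" "v \<noteq> x" using x R 2(1) qd(3) dis(2) by auto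
      moreover have "\<not> touch {v} D" using DU U_iff unfolding touch_def by blast
      moreover have "s \<notin> D" "x \<notin> D" "v \<notin> D" "D \<subseteq> V" using DU xU U_iff by auto
      moreover have "conn D" unfolding D_def by (rule conn_cmp)
      ultimately have "quad {s} {x} {v} D"
        unfolding quad_def using dis(8) vs x(2) by simp
      then have "card P \<le> 1" using le by force
      then show False using R x(1) qd(22) 2(1) by (metis card_le_Suc0_iff_eq One_nat_def psubset_imp_subset subsetD)
    qed
    then obtain c0 where "good c0" by blast
    from ex_has_least_nat[of good, OF this, of "\<lambda>c. card (Kc c)"] obtain c where
      c: "good c" and cmin: "\<And>c'. good c' \<Longrightarrow> card (Kc c) \<le> card (Kc c')" by blast
    have cF: "c \<in> F" "\<not> touch (Kc c) {x}" "c \<notin> K" using c FK unfolding good_def by auto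
    note Kc = Kc_sub[OF cF(3)] KKc[OF cF(3)] Kc_closed[OF cF(3)] Kcs[OF cF(3)]
    have sep: "Z \<inter> Kc c = {} \<and> \<not> touch Z (Kc c)" if Z: "conn Z" "Z \<subseteq> insert x (U - {c})" "x \<in> Z" for Z
    proof -
      have step: "r \<in> Kc c" if "E k r" "k \<in> Kc c" "r \<in> Z" for k r
      proof (rule ccontr)
        assume r: "r \<notin> Kc c"
        show False
        proof (cases "r = x")
          case True
          then show False using that cF(2) unfolding touch_def by blast
        next
          case False
          then have "touch (Kc c) (U - {c} - Kc c)" using that r Z by (intro touchI[of k r]) auto
          then show False using Kc(3) by blast
        qed
      qed
      have 1: "Z \<inter> Kc c = {}"
      proof (rule ccontr)
        assume "Z \<inter> Kc c \<noteq> {}"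
        moreover have "x \<notin> Kc c" using Kc(1) xU by blast
        ultimately have "touch (Z \<inter> Kc c) (Z - Z \<inter> Kc c)" using Z by (intro connD) auto
        then show False using step unfolding touch_def by blast
      qed
      moreover have "\<not> touch Z (Kc c)"
      proof
        assume "touch Z (Kc c)"
        then obtain r k where "r \<in> Z" "k \<in> Kc c" "E r k" by (auto elim: touchE)
        then show False using step[of k r] 1 E_sym by blast
      qed
      ultimately show ?thesis by blast
    qed
    have RU: "Z \<subseteq> insert x (U - {c})" if "Z \<subseteq> R - {c}" for Z
      using that FU unfolding F_def by blast
    have lk: "linked (Kc c) {s} {c}"
    proof (cases "c = t")
      case True
      then show ?thesis using linked_subset[OF qd(19) Kc(2)] by blast
    next
      case ct: False
      then have cR: "c \<in> R" "c \<noteq> x" using cF(1) unfolding F_def by auto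
      show ?thesis
      proof (rule ccontr)
        assume "\<not> linked (Kc c) {s} {c}"
        then obtain c' where c': "\<And>X. X \<subseteq> Kc c - {c'} \<Longrightarrow> conn X \<Longrightarrow> touch X {s} \<Longrightarrow> touch X {c} \<Longrightarrow> False"
          unfolding linked_def by blast
        define W where "W = {t} \<union> R"
        have W: "conn W" "c \<in> W" "t \<in> W"
        proof -
          have "touch {t} R" using R(3) touch_commute by blast
          then show "conn W" unfolding W_def using R(1) by (intro conn_Un) auto
        qed (use cR in \<open>auto simp: W_def\<close>)
        \<comment> \<open>The stretch of the path from \<open>t\<close> to just before
          \<open>c\<close>. A connection inside \<open>K\<close> from \<open>s\<close> to
          \<open>t\<close> continues along it to \<open>c\<close>, so the supposed separator
          \<open>c'\<close> must lie on it.\<close>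
        define G where "G = cmp (W - {c}) t"
        have tW: "t \<in> W - {c}" using W ct by auto
        have G: "conn G" "touch G {c}" "t \<in> G" "G \<subseteq> W - {c}"
          unfolding G_def using conn_remove_touch[OF W] ct cmp_subset[OF tW] by (auto simp: conn_cmp)
        have GU: "G \<subseteq> insert x (U - {c})" using G(4) FU unfolding W_def F_def by blast
        have tKc: "t \<in> Kc c"
        proof -
          have "conn (K \<union> {t})" using Ks(2) by (intro conn_Un qd(8)) auto
          then have "K \<union> {t} \<subseteq> Kc c" unfolding Kc_def
            by (rule conn_subset_cmp) (use KU FU tF ct cF y in auto)
          then show ?thesis by blast
        qed
        have xG: "x \<notin> G" using sep[OF G(1) GU] tKc G(3) by blast
        then have GU': "G \<subseteq> U - {c}" using GU by blast
        have GKc: "G \<subseteq> Kc c"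
          by (rule conn_subset_closed[OF G(1) Kc(3) GU']) (use tKc G(3) in blast)
        have KGt: "touch K G" using touch_mono[OF Ks(2) order_refl] G(3) by blast
        have c'G: "c' \<in> G"
        proof (rule ccontr)
          assume n: "c' \<notin> G"
          obtain X where X: "X \<subseteq> K - {c'}" "conn X" "touch X {s}" "touch X {t}"
            using linkedD[OF qd(19), of c'] by (elim exE conjE)
          have "touch X G" using touch_mono[OF X(4) order_refl, of G] G(3) by simp
          then have "conn (X \<union> G)" by (intro conn_Un X G) auto
          moreover have "X \<union> G \<subseteq> Kc c - {c'}" using X(1) n Kc(2) GKc by blast
          ultimately show False using c'[of "X \<union> G"] X(3) G(2) by simp
        qed
        have GF: "G \<subseteq> F" using G(4) xG unfolding W_def F_def by blast
        have c'K: "c' \<notin> K" and c'F: "c' \<in> F" and c'Kc: "c' \<in> Kc c" using c'G GF GKc FK by auto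
        \<comment> \<open>After deletion of \<open>c'\<close>, the side of \<open>y\<close> no
          longer touches \<open>c\<close>. It is therefore closed in \<open>U - {c'}\<close> and
          contains \<open>Kc c'\<close>, so \<open>c'\<close> is good with a smaller component than
          \<open>c\<close>.\<close>
        define A where "A = cmp (Kc c - {c'}) y"
        have yA: "y \<in> Kc c - {c'}" using y Kc(2) c'K by blast
        have A: "conn A" "A \<subseteq> Kc c - {c'}" "\<not> touch A (Kc c - {c'} - A)" "K \<subseteq> A"
          unfolding A_def using conn_cmp cmp_subset[OF yA] cmp_closed[OF yA]
            conn_subset_cmp[OF qd(8) _ y, of "Kc c - {c'}"] Kc(2) c'K by auto
        have "touch A {s}" using touch_mono[OF Ks(1) A(4) order_refl] .
        then have nAc: "\<not> touch A {c}" using c'[OF A(2,1)] by blast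
        have Acl: "\<not> touch A (U - {c'} - A)"
        proof
          assume "touch A (U - {c'} - A)"
          then obtain k r where kr: "k \<in> A" "r \<in> U" "r \<noteq> c'" "r \<notin> A" "E k r" unfolding touch_def by blast
          have "r \<noteq> c" using nAc kr unfolding touch_def by blast
          moreover have "r \<notin> Kc c" using A(3) kr unfolding touch_def by blast
          ultimately have "touch (Kc c) (U - {c} - Kc c)" using kr A(2) by (intro touchI[of k r]) auto
          then show False using Kc(3) by blast
        qed
        have KA: "Kc c' \<subseteq> A"
          by (rule conn_subset_closed[OF conKc Acl Kc_sub[OF c'K]]) (use KKc[OF c'K] A(4) y in blast)
        have sub: "Kc c' \<subset> Kc c" using KA A(2) c'Kc by blast
        have "finite (Kc c)" using Kc(1) finite_V by (auto simp: U_def far_def intro: finite_subset)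
        then have "card (Kc c') < card (Kc c)" using sub psubset_card_mono by blast
        moreover have "good c'"
          unfolding good_def using c'F cF(2) sub touch_mono[of "Kc c'" "{x}" "Kc c" "{x}"] by blast
        ultimately show False using cmin by force
      qed
    qed
    have vKc: "\<not> touch {v} (Kc c)" "v \<notin> Kc c" "s \<notin> Kc c" "c \<notin> Kc c" "Kc c \<subseteq> V"
      using Kc(1) U_iff xU unfolding touch_def by blast+
    show ?thesis
    proof (cases "c = t")
      case False
      then have cR: "c \<in> R" "c \<noteq> x" using cF(1) unfolding F_def by auto
      \<comment> \<open>\<open>v\<close> and the stretch of \<open>R\<close> from \<open>x\<close>
        to \<open>c\<close> form a proper part of \<open>P\<close> that would do for
        \<open>s\<close> and \<open>c\<close> in place of \<open>s\<close> and
        \<open>t\<close>.\<close>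
      define Z where "Z = cmp (R - {c}) x"
      have xR: "x \<in> R - {c}" using x(1) cR by blast
      have Z: "conn Z" "Z \<subseteq> R - {c}" "x \<in> Z" "touch Z {c}"
        unfolding Z_def using conn_remove_touch[OF R(1) cR(1) x(1)] cR(2) cmp_subset[OF xR]
        by (auto simp: conn_cmp)
      have ZK: "Z \<inter> Kc c = {}" "\<not> touch Z (Kc c)" using sep[OF Z(1) RU[OF Z(2)] Z(3)] by blast+
      have conn': "conn ({v} \<union> Z)" using Z x(2) by (intro conn_Un) (auto simp: touch_def)
      have "quad {s} {c} ({v} \<union> Z) (Kc c)"
        unfolding quad_def
      proof (intro conjI)
        show "{s} \<subseteq> V" "{c} \<subseteq> V" "{v} \<union> Z \<subseteq> V" using dis cR Z R(5) qd(3) 2(1) by auto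
        show "{s} \<inter> {c} = {}" "{s} \<inter> ({v} \<union> Z) = {}" "{c} \<inter> ({v} \<union> Z) = {}"
          using dis(2) cR Z(2) R(4,5) 2(1) by auto
        show "({v} \<union> Z) \<inter> Kc c = {}" using ZK(1) vKc(2) by blast
        show "\<not> touch {s} {c}" using R(2) cR(1) E_sym unfolding touch_def by blast
        show "\<not> touch ({v} \<union> Z) (Kc c)" using ZK(2) vKc(1) by (simp only: touch_Un simp_thms)
        show "touch ({v} \<union> Z) {s}" using vs by (simp only: touch_Un touch_singletons simp_thms)
        show "touch ({v} \<union> Z) {c}" using Z(4) by (simp only: touch_Un simp_thms)
      qed (use vKc conKc lk conn' in simp_all)
      then have "card P \<le> card ({v} \<union> Z)" by (rule le)
      moreover have sub: "{v} \<union> Z \<subset> P" using Z(2) R(4,5) cR(1) 2(1) by blast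
      ultimately show ?thesis using psubset_card_mono[OF qd(22) sub] by linarith
    next
      case True
      have far: "far v s t = U - {c}" unfolding True U_def far_def by auto
      have K_eq: "cmp (far v s t) y = Kc c" unfolding Kc_def far ..
      have cR: "c \<notin> R" using True dis(4) R(5) by auto
      have RK: "R \<inter> Kc c = {}" "\<not> touch R (Kc c)" using sep[OF R(1) RU x(1)] cR by auto
      have "P \<subseteq> away (Kc c)"
      proof
        fix p assume p: "p \<in> P"
        then have "p = v \<or> p \<in> R" using R(6) by blast
        then have "p \<notin> Kc c" "\<not> touch {p} (Kc c)"
          using RK vKc(1,2) touch_mono[of "{p}" "Kc c" R "Kc c"] by auto
        then show "p \<in> away (Kc c)" using p qd(3) unfolding away_def by blast
      qed
      then have "P \<subseteq> cmp (away (Kc c)) v" by (rule conn_subset_cmp[OF qd(7) _ 2(1)])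
      then have "touch (cmp (away (Kc c)) v) {t}" using touch_mono[OF qd(18) _ order_refl] by blast
      moreover have "y \<in> far v s t" unfolding far using y KU cF(3) by blast
      moreover have "t \<noteq> v" using dis(4) 2(1) by auto
      ultimately have "long_witness v s t y"
        unfolding long_witness_def K_eq using vs dis lk True by auto
      then show ?thesis by blast
    qed
  qed
qed

theorem quad_iff_witness:
  "(\<exists>S T P K. quad S T P K) \<longleftrightarrow> (\<exists>v s t y. long_witness v s t y \<or> fan_witness v s t y)"
proof
  assume "\<exists>S T P K. quad S T P K"
  then have ex: "\<exists>s T P K. quad {s} T P K" using quad_singleton by blast
  \<comment> \<open>This minimum ranges over quadruples with one singleton side only. If the other
    side is a singleton too, the comparison with such quadruples reduces to the size of
    \<open>P\<close>.\<close>
  define m where "m = (LEAST n. \<exists>s T P K. quad {s} T P K \<and> n = 3 * card T + 2 * card P)"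
  have "\<exists>s T P K. quad {s} T P K \<and> m = 3 * card T + 2 * card P"
    unfolding m_def by (rule LeastI_ex) (use ex in blast)
  then obtain s T P K where q: "quad {s} T P K" and m: "m = 3 * card T + 2 * card P"
    by (elim exE conjE)
  have le: "\<forall>s' T' P' K'. quad {s'} T' P' K' \<longrightarrow>
      3 * card T + 2 * card P \<le> 3 * card T' + 2 * card P'"
    unfolding m[symmetric] m_def by (intro allI impI Least_le) blast
  show "\<exists>v s t y. long_witness v s t y \<or> fan_witness v s t y"
  proof (cases "\<exists>t. T = {t}")
    case True
    then obtain t where t: "T = {t}" by blast
    have "\<forall>s' t' P' K'. quad {s'} {t'} P' K' \<longrightarrow> card P \<le> card P'"
      using le t by fastforce
    then show ?thesis using minimal_quad_long q t by blast
  next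
    case False
    then show ?thesis using minimal_quad_fan[OF q False le] by blast
  qed
next
  assume "\<exists>v s t y. long_witness v s t y \<or> fan_witness v s t y"
  then show "\<exists>S T P K. quad S T P K"
    using long_witness_quad fan_witness_quad by blast
qed

section \<open>Linkedness in terms of vertices\<close>

text \<open>Removes the quantifier over sets: the best connection avoiding \<open>c\<close> is a
  whole component of \<open>U - {c}\<close>, which is determined by one vertex \<open>k\<close> of
  it. What remains are vertices and reachability.\<close>

lemma linked_cmp_iff:
  assumes U: "U \<subseteq> V" and y: "y \<in> U"
  shows "linked (cmp U y) S T \<longleftrightarrow> (\<forall>c\<in>V. \<exists>k\<in>V. \<exists>l\<in>V. k \<in> cmp U y \<and> touch {k} S \<and> touch {l} T \<and>
    k \<in> U - {c} \<and> l \<in> cmp (U - {c}) k)"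
    (is "_ \<longleftrightarrow> (\<forall>c\<in>V. ?P c)")
proof
  note CU = cmp_subset[OF y]
  assume L: "linked (cmp U y) S T"
  show "\<forall>c\<in>V. ?P c"
  proof
    fix c
    obtain X where X: "X \<subseteq> cmp U y - {c}" "conn X" "touch X S" "touch X T"
      using linkedD[OF L, of c] by (elim exE conjE)
    obtain k l where kl: "k \<in> X" "l \<in> X" "touch {k} S" "touch {l} T"
      using X(3,4) unfolding touch_def by blast
    have XU: "X \<subseteq> U - {c}" using X(1) CU by blast
    have "X \<subseteq> cmp (U - {c}) k" by (rule conn_subset_cmp[OF X(2) XU kl(1)])
    moreover have "k \<in> V" "l \<in> V" using kl(1,2) XU U by auto
    ultimately show "?P c" using kl X(1) XU by (intro bexI[of _ k] bexI[of _ l]) auto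
  qed
next
  note CU = cmp_subset[OF y]
  assume P: "\<forall>c\<in>V. ?P c"
  have *: "\<exists>X \<subseteq> cmp U y - {c}. conn X \<and> touch X S \<and> touch X T" if c: "c \<in> V" for c
  proof -
    obtain k l where kl: "k \<in> cmp U y" "touch {k} S" "touch {l} T" "k \<in> U - {c}" "l \<in> cmp (U - {c}) k"
      using bspec[OF P c] by (elim bexE conjE)
    let ?X = "cmp (U - {c}) k"
    have XU: "?X \<subseteq> U - {c}" by (rule cmp_subset[OF kl(4)])
    have "?X \<subseteq> cmp U y"
      by (rule conn_subset_closed[OF conn_cmp cmp_closed[OF y]]) (use XU kl(1) cmp_refl[of k "U - {c}"] in blast)+
    moreover have "touch ?X S" "touch ?X T"
      using kl(2,3,5) cmp_refl[of k "U - {c}"] unfolding touch_def by blast+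
    ultimately show ?thesis using XU conn_cmp by (intro exI[of _ ?X]) auto
  qed
  show "linked (cmp U y) S T"
  proof (rule linkedI)
    fix c
    show "\<exists>X \<subseteq> cmp U y - {c}. conn X \<and> touch X S \<and> touch X T"
    proof (cases "c \<in> V")
      case False
      \<comment> \<open>A \<open>c\<close> outside \<open>V\<close> deletes nothing, so the set
        found for any vertex of \<open>V\<close> will do; \<open>y\<close> is one.\<close>
      obtain X where "X \<subseteq> cmp U y - {y}" "conn X" "touch X S" "touch X T"
        using *[of y] y U by blast
      then show ?thesis using False CU U by (intro exI[of _ X]) auto
    qed (rule *)
  qed
qed

end

section \<open>Models of induced minors\<close>

abbreviation adj :: "'a ugraph \<Rightarrow> 'a \<Rightarrow> 'a \<Rightarrow> bool" where
  "adj G u v \<equiv> {u, v} \<in> edges G"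

abbreviation gtouch :: "'a ugraph \<Rightarrow> 'a set \<Rightarrow> 'a set \<Rightarrow> bool" where
  "gtouch G \<equiv> sgraph.touch (adj G)"

abbreviation gconn :: "'a ugraph \<Rightarrow> 'a set \<Rightarrow> bool" where
  "gconn G \<equiv> sgraph.conn (adj G)"

lemma simple_graph_edge:
  assumes "simple_graph G" "{u, v} \<in> edges G"
  shows "u \<in> verts G" "v \<in> verts G" "u \<noteq> v"
proof -
  have "{u, v} \<subseteq> verts G" "card {u, v} = 2"
    using assms by (auto simp: simple_graph_def)
  then show "u \<in> verts G" "v \<in> verts G" "u \<noteq> v" by auto
qed

lemma sgraph_adj: "simple_graph G \<Longrightarrow> sgraph (adj G) (verts G)"
  using simple_graph_edge by unfold_locales (auto simp: simple_graph_def insert_commute)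

lemma gtouch_iff:
  assumes "simple_graph G"
  shows "gtouch G A B \<longleftrightarrow> (\<exists>a\<in>A. \<exists>b\<in>B. adj G a b)"
  using sgraph.touch_def[OF sgraph_adj[OF assms]] .

lemma gconn_iff:
  assumes "simple_graph G"
  shows "gconn G X \<longleftrightarrow> X \<noteq> {} \<and> (\<forall>Y. Y \<subset> X \<and> Y \<noteq> {} \<longrightarrow> (\<exists>a\<in>Y. \<exists>b\<in>X - Y. adj G a b))"
  using sgraph.conn_def[OF sgraph_adj[OF assms]] gtouch_iff[OF assms] by simp

text \<open>Vertices in no bag are those to be deleted. Non-adjacent vertices of \<open>H\<close>
  forbid contact between their bags, which is what makes the minor induced.\<close>

definition minor_model :: "'a ugraph \<Rightarrow> 'b ugraph \<Rightarrow> ('b \<Rightarrow> 'a set) \<Rightarrow> bool" where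
  "minor_model G H f \<longleftrightarrow> (\<forall>h\<in>verts H. f h \<subseteq> verts G \<and> gconn G (f h)) \<and>
     (\<forall>h\<in>verts H. \<forall>h'\<in>verts H. h \<noteq> h' \<longrightarrow>
        f h \<inter> f h' = {} \<and> (gtouch G (f h) (f h') \<longleftrightarrow> {h, h'} \<in> edges H))"

text \<open>Common frame for undoing a deletion, undoing a contraction and performing one: only the
  effect on single bags and on pairs of bags remains to be checked.\<close>

lemma minor_model_transfer:
  assumes "minor_model G H f" "simple_graph G" "simple_graph G'"
    and "\<And>h. h \<in> verts H \<Longrightarrow> f' h \<subseteq> verts G' \<and> (gconn G (f h) \<longrightarrow> gconn G' (f' h))"
    and "\<And>h h'. h \<in> verts H \<Longrightarrow> h' \<in> verts H \<Longrightarrow> h \<noteq> h' \<Longrightarrow> f h \<inter> f h' = {} \<Longrightarrow>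
      f' h \<inter> f' h' = {} \<and> (gtouch G' (f' h) (f' h') \<longleftrightarrow> gtouch G (f h) (f h'))"
  shows "minor_model G' H f'"
  unfolding minor_model_def
proof (intro conjI ballI impI)
  fix h assume h: "h \<in> verts H"
  then have "gconn G (f h)" using assms(1) unfolding minor_model_def by blast
  then show "f' h \<subseteq> verts G'" "gconn G' (f' h)" using assms(4)[OF h] by simp_all
  fix h' assume h': "h' \<in> verts H" "h \<noteq> h'"
  then have "f h \<inter> f h' = {}" "gtouch G (f h) (f h') \<longleftrightarrow> {h, h'} \<in> edges H"
    using assms(1) h unfolding minor_model_def by blast+
  then show "f' h \<inter> f' h' = {}" "gtouch G' (f' h) (f' h') \<longleftrightarrow> {h, h'} \<in> edges H"
    using assms(5)[OF h h'] by simp_all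
qed

lemma gconn_cong:
  assumes "simple_graph G" "simple_graph G'"
    and "\<And>a b. a \<in> X \<Longrightarrow> b \<in> X \<Longrightarrow> adj G a b \<longleftrightarrow> adj G' a b"
  shows "gconn G X \<longleftrightarrow> gconn G' X"
  unfolding gconn_iff[OF assms(1)] gconn_iff[OF assms(2)]
  by (intro conj_cong refl all_cong1 imp_cong bex_cong) (use assms(3) in blast)+

section \<open>Models under deletion and contraction\<close>

lemma adj_delete_vertex: "adj (delete_vertex x G) a b \<longleftrightarrow> adj G a b \<and> a \<noteq> x \<and> b \<noteq> x"
  unfolding delete_vertex_def by auto

lemma adj_contract_edge:
  "adj (contract_edge u v G) a b \<longleftrightarrow> adj G a b \<and> a \<noteq> v \<and> b \<noteq> v \<or>
     a = u \<and> b \<noteq> u \<and> adj G v b \<or> b = u \<and> a \<noteq> u \<and> adj G v a"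
  unfolding contract_edge_def by (auto simp: doubleton_eq_iff)

lemma gconn_delete_vertex:
  assumes "simple_graph G" "simple_graph (delete_vertex x G)" "x \<notin> X"
  shows "gconn (delete_vertex x G) X \<longleftrightarrow> gconn G X"
  by (rule gconn_cong[OF assms(2,1)]) (use assms(3) in \<open>auto simp only: adj_delete_vertex\<close>)

lemma gtouch_delete_vertex:
  assumes "simple_graph G" "simple_graph (delete_vertex x G)" "x \<notin> X" "x \<notin> Y"
  shows "gtouch (delete_vertex x G) X Y \<longleftrightarrow> gtouch G X Y"
  unfolding gtouch_iff[OF assms(1)] gtouch_iff[OF assms(2)]
  unfolding adj_delete_vertex
  by (intro bex_cong refl) (use assms(3,4) in auto)

context
  fixes G :: "'a ugraph" and u v :: 'a
  assumes G: "simple_graph G" and uv: "adj G u v"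
begin

lemma simple_graph_contract_edge: "simple_graph (contract_edge u v G)"
  by (rule minor_step_simple_graph[OF minor_step.contraction[OF uv] G])

lemma contracted_edge_neq: "u \<noteq> v" using simple_graph_edge(3)[OF G uv] .

lemma gconn_contract_edge_other:
  assumes "u \<notin> X" "v \<notin> X"
  shows "gconn (contract_edge u v G) X \<longleftrightarrow> gconn G X"
proof -
  have "adj (contract_edge u v G) a b \<longleftrightarrow> adj G a b" if "a \<in> X" "b \<in> X" for a b
    unfolding adj_contract_edge using that assms by blast
  then show ?thesis
    by (rule gconn_cong[OF simple_graph_contract_edge G])
qed

text \<open>Cuts of \<open>X\<close> after the contraction correspond to the cuts of
  \<open>insert v X\<close> with \<open>u\<close> and \<open>v\<close> on the same side. A cut that
  separates these two is crossed by the contracted edge itself.\<close>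

lemma gconn_contract_edge:
  assumes "u \<in> X" "v \<notin> X"
  shows "gconn (contract_edge u v G) X \<longleftrightarrow> gconn G (insert v X)"
proof
  assume X: "gconn (contract_edge u v G) X"
  show "gconn G (insert v X)"
    unfolding gconn_iff[OF G]
  proof (intro conjI allI impI)
    fix Y assume Y: "Y \<subset> insert v X \<and> Y \<noteq> {}"
    show "\<exists>a\<in>Y. \<exists>b\<in>insert v X - Y. adj G a b"
    proof (rule ccontr)
      assume "\<not> ?thesis"
      then have n: "\<not> adj G a b" if "a \<in> Y" "b \<in> insert v X" "b \<notin> Y" for a b using that by blast
      have same: "u \<in> Y \<longleftrightarrow> v \<in> Y"
        using n[of u v] n[of v u] uv assms(1) by (auto simp: insert_commute)
      then have "Y - {v} \<subset> X \<and> Y - {v} \<noteq> {}" using Y assms contracted_edge_neq by auto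
      then obtain a b where ab: "a \<in> Y - {v}" "b \<in> X - (Y - {v})" "adj (contract_edge u v G) a b"
        using X unfolding gconn_iff[OF simple_graph_contract_edge] by blast
      then have "b \<notin> Y" "a \<in> Y" using assms by auto
      then show False
        using ab(3) n[of a b] n[of v b] n[of a v] same ab(1,2)
        unfolding adj_contract_edge by (auto simp: insert_commute)
    qed
  qed simp
next
  assume X: "gconn G (insert v X)"
  show "gconn (contract_edge u v G) X"
    unfolding gconn_iff[OF simple_graph_contract_edge]
  proof (intro conjI allI impI)
    show "X \<noteq> {}" using assms by blast
    fix Y assume Y: "Y \<subset> X \<and> Y \<noteq> {}"
    define Z where "Z = (if u \<in> Y then insert v Y else Y)"
    have "Z \<subset> insert v X \<and> Z \<noteq> {}" unfolding Z_def using Y assms by auto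
    then obtain a b where ab: "a \<in> Z" "b \<in> insert v X" "b \<notin> Z" "adj G a b"
      using X unfolding gconn_iff[OF G] by blast
    consider "a = v" | "b = v" | "a \<noteq> v" "b \<noteq> v" by blast
    then show "\<exists>a\<in>Y. \<exists>b\<in>X - Y. adj (contract_edge u v G) a b"
    proof cases
      case 1
      then have "u \<in> Y" "b \<in> X - Y" "b \<noteq> u" using ab Y assms unfolding Z_def by (auto split: if_splits)
      then show ?thesis using ab(4) 1 unfolding adj_contract_edge by blast
    next
      case 2
      then have "u \<notin> Y" "a \<in> Y" "a \<noteq> u" using ab unfolding Z_def by (auto split: if_splits)
      then show ?thesis using ab(4) 2 assms unfolding adj_contract_edge
        by (intro bexI[of _ a] bexI[of _ u]) (auto simp: insert_commute)
    next
      case 3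
      then have "a \<in> Y" "b \<in> X - Y" using ab unfolding Z_def by (auto split: if_splits)
      then show ?thesis using ab(4) 3 unfolding adj_contract_edge by blast
    qed
  qed
qed

lemma gtouch_contract_edge_other:
  assumes "u \<notin> X" "v \<notin> X" "u \<notin> Y" "v \<notin> Y"
  shows "gtouch (contract_edge u v G) X Y \<longleftrightarrow> gtouch G X Y"
  unfolding gtouch_iff[OF G] gtouch_iff[OF simple_graph_contract_edge]
    unfolding adj_contract_edge
  using assms by blast

lemma gtouch_contract_edge:
  assumes "u \<in> X" "v \<notin> X" "u \<notin> Y" "v \<notin> Y"
  shows "gtouch (contract_edge u v G) X Y \<longleftrightarrow> gtouch G (insert v X) Y"
    and "gtouch (contract_edge u v G) Y X \<longleftrightarrow> gtouch G Y (insert v X)"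
proof -
  show *: "gtouch (contract_edge u v G) X Y \<longleftrightarrow> gtouch G (insert v X) Y"
    unfolding gtouch_iff[OF G] gtouch_iff[OF simple_graph_contract_edge]
    unfolding adj_contract_edge
  proof (intro iffI; elim bexE)
    fix a b assume "a \<in> X" "b \<in> Y"
      and "adj G a b \<and> a \<noteq> v \<and> b \<noteq> v \<or> a = u \<and> b \<noteq> u \<and> adj G v b \<or> b = u \<and> a \<noteq> u \<and> adj G v a"
    then show "\<exists>a\<in>insert v X. \<exists>b\<in>Y. adj G a b" using assms by auto
  next
    fix a b assume ab: "a \<in> insert v X" "b \<in> Y" "adj G a b"
    then have "b \<noteq> u" "b \<noteq> v" using assms by auto
    then show "\<exists>a\<in>X. \<exists>b\<in>Y. adj G a b \<and> a \<noteq> v \<and> b \<noteq> v \<or>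
      a = u \<and> b \<noteq> u \<and> adj G v b \<or> b = u \<and> a \<noteq> u \<and> adj G v a"
      using ab assms(1) by (cases "a = v") auto
  qed
  then show "gtouch (contract_edge u v G) Y X \<longleftrightarrow> gtouch G Y (insert v X)"
    using sgraph.touch_commute[OF sgraph_adj[OF G]]
      sgraph.touch_commute[OF sgraph_adj[OF simple_graph_contract_edge]] by blast
qed

lemma minor_model_uncontract:
  assumes "minor_model (contract_edge u v G) H f"
  shows "minor_model G H (\<lambda>h. if u \<in> f h then insert v (f h) else f h)"
proof (rule minor_model_transfer[OF assms simple_graph_contract_edge G])
  have vs: "verts (contract_edge u v G) = verts G - {v}" by (simp add: contract_edge_def)
  have sub: "f h \<subseteq> verts G" "v \<notin> f h" if "h \<in> verts H" for h
    using assms that unfolding minor_model_def vs by auto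
  show "(if u \<in> f h then insert v (f h) else f h) \<subseteq> verts G \<and> (gconn (contract_edge u v G) (f h) \<longrightarrow>
      gconn G (if u \<in> f h then insert v (f h) else f h))" if "h \<in> verts H" for h
    using sub[OF that] gconn_contract_edge gconn_contract_edge_other simple_graph_edge(2)[OF G uv] by auto
  show "(if u \<in> f h then insert v (f h) else f h) \<inter> (if u \<in> f h' then insert v (f h') else f h') = {} \<and>
      (gtouch G (if u \<in> f h then insert v (f h) else f h) (if u \<in> f h' then insert v (f h') else f h') \<longleftrightarrow>
       gtouch (contract_edge u v G) (f h) (f h'))"
    if "h \<in> verts H" "h' \<in> verts H" "h \<noteq> h'" "f h \<inter> f h' = {}" for h h'
    using that sub gtouch_contract_edge gtouch_contract_edge_other
    by (cases "u \<in> f h"; cases "u \<in> f h'") auto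
qed

text \<open>Bags are disjoint, so both ends of the edge are missing from every bag other than
  \<open>f h0\<close>, and those bags are unaffected.\<close>

lemma minor_model_contract:
  assumes f: "minor_model G H f" and h0: "h0 \<in> verts H" "u \<in> f h0" "v \<in> f h0"
  shows "minor_model (contract_edge u v G) H (\<lambda>h. f h - {v})"
proof (rule minor_model_transfer[OF f G simple_graph_contract_edge])
  have vs: "verts (contract_edge u v G) = verts G - {v}" by (simp add: contract_edge_def)
  have iff: "v \<in> f h \<longleftrightarrow> u \<in> f h" "u \<in> f h \<longleftrightarrow> h = h0" if "h \<in> verts H" for h
  proof -
    have "h \<noteq> h0 \<Longrightarrow> f h \<inter> f h0 = {}" using f h0(1) that unfolding minor_model_def by blast
    then show "v \<in> f h \<longleftrightarrow> u \<in> f h" "u \<in> f h \<longleftrightarrow> h = h0" using h0(2,3) by blast+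
  qed
  have cases: "u \<in> f h - {v} \<and> insert v (f h - {v}) = f h \<or> u \<notin> f h - {v} \<and> v \<notin> f h \<and> f h - {v} = f h"
    if "h \<in> verts H" for h
    using iff[OF that] contracted_edge_neq by blast
  show "f h - {v} \<subseteq> verts (contract_edge u v G) \<and> (gconn G (f h) \<longrightarrow> gconn (contract_edge u v G) (f h - {v}))"
    if "h \<in> verts H" for h
  proof
    show "f h - {v} \<subseteq> verts (contract_edge u v G)"
      using f that unfolding minor_model_def vs by blast
    show "gconn G (f h) \<longrightarrow> gconn (contract_edge u v G) (f h - {v})"
      using cases[OF that]
    proof (elim disjE conjE)
      assume "u \<in> f h - {v}" "insert v (f h - {v}) = f h"
      then show ?thesis using gconn_contract_edge[of "f h - {v}"] by auto
    next
      assume "u \<notin> f h - {v}" "v \<notin> f h" "f h - {v} = f h"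
      then show ?thesis using gconn_contract_edge_other[of "f h"] by simp
    qed
  qed
  show "(f h - {v}) \<inter> (f h' - {v}) = {} \<and>
      (gtouch (contract_edge u v G) (f h - {v}) (f h' - {v}) \<longleftrightarrow> gtouch G (f h) (f h'))"
    if "h \<in> verts H" "h' \<in> verts H" "h \<noteq> h'" "f h \<inter> f h' = {}" for h h'
  proof
    show "(f h - {v}) \<inter> (f h' - {v}) = {}" using that(4) by blast
    note hh = cases[OF that(1)] cases[OF that(2)] that(4)
    consider (a) "u \<in> f h - {v}" "insert v (f h - {v}) = f h" "u \<notin> f h'" "v \<notin> f h'" "f h' - {v} = f h'"
      | (b) "u \<in> f h' - {v}" "insert v (f h' - {v}) = f h'" "u \<notin> f h" "v \<notin> f h" "f h - {v} = f h"
      | (c) "u \<notin> f h" "v \<notin> f h" "f h - {v} = f h" "u \<notin> f h'" "v \<notin> f h'" "f h' - {v} = f h'"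
      using hh by blast
    then show "gtouch (contract_edge u v G) (f h - {v}) (f h' - {v}) \<longleftrightarrow> gtouch G (f h) (f h')"
    proof cases
      case a
      then show ?thesis
        unfolding a(5) using gtouch_contract_edge(1)[OF a(1) _ a(3,4), unfolded a(2)] by simp
    next
      case b
      then show ?thesis
        unfolding b(5) using gtouch_contract_edge(2)[OF b(1) _ b(3,4), unfolded b(2)] by simp
    next
      case c
      then show ?thesis using gtouch_contract_edge_other by simp
    qed
  qed
qed

end

lemma minor_model_step:
  assumes "minor_step G G'" "simple_graph G" "minor_model G' H f"
  shows "\<exists>f'. minor_model G H f'"
  using assms(1)
proof cases
  case (deletion x)
  have G': "simple_graph (delete_vertex x G)"
    using minor_step_simple_graph[OF assms(1,2)] deletion by simp
  have vs: "verts (delete_vertex x G) = verts G - {x}" by (simp add: delete_vertex_def)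
  have f: "minor_model (delete_vertex x G) H f" using assms(3) deletion by simp
  then have "f h \<subseteq> verts G" "x \<notin> f h" if "h \<in> verts H" for h
    using that unfolding minor_model_def vs by auto
  then have "minor_model G H f"
    by (intro minor_model_transfer[OF f G' assms(2)])
      (simp_all add: gconn_delete_vertex[OF assms(2) G'] gtouch_delete_vertex[OF assms(2) G'])
  then show ?thesis by blast
next
  case (contraction u v)
  then show ?thesis using minor_model_uncontract[OF assms(2)] assms(3) by blast
qed

lemma graph_iso_minor_model:
  assumes iso: "graph_iso G H" and G: "simple_graph G" and H: "simple_graph H"
  shows "\<exists>f. minor_model G H f"
proof -
  obtain f where f: "bij_betw f (verts G) (verts H)"
    and e: "\<And>u v. u \<in> verts G \<Longrightarrow> v \<in> verts G \<Longrightarrow> adj G u v \<longleftrightarrow> {f u, f v} \<in> edges H"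
    using iso unfolding graph_iso_def by blast
  define g where "g = inv_into (verts G) f"
  have g: "g h \<in> verts G" "f (g h) = h" if "h \<in> verts H" for h
    using f that unfolding g_def by (auto simp: bij_betw_def f_inv_into_f inv_into_into)
  have "minor_model G H (\<lambda>h. {g h})"
    unfolding minor_model_def gtouch_iff[OF G]
    using g e sgraph.conn_singleton[OF sgraph_adj[OF G]] by (auto; metis)
  then show ?thesis by blast
qed

lemma contains_induced_minor_imp_model:
  assumes "contains_induced_minor G H" and G: "simple_graph G" and H: "simple_graph H"
  shows "\<exists>f. minor_model G H f"
proof -
  obtain G' where "minor_step\<^sup>*\<^sup>* G G'" and iso: "graph_iso G' H"
    using assms(1) unfolding contains_induced_minor_def by blast
  then show ?thesis using G
  proof (induction rule: converse_rtranclp_induct)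
    case base
    then show ?case using graph_iso_minor_model[OF iso _ H] by blast
  next
    case (step G1 G2)
    then show ?case using minor_model_step minor_step_simple_graph by metis
  qed
qed

text \<open>By induction on the number of vertices: a vertex in no bag is deleted, an edge inside a
  bag is contracted, and once the bags are singletons that cover the graph, the model is an
  isomorphism.\<close>

lemma minor_model_imp_contains:
  assumes "minor_model G H f" and G: "simple_graph G" and H: "simple_graph H"
  shows "contains_induced_minor G H"
  using assms(1) G
proof (induction "card (verts G)" arbitrary: G f rule: less_induct)
  case less
  note f = less.prems(1) and G = less.prems(2)
  have step: ?case if "minor_step G G'" "card (verts G') < card (verts G)" "minor_model G' H f'" for G' f'
    using less.hyps[OF that(2,3) minor_step_simple_graph[OF that(1) G]] that(1)
    unfolding contains_induced_minor_def by (meson converse_rtranclp_into_rtranclp)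
  have fin: "finite (verts G)" using G by (simp add: simple_graph_def)
  show ?case
  proof (cases "\<exists>x\<in>verts G. \<forall>h\<in>verts H. x \<notin> f h")
    case True
    then obtain x where x: "x \<in> verts G" "\<And>h. h \<in> verts H \<Longrightarrow> x \<notin> f h" by blast
    have st: "minor_step G (delete_vertex x G)" by (rule minor_step.deletion[OF x(1)])
    note G' = minor_step_simple_graph[OF st G]
    have vs: "verts (delete_vertex x G) = verts G - {x}" by (simp add: delete_vertex_def)
    have "minor_model (delete_vertex x G) H f"
      using x(2) f unfolding minor_model_def vs
      by (auto simp: gconn_delete_vertex[OF G G'] gtouch_delete_vertex[OF G G'])
    moreover have "card (verts (delete_vertex x G)) < card (verts G)"
      unfolding vs using card_Diff1_less[OF fin x(1)] .
    ultimately show ?thesis using step[OF st] by blast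
  next
    case cover: False
    show ?thesis
    proof (cases "\<exists>h\<in>verts H. \<nexists>x. f h = {x}")
      case True
      then obtain h where h: "h \<in> verts H" "\<nexists>x. f h = {x}" by blast
      have conn: "gconn G (f h)" using f h(1) unfolding minor_model_def by blast
      obtain u where u: "u \<in> f h" using conn unfolding gconn_iff[OF G] by blast
      have "{u} \<subset> f h" using u h(2) by blast
      then obtain v where v: "v \<in> f h" "adj G u v"
        using conn[unfolded gconn_iff[OF G], THEN conjunct2, rule_format, of "{u}"] by blast
      have st: "minor_step G (contract_edge u v G)" by (rule minor_step.contraction[OF v(2)])
      have vs: "verts (contract_edge u v G) = verts G - {v}" by (simp add: contract_edge_def)
      have "card (verts (contract_edge u v G)) < card (verts G)"
        unfolding vs using card_Diff1_less[OF fin simple_graph_edge(2)[OF G v(2)]] .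
      then show ?thesis
        using step[OF st] minor_model_contract[OF G v(2) f h(1) u v(1)] by blast
    next
      case False
      then have "\<forall>h\<in>verts H. \<exists>x. f h = {x}" by blast
      then obtain g where g: "\<And>h. h \<in> verts H \<Longrightarrow> f h = {g h}" by metis
      have inj: "inj_on g (verts H)"
        using f g unfolding minor_model_def by (intro inj_onI) fastforce
      have img: "g ` verts H = verts G"
        using f g cover unfolding minor_model_def by fastforce
      have bij: "bij_betw g (verts H) (verts G)" using inj img by (simp add: bij_betw_def)
      define k where "k = inv_into (verts H) g"
      have k: "bij_betw k (verts G) (verts H)" unfolding k_def by (rule bij_betw_inv_into[OF bij])
      have gk: "g (k x) = x" "k x \<in> verts H" if "x \<in> verts G" for x
        using that img unfolding k_def by (auto simp: f_inv_into_f inv_into_into)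
      have "adj G x y \<longleftrightarrow> {k x, k y} \<in> edges H" if xy: "x \<in> verts G" "y \<in> verts G" for x y
      proof (cases "x = y")
        case True
        then show ?thesis using simple_graph_edge(3)[OF G] simple_graph_edge(3)[OF H] by blast
      next
        case ne: False
        then have kne: "k x \<noteq> k y" using gk xy by metis
        have "gtouch G (f (k x)) (f (k y)) \<longleftrightarrow> {k x, k y} \<in> edges H"
          using f gk(2)[OF xy(1)] gk(2)[OF xy(2)] kne unfolding minor_model_def by blast
        then show ?thesis using g gk xy by (simp add: gtouch_iff[OF G])
      qed
      then have "graph_iso G H" unfolding graph_iso_def using k by blast
      then show ?thesis unfolding contains_induced_minor_def by blast
    qed
  qed
qed

section \<open>Models of \<open>F2\<close> and quadruples\<close>

lemma contains_F2_iff_quad: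
  assumes G: "simple_graph G"
  shows "contains_induced_minor G F2 \<longleftrightarrow> (\<exists>S T P K. sgraph.quad (adj G) (verts G) S T P K)"
proof -
  interpret g: sgraph "adj G" "verts G" by (rule sgraph_adj[OF G])
  have V: "verts F2 = {1, 2, 3, 4, 5}" and E: "edges F2 = {{1, 2}, {1, 5}, {2, 3}, {2, 4}, {3, 4}, {3, 5}, {4, 5}}"
    by (simp_all add: F2_def)
  show ?thesis
  proof
    assume "contains_induced_minor G F2"
    then obtain f where f: "minor_model G F2 f"
      using contains_induced_minor_imp_model[OF _ G simple_graph_F2] by blast
    have c: "g.conn (f h)" "f h \<subseteq> verts G" if "h \<in> {1, 2, 3, 4, 5}" for h
      using f that unfolding minor_model_def V by blast+
    have d: "f h \<inter> f h' = {}" "g.touch (f h) (f h') \<longleftrightarrow> {h, h'} \<in> edges F2"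
      if "h \<in> {1, 2, 3, 4, 5}" "h' \<in> {1, 2, 3, 4, 5}" "h \<noteq> h'" for h h'
      using f that unfolding minor_model_def V by blast+
    have t: "g.touch (f 3) (f 4)" "g.touch (f 3) (f 2)" "g.touch (f 3) (f 5)" "g.touch (f 4) (f 2)"
      "g.touch (f 4) (f 5)" "g.touch (f 1) (f 2)" "g.touch (f 1) (f 5)"
      "\<not> g.touch (f 2) (f 5)" "\<not> g.touch (f 1) (f 3)" "\<not> g.touch (f 1) (f 4)"
      by (subst d(2); simp add: E doubleton_eq_iff)+
    have disj: "f 2 \<inter> f 5 = {}" "f 2 \<inter> f 1 = {}" "f 2 \<inter> f 3 = {}" "f 2 \<inter> f 4 = {}" "f 5 \<inter> f 1 = {}"
      "f 5 \<inter> f 3 = {}" "f 5 \<inter> f 4 = {}" "f 1 \<inter> f 3 = {}" "f 1 \<inter> f 4 = {}" "f 3 \<inter> f 4 = {}"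
      by (rule d(1); simp)+
    have "g.conn (f 3 \<union> f 4)" using t(1) c by (intro g.conn_Un) auto
    moreover have "g.linked (f 3 \<union> f 4) (f 2) (f 5)"
      by (rule g.linked_two[of "f 3" _ "f 4"]) (use c t disj in auto)
    ultimately have "g.quad (f 2) (f 5) (f 1) (f 3 \<union> f 4)"
      unfolding g.quad_def using c t disj by (simp add: Int_Un_distrib)
    then show "\<exists>S T P K. g.quad S T P K" by blast
  next
    assume "\<exists>S T P K. g.quad S T P K"
    then obtain S T P K where q: "g.quad S T P K" by blast
    obtain X Y where "g.split K S T X Y" using g.quad_split[OF q] by blast
    then have xy: "X \<subseteq> K" "Y \<subseteq> K" "X \<inter> Y = {}" "g.conn X" "g.conn Y" "g.touch X Y"
      "g.touch X S" "g.touch X T" "g.touch Y S" "g.touch Y T" by (simp_all add: g.split_def)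
    note qd = g.quadD[OF q]
    define f :: "nat \<Rightarrow> _" where "f = (\<lambda>_. {})(1 := P, 2 := S, 3 := X, 4 := Y, 5 := T)"
    have f [simp]: "f 1 = P" "f (Suc 0) = P" "f 2 = S" "f 3 = X" "f 4 = Y" "f 5 = T" by (simp_all add: f_def)
    have tP: "\<not> g.touch P X" "\<not> g.touch P Y"
      using qd(16) g.touch_mono[of P _ P K] xy(1,2) by blast+
    note t = xy(6-10) qd(15,17,18) tP
    have t': "g.touch Y X" "g.touch S X" "g.touch T X" "g.touch S Y" "g.touch T Y" "\<not> g.touch T S"
      "g.touch S P" "g.touch T P" "\<not> g.touch X P" "\<not> g.touch Y P"
      using t g.touch_commute by blast+
    have disj: "S \<inter> T = {}" "S \<inter> P = {}" "S \<inter> X = {}" "S \<inter> Y = {}" "T \<inter> P = {}" "T \<inter> X = {}"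
      "T \<inter> Y = {}" "P \<inter> X = {}" "P \<inter> Y = {}" "X \<inter> Y = {}"
      using qd(9-14) xy(1-3) by blast+
    have sub: "X \<subseteq> verts G" "Y \<subseteq> verts G" using qd(4) xy by auto
    have "minor_model G F2 f"
      unfolding minor_model_def V E
      using t t' disj qd(1-7) xy(4,5) sub by (simp add: doubleton_eq_iff Int_commute)
    then show "contains_induced_minor G F2"
      using minor_model_imp_contains[OF _ G simple_graph_F2] by blast
  qed
qed

section \<open>Evaluating formulas with reachability in polynomial time\<close>

text \<open>Only an upper bound on the time is recorded, so that the branches of a conditional can
  share one bound.\<close>

definition runs :: "com \<Rightarrow> memory \<Rightarrow> nat \<Rightarrow> (memory \<Rightarrow> bool) \<Rightarrow> bool" where
  "runs c s B Q \<longleftrightarrow> (\<exists>t s'. exec c s t s' \<and> t \<le> B \<and> Q s')"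

lemma runs_mono:
  assumes "runs c s B Q" "B \<le> B'" "\<And>s'. Q s' \<Longrightarrow> Q' s'"
  shows "runs c s B' Q'"
  using assms unfolding runs_def by (meson le_trans)

lemma runs_Skip: "Q s \<Longrightarrow> runs Skip s 1 Q"
  unfolding runs_def using exec_Skip by blast

lemma runs_Skip_Suc: "Q s \<Longrightarrow> runs Skip s (Suc B) Q"
  by (rule runs_mono[OF runs_Skip]) auto

lemma runs_Assign: "Q (s(a := (s a)(val i s := val e s))) \<Longrightarrow> runs (Assign a i e) s 1 Q"
  unfolding runs_def using exec_Assign by blast

lemma runs_Seq:
  assumes "runs c s B R" "\<And>s'. R s' \<Longrightarrow> runs c' s' B' Q"
  shows "runs (Seq c c') s (B + B') Q"
proof -
  obtain t s' where 1: "exec c s t s'" "t \<le> B" "R s'" using assms(1) unfolding runs_def by blast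
  obtain t' s'' where 2: "exec c' s' t' s''" "t' \<le> B'" "Q s''"
    using assms(2)[OF 1(3)] unfolding runs_def by blast
  show ?thesis unfolding runs_def using exec_Seq[OF 1(1) 2(1)] 1(2) 2(2,3) by (meson add_mono)
qed

lemma runs_Assign_Seq:
  assumes "runs c (s(a := (s a)(val i s := val e s))) B Q"
  shows "runs (Seq (Assign a i e) c) s (Suc B) Q"
  using runs_Seq[OF runs_Assign[where Q = "\<lambda>s'. s' = s(a := (s a)(val i s := val e s))"], of s a i e c B Q] assms
  by simp

lemma runs_Cond:
  assumes "val b s \<noteq> 0 \<Longrightarrow> runs c s B Q" "val b s = 0 \<Longrightarrow> runs c' s B Q"
  shows "runs (Cond b c c') s (Suc B) Q"
proof (cases "val b s = 0")
  case True
  then show ?thesis using assms(2) exec_CondFalse[OF True] unfolding runs_def by fastforce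
next
  case False
  then show ?thesis using assms(1) exec_CondTrue[OF False] unfolding runs_def by fastforce
qed

lemma runs_Loop:
  assumes body: "\<And>s. P s \<Longrightarrow> val b s \<noteq> 0 \<Longrightarrow> runs c s T (\<lambda>s'. P s' \<and> f s' < f s)"
    and init: "P s"
  shows "runs (Loop b c) s (f s * (T + 1) + 1) (\<lambda>s'. P s' \<and> val b s' = 0)"
  using init
proof (induction "f s" arbitrary: s rule: less_induct)
  case less
  show ?case
  proof (cases "val b s = 0")
    case True
    then show ?thesis using exec_LoopFalse[OF True] less.prems unfolding runs_def by fastforce
  next
    case False
    obtain t s' where 1: "exec c s t s'" "t \<le> T" "P s'" "f s' < f s"
      using body[OF less.prems False] unfolding runs_def by blast
    obtain t' s'' where 2: "exec (Loop b c) s' t' s''" "t' \<le> f s' * (T + 1) + 1" "P s''" "val b s'' = 0"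
      using less.hyps[OF 1(4,3)] unfolding runs_def by blast
    have "t + t' + 1 \<le> Suc (f s') * (T + 1) + 1" using 1(2) 2(2) by simp
    also have "\<dots> \<le> f s * (T + 1) + 1" using 1(4) by (intro add_right_mono mult_right_mono) auto
    finally show ?thesis unfolding runs_def using exec_LoopTrue[OF False 1(1) 2(1)] 2(3,4) by blast
  qed
qed

definition For :: "nat \<Rightarrow> expr \<Rightarrow> com \<Rightarrow> com" where
  "For k b c = Seq (Assign k (Const 0) (Const 0))
     (Loop (Sub b (Cell k (Const 0))) (Seq c (Assign k (Const 0) (Add (Cell k (Const 0)) (Const 1)))))"

text \<open>Each round costs the test, the body and the increment; the additional 2 pays for the
  initial assignment and the failing test. The invariant speaks of the memory with the counter
  already advanced, and the bound \<open>b\<close> is evaluated anew in every round, hence the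
  demand that the invariant fixes its value.\<close>

lemma runs_For:
  assumes init: "I 0 (s(k := (s k)(0 := 0)))"
    and body: "\<And>i s. i < N \<Longrightarrow> s k 0 = i \<Longrightarrow> I i s \<Longrightarrow>
      runs c s T (\<lambda>s'. s' k 0 = i \<and> I (Suc i) (s'(k := (s' k)(0 := Suc i))))"
    and bound: "\<And>i s. I i s \<Longrightarrow> val b s = N"
  shows "runs (For k b c) s (N * (T + 2) + 2) (I N)"
proof -
  define P where "P s \<longleftrightarrow> s k 0 \<le> N \<and> I (s k 0) s" for s
  let ?s = "s(k := (s k)(0 := 0))"
  let ?inc = "Assign k (Const 0) (Add (Cell k (Const 0)) (Const 1))"
  have "runs (Loop (Sub b (Cell k (Const 0))) (Seq c ?inc)) ?s ((\<lambda>s. N - s k 0) ?s * (T + 1 + 1) + 1)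
    (\<lambda>s'. P s' \<and> val (Sub b (Cell k (Const 0))) s' = 0)"
  proof (rule runs_Loop)
    show "P ?s" using init by (simp add: P_def)
    fix s assume s: "P s" "val (Sub b (Cell k (Const 0))) s \<noteq> 0"
    then have i: "s k 0 < N" "I (s k 0) s" using bound by (auto simp: P_def)
    show "runs (Seq c ?inc) s (T + 1) (\<lambda>s'. P s' \<and> N - s' k 0 < N - s k 0)"
      by (rule runs_Seq[OF body[OF i(1) refl i(2)]], rule runs_Assign) (use i(1) in \<open>auto simp: P_def\<close>)
  qed
  then have "runs (Loop (Sub b (Cell k (Const 0))) (Seq c ?inc)) ?s (N * (T + 2) + 1) (I N)"
    by (rule runs_mono) (use bound in \<open>auto simp: P_def\<close>)
  then show ?thesis unfolding For_def by (intro runs_mono[OF runs_Assign_Seq]) auto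
qed

section \<open>Polynomial bounds\<close>

text \<open>The base \<open>n + 2\<close> is at least 2 even for \<open>n = 0\<close>, so constant
  factors and sums are absorbed by a larger exponent.\<close>

definition polyb :: "(nat \<Rightarrow> nat) \<Rightarrow> bool" where
  "polyb B \<longleftrightarrow> (\<exists>d. \<forall>n. B n \<le> (n + 2) ^ d)"

lemma polyb_const: "polyb (\<lambda>_. c)"
  unfolding polyb_def
proof (intro exI allI)
  fix n
  have "c \<le> 2 ^ c" using less_exp[of c] by simp
  also have "\<dots> \<le> (n + 2) ^ c" by (rule power_mono) auto
  finally show "c \<le> (n + 2) ^ c" .
qed

lemma polyb_id: "polyb (\<lambda>n. n)"
  unfolding polyb_def by (rule exI[of _ 1]) simp

lemma polyb_add:
  assumes "polyb A" "polyb B"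
  shows "polyb (\<lambda>n. A n + B n)"
proof -
  obtain a b where ab: "\<And>n. A n \<le> (n + 2) ^ a" "\<And>n. B n \<le> (n + 2) ^ b"
    using assms unfolding polyb_def by blast
  have "A n + B n \<le> (n + 2) ^ Suc (a + b)" for n
  proof -
    have "(n + 2) ^ a \<le> (n + 2) ^ (a + b)" "(n + 2) ^ b \<le> (n + 2) ^ (a + b)"
      by (rule power_increasing; simp)+
    then have "A n + B n \<le> 2 * (n + 2) ^ (a + b)" using ab[of n] by linarith
    also have "\<dots> \<le> (n + 2) * (n + 2) ^ (a + b)" by (rule mult_right_mono) auto
    finally show ?thesis by simp
  qed
  then show ?thesis unfolding polyb_def by blast
qed

lemma polyb_mult:
  assumes "polyb A" "polyb B"
  shows "polyb (\<lambda>n. A n * B n)"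
proof -
  obtain a b where ab: "\<And>n. A n \<le> (n + 2) ^ a" "\<And>n. B n \<le> (n + 2) ^ b"
    using assms unfolding polyb_def by blast
  have "A n * B n \<le> (n + 2) ^ (a + b)" for n
    unfolding power_add using ab[of n] by (intro mult_mono) auto
  then show ?thesis unfolding polyb_def by blast
qed

lemma polyb_Suc: "polyb A \<Longrightarrow> polyb (\<lambda>n. Suc (A n))"
  using polyb_add[OF polyb_const[of 1]] by simp

lemmas polyb_intros = polyb_const polyb_id polyb_add polyb_mult polyb_Suc

section \<open>Formulas with reachability and their programs\<close>

datatype fm =
    Edge nat nat
  | Eq nat nat
  | Neg fm
  | And fm fm
  | ExV nat fm
  | Reach nat fm nat nat

text \<open>The start must be required to lie in \<open>U\<close>, because the reflexive closure
  relates every vertex to itself; the end then lies in \<open>U\<close> as well.\<close>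

fun sem :: "nat \<Rightarrow> (nat \<Rightarrow> nat \<Rightarrow> bool) \<Rightarrow> fm \<Rightarrow> (nat \<Rightarrow> nat) \<Rightarrow> bool" where
  "sem n E (Edge i j) e \<longleftrightarrow> E (e i) (e j)"
| "sem n E (Eq i j) e \<longleftrightarrow> e i = e j"
| "sem n E (Neg f) e \<longleftrightarrow> \<not> sem n E f e"
| "sem n E (And f g) e \<longleftrightarrow> sem n E f e \<and> sem n E g e"
| "sem n E (ExV i f) e \<longleftrightarrow> (\<exists>x<n. sem n E f (e(i := x)))"
| "sem n E (Reach i f u v) e \<longleftrightarrow> (let U = {x. x < n \<and> sem n E f (e(i := x))} in
     e u \<in> U \<and> (\<lambda>a b. E a b \<and> a \<in> U \<and> b \<in> U)\<^sup>*\<^sup>* (e u) (e v))"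

text \<open>Array 2 holds the values of the variables, cell 0 of array 3 the number \<open>n\<close> of vertices, and
  array 4 the row offsets \<open>i * n\<close>, which have to be tabulated since expressions cannot multiply.\<close>

definition loaded :: "memory \<Rightarrow> nat \<Rightarrow> (nat \<Rightarrow> nat \<Rightarrow> bool) \<Rightarrow> bool" where
  "loaded s n E \<longleftrightarrow> s 0 0 = n * n \<and> (\<forall>i<n. \<forall>j<n. s 0 (i * n + j + 1) \<noteq> 0 \<longleftrightarrow> E i j) \<and>
     (\<forall>i. s 2 i < n) \<and> s 3 0 = n \<and> (\<forall>i<n. s 4 i = i * n)"

text \<open>The truth value ends up in array \<open>m\<close>; arrays below \<open>m\<close> are preserved, so that the program
  for a compound formula can keep its own state there while it runs the programs for subformulas.\<close>

definition decides :: "nat \<Rightarrow> com \<Rightarrow> (nat \<Rightarrow> nat) \<Rightarrow> fm \<Rightarrow> bool" where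
  "decides m c B f \<longleftrightarrow> (\<forall>s n E. loaded s n E \<longrightarrow>
     runs c s (B n) (\<lambda>s'. (\<forall>a<m. s' a = s a) \<and> (s' m 0 \<noteq> 0 \<longleftrightarrow> sem n E f (s 2))))"

definition edge_expr :: "expr \<Rightarrow> expr \<Rightarrow> expr" where
  "edge_expr x y = Cell 0 (Add (Add (Cell 4 x) y) (Const 1))"

abbreviation "var i \<equiv> Cell 2 (Const i)"
abbreviation "scalar a \<equiv> Cell a (Const 0)"
abbreviation "set_scalar a e \<equiv> Assign a (Const 0) e"

lemma loadedD:
  assumes "loaded s n E"
  shows "s 2 i < n" "s 3 0 = n" "s 0 0 = n * n" "i < n \<Longrightarrow> s 4 i = i * n"
    "i < n \<Longrightarrow> j < n \<Longrightarrow> s 0 (i * n + j + 1) \<noteq> 0 \<longleftrightarrow> E i j"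
  using assms unfolding loaded_def by blast+

lemma loaded_cong:
  assumes "loaded s n E" "\<And>a. a < 5 \<Longrightarrow> a \<noteq> 2 \<Longrightarrow> s' a = s a" "\<And>i. s' 2 i < n"
  shows "loaded s' n E"
  using assms unfolding loaded_def by simp

lemma val_edge_expr:
  assumes "loaded s n E" "val x s < n" "val y s < n"
  shows "val (edge_expr x y) s \<noteq> 0 \<longleftrightarrow> E (val x s) (val y s)"
  using loadedD(4)[OF assms(1,2)] loadedD(5)[OF assms] unfolding edge_expr_def by simp

lemma decidesD:
  "decides m c B f \<Longrightarrow> loaded s n E \<Longrightarrow>
    runs c s (B n) (\<lambda>s'. (\<forall>a<m. s' a = s a) \<and> (s' m 0 \<noteq> 0 \<longleftrightarrow> sem n E f (s 2)))"
  unfolding decides_def by blast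

lemma decides_Edge:
  assumes "m \<ge> 5"
  shows "\<exists>c B. polyb B \<and> decides m c B (Edge i j)"
proof (intro exI conjI)
  show "decides m (set_scalar m (edge_expr (var i) (var j))) (\<lambda>_. 1) (Edge i j)"
    unfolding decides_def
    by (intro allI impI runs_Assign) (use val_edge_expr loadedD(1) assms in auto)
qed (rule polyb_const)

lemma decides_Eq:
  assumes "m \<ge> 5"
  shows "\<exists>c B. polyb B \<and> decides m c B (Eq i j)"
proof (intro exI conjI)
  show "decides m (set_scalar m (Sub (Const 1) (Add (Sub (var i) (var j)) (Sub (var j) (var i)))))
    (\<lambda>_. 1) (Eq i j)"
    unfolding decides_def by (intro allI impI runs_Assign) (use assms in auto)
qed (rule polyb_const)

lemma decides_Neg:
  assumes "polyb B" "decides m c B f"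
  shows "\<exists>c B. polyb B \<and> decides m c B (Neg f)"
proof (intro exI conjI)
  show "decides m (Seq c (set_scalar m (Sub (Const 1) (scalar m)))) (\<lambda>n. B n + 1) (Neg f)"
    unfolding decides_def
    by (intro allI impI, rule runs_Seq[OF decidesD[OF assms(2)]], assumption, rule runs_Assign) auto
qed (intro polyb_intros assms(1))

lemma decides_And:
  assumes m: "m \<ge> 5" and f: "polyb B" "decides (Suc m) c B f" and g: "polyb B'" "decides (Suc m) c' B' g"
  shows "\<exists>c B. polyb B \<and> decides m c B (And f g)"
proof (intro exI conjI)
  \<comment> \<open>The first truth value is copied to array \<open>m\<close>, which the second
    program preserves, and is overwritten by 0 if the second conjunct fails.\<close>
  show "decides m (Seq c (Seq (set_scalar m (scalar (Suc m))) (Seq c' (Cond (scalar (Suc m)) Skip (set_scalar m (Const 0))))))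
    (\<lambda>n. B n + Suc (B' n + Suc 1)) (And f g)"
    unfolding decides_def
  proof (intro allI impI)
    fix s n E assume s: "loaded s n E"
    show "runs (Seq c (Seq (set_scalar m (scalar (Suc m))) (Seq c' (Cond (scalar (Suc m)) Skip (set_scalar m (Const 0))))))
      s (B n + Suc (B' n + Suc 1)) (\<lambda>s'. (\<forall>a<m. s' a = s a) \<and> (s' m 0 \<noteq> 0 \<longleftrightarrow> sem n E (And f g) (s 2)))"
    proof (rule runs_Seq[OF decidesD[OF f(2) s]], rule runs_Assign_Seq)
      fix s1 assume s1: "(\<forall>a<Suc m. s1 a = s a) \<and> (s1 (Suc m) 0 \<noteq> 0 \<longleftrightarrow> sem n E f (s 2))"
      let ?s = "s1(m := (s1 m)(val (Const 0) s1 := val (scalar (Suc m)) s1))"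
      have "loaded ?s n E" by (rule loaded_cong[OF s]) (use s1 m loadedD(1)[OF s] in auto)
      then show "runs (Seq c' (Cond (scalar (Suc m)) Skip (set_scalar m (Const 0)))) ?s (B' n + Suc 1)
        (\<lambda>s'. (\<forall>a<m. s' a = s a) \<and> (s' m 0 \<noteq> 0 \<longleftrightarrow> sem n E (And f g) (s 2)))"
      proof (rule runs_Seq[OF decidesD[OF g(2)]], intro runs_Cond runs_Skip runs_Assign)
      qed (use s1 m in auto)
    qed
  qed
qed (intro polyb_intros f(1) g(1))

lemma decides_Ex:
  assumes m: "m \<ge> 5" and f: "polyb B" "decides (m + 3) c B f"
  shows "\<exists>c B. polyb B \<and> decides m c B (ExV i f)"
proof (intro exI conjI)
  \<comment> \<open>Array \<open>m\<close> accumulates the answer, \<open>m + 1\<close> is the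
    counter, \<open>m + 2\<close> keeps the old value of variable \<open>i\<close> for restoration,
    and the subprogram answers in \<open>m + 3\<close>.\<close>
  let ?body = "Seq (Assign 2 (Const i) (scalar (m + 1)))
    (Seq c (Cond (scalar (m + 3)) (set_scalar m (Const 1)) Skip))"
  let ?c = "Seq (set_scalar m (Const 0)) (Seq (set_scalar (m + 2) (var i))
    (Seq (For (m + 1) (scalar 3) ?body) (Assign 2 (Const i) (scalar (m + 2)))))"
  let ?B = "\<lambda>n. Suc (Suc ((n * (Suc (B n + Suc 1) + 2) + 2) + 1))"
  show "decides m ?c ?B (ExV i f)"
    unfolding decides_def
  proof (intro allI impI)
    fix s n E assume s: "loaded s n E"
    define I where "I x s' \<longleftrightarrow> (\<forall>a<m. a \<noteq> 2 \<longrightarrow> s' a = s a) \<and> (\<exists>w<n. s' 2 = (s 2)(i := w)) \<and>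
      s' (m + 2) 0 = s 2 i \<and> (s' m 0 \<noteq> 0 \<longleftrightarrow> (\<exists>y<x. sem n E f ((s 2)(i := y))))" for x s'
    have loop: "runs (For (m + 1) (scalar 3) ?body) s' (n * (Suc (B n + Suc 1) + 2) + 2) (I n)"
      if "I 0 (s'(m + 1 := (s' (m + 1))(0 := 0)))" for s'
    proof (rule runs_For[where I = I, OF that])
      show "I x s' \<Longrightarrow> val (scalar 3) s' = n" for x s'
        using m loadedD(2)[OF s] unfolding I_def by auto
      fix x s1 assume x: "x < n" "s1 (m + 1) 0 = x" and I: "I x s1"
      then have I1: "\<And>a. a < m \<Longrightarrow> a \<noteq> 2 \<Longrightarrow> s1 a = s a" "s1 (m + 2) 0 = s 2 i"
        "s1 m 0 \<noteq> 0 \<longleftrightarrow> (\<exists>y<x. sem n E f ((s 2)(i := y)))" "(s1 2)(i := x) = (s 2)(i := x)"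
        unfolding I_def by auto
      show "runs ?body s1 (Suc (B n + Suc 1))
        (\<lambda>s'. s' (m + 1) 0 = x \<and> I (Suc x) (s'(m + 1 := (s' (m + 1))(0 := Suc x))))"
      proof (rule runs_Assign_Seq)
        let ?s = "s1(2 := (s1 2)(val (Const i) s1 := val (scalar (m + 1)) s1))"
        have s2: "?s 2 = (s 2)(i := x)" using x I1 by simp
        have "loaded ?s n E"
          by (rule loaded_cong[OF s]) (use I1(1) m s2 x(1) loadedD(1)[OF s] in auto)
        note run = decidesD[OF f(2) this, unfolded s2]
        show "runs (Seq c (Cond (scalar (m + 3)) (set_scalar m (Const 1)) Skip)) ?s (B n + Suc 1)
          (\<lambda>s'. s' (m + 1) 0 = x \<and> I (Suc x) (s'(m + 1 := (s' (m + 1))(0 := Suc x))))"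
        proof (rule runs_Seq[OF run])
          fix s2 assume s2: "(\<forall>a<m + 3. s2 a = ?s a) \<and> (s2 (m + 3) 0 \<noteq> 0 \<longleftrightarrow> sem n E f ((s 2)(i := x)))"
          then have eq: "\<And>a. a < m \<Longrightarrow> a \<noteq> 2 \<Longrightarrow> s2 a = s a" "s2 2 = (s 2)(i := x)" "s2 (m + 2) 0 = s 2 i"
            "s2 m 0 = s1 m 0" "s2 (m + 1) 0 = x"
            using I1 m x by auto
          show "runs (Cond (scalar (m + 3)) (set_scalar m (Const 1)) Skip) s2 (Suc 1)
            (\<lambda>s'. s' (m + 1) 0 = x \<and> I (Suc x) (s'(m + 1 := (s' (m + 1))(0 := Suc x))))"
            by (intro runs_Cond runs_Skip runs_Assign)
              (use eq s2 I1(3) x(1) m in \<open>auto simp: I_def less_Suc_eq\<close>)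
        qed
      qed
    qed
    show "runs ?c s (?B n) (\<lambda>s'. (\<forall>a<m. s' a = s a) \<and> (s' m 0 \<noteq> 0 \<longleftrightarrow> sem n E (ExV i f) (s 2)))"
    proof (rule runs_Assign_Seq, rule runs_Assign_Seq, rule runs_Seq[OF loop])
      show "I 0 ((\<lambda>s'. s'(m + 1 := (s' (m + 1))(0 := 0)))
        ((\<lambda>s1. s1(m + 2 := (s1 (m + 2))(val (Const 0) s1 := val (var i) s1))) (s(m := (s m)(val (Const 0) s := val (Const 0) s)))))"
        using m loadedD(1)[OF s] unfolding I_def by (auto intro!: exI[of _ "s 2 i"])
      fix s1 assume I: "I n s1"
      then show "runs (Assign 2 (Const i) (scalar (m + 2))) s1 1
        (\<lambda>s'. (\<forall>a<m. s' a = s a) \<and> (s' m 0 \<noteq> 0 \<longleftrightarrow> sem n E (ExV i f) (s 2)))"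
        by (intro runs_Assign) (use m in \<open>auto simp: I_def\<close>)
    qed
  qed
qed (intro polyb_intros f(1))

text \<open>The number of steps is bounded by the number of edges. The bound \<open>n * n\<close> is
  generous but convenient: it is the input length, which the program can read off as the number of
  rounds.\<close>

lemma relpowp_bounded:
  fixes n :: nat
  assumes "r\<^sup>*\<^sup>* a b" "\<And>x y. r x y \<Longrightarrow> x < n \<and> y < n"
  shows "\<exists>q\<le>n * n. (r ^^ q) a b"
proof -
  let ?R = "{(x, y). r x y}"
  have sub: "?R \<subseteq> {..<n} \<times> {..<n}" using assms(2) by auto
  then have fin: "finite ?R" using finite_subset by blast
  have card: "card ?R \<le> n * n" using card_mono[OF _ sub] by simp
  have "(a, b) \<in> ?R\<^sup>*" using assms(1) by (simp add: rtranclp_rtrancl_eq)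
  then obtain q where "q \<le> card ?R" "(a, b) \<in> ?R ^^ q"
    unfolding rtrancl_finite_eq_relpow[OF fin] by blast
  moreover have "((\<lambda>x y. (x, y) \<in> ?R) ^^ q) a b \<longleftrightarrow> (a, b) \<in> ?R ^^ q"
    by (simp only: relpowp_relpow_eq)
  moreover have "(\<lambda>x y. (x, y) \<in> ?R) = r" by auto
  ultimately show ?thesis using card by (intro exI[of _ q]) simp
qed

lemma decides_Reach:
  assumes m: "m \<ge> 5" and f: "polyb B" "decides (m + 7) c B f"
  shows "\<exists>c B. polyb B \<and> decides m c B (Reach i f u v)"
proof (intro exI conjI)
  \<comment> \<open>The set is tabulated once in array \<open>m + 3\<close>. Array
    \<open>m + 4\<close> marks the vertices reached, and each pass relaxes all edges, as in the
    algorithm of Bellman and Ford. Array \<open>m + 2\<close> saves variable \<open>i\<close>;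
    \<open>m + 1\<close>, \<open>m + 5\<close> and \<open>m + 6\<close> are counters.\<close>
  let ?eval = "Seq (Assign 2 (Const i) (scalar (m + 5))) (Seq c
    (Seq (Assign (m + 3) (scalar (m + 5)) (scalar (m + 7))) (Assign (m + 4) (scalar (m + 5)) (Const 0))))"
  let ?start = "Cond (Cell (m + 3) (var u)) (Assign (m + 4) (var u) (Const 1)) Skip"
  let ?step = "Cond (Cell (m + 4) (scalar (m + 5))) (Cond (edge_expr (scalar (m + 5)) (scalar (m + 6)))
    (Cond (Cell (m + 3) (scalar (m + 6))) (Assign (m + 4) (scalar (m + 6)) (Const 1)) Skip) Skip) Skip"
  let ?row = "For (m + 6) (scalar 3) ?step"
  let ?pass = "For (m + 5) (scalar 3) ?row"
  let ?c = "Seq (set_scalar (m + 2) (var i)) (Seq (For (m + 5) (scalar 3) ?eval)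
    (Seq (Assign 2 (Const i) (scalar (m + 2))) (Seq ?start
      (Seq (For (m + 1) (scalar 0) ?pass) (set_scalar m (Cell (m + 4) (var v)))))))"
  let ?Beval = "\<lambda>n. n * (Suc (B n + Suc 1) + 2) + 2"
  \<comment> \<open>4 stands for three nested tests and one assignment.\<close>
  let ?Brow = "\<lambda>n. n * (4 + 2) + (2 :: nat)"
  let ?Bpass = "\<lambda>n. n * (?Brow n + 2) + 2"
  let ?Bsearch = "\<lambda>n. n * n * (?Bpass n + 2) + 2"
  let ?B = "\<lambda>n. Suc (?Beval n + Suc (Suc 1 + (?Bsearch n + 1)))"
  show "decides m ?c ?B (Reach i f u v)"
    unfolding decides_def
  proof (intro allI impI)
    fix s n E assume s: "loaded s n E"
    define U where "U = {x. x < n \<and> sem n E f ((s 2)(i := x))}"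
    define r where "r a b \<longleftrightarrow> E a b \<and> a \<in> U \<and> b \<in> U" for a b
    \<comment> \<open>After \<open>p\<close> passes the marks lie between \<open>W p\<close> and
      \<open>R\<close>. They need not equal \<open>W p\<close>, since a mark set early in a pass may
      be propagated later in the same pass.\<close>
    define W where "W p = {y. s 2 u \<in> U \<and> (\<exists>q\<le>p. (r ^^ q) (s 2 u) y)}" for p
    define R where "R = {y. s 2 u \<in> U \<and> r\<^sup>*\<^sup>* (s 2 u) y}"
    define marks where "marks s' = {y. y < n \<and> s' (m + 4) y \<noteq> (0 :: nat)}" for s' :: memory
    have U_less: "x \<in> U \<Longrightarrow> x < n" for x unfolding U_def by simp
    have W0: "W 0 = {y. y = s 2 u \<and> y \<in> U}" unfolding W_def by auto
    have W_Suc: "W (Suc p) \<subseteq> W p \<union> {y. \<exists>x\<in>W p. r x y}" for p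
    proof
      fix y assume "y \<in> W (Suc p)"
      then obtain q where q: "s 2 u \<in> U" "q \<le> Suc p" "(r ^^ q) (s 2 u) y" unfolding W_def by blast
      show "y \<in> W p \<union> {y. \<exists>x\<in>W p. r x y}"
      proof (cases "q \<le> p")
        case True
        then show ?thesis using q unfolding W_def by blast
      next
        case False
        then have "q = Suc p" using q by simp
        then obtain x where "(r ^^ p) (s 2 u) x" "r x y" using q(3) by auto
        then show ?thesis using q(1) unfolding W_def by blast
      qed
    qed
    have W_R: "W p \<subseteq> R" for p unfolding W_def R_def by (auto dest: relpowp_imp_rtranclp)
    have R_W: "R \<subseteq> W (n * n)"
      unfolding W_def R_def using relpowp_bounded[of r _ _ n] U_less unfolding r_def by auto
    have R_U: "R \<subseteq> U"
    proof
      fix y assume "y \<in> R"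
      then have "r\<^sup>*\<^sup>* (s 2 u) y" "s 2 u \<in> U" unfolding R_def by auto
      then show "y \<in> U" by (cases rule: rtranclp.cases) (auto simp: r_def)
    qed
    have R_step: "x \<in> R \<Longrightarrow> r x y \<Longrightarrow> y \<in> R" for x y
      unfolding R_def by (auto intro: rtranclp.rtrancl_into_rtrancl)

    define ok where "ok s' \<longleftrightarrow> (\<forall>a<m. s' a = s a) \<and> (\<forall>y<n. s' (m + 3) y \<noteq> 0 \<longleftrightarrow> y \<in> U)" for s'
    have ok_loaded: "ok s' \<Longrightarrow> loaded s' n E" for s'
      by (rule loaded_cong[OF s]) (use m loadedD(1)[OF s] in \<open>auto simp: ok_def\<close>)
    have ok_upd: "ok (s'(a := g)) \<longleftrightarrow> ok s'" if "a > m + 3" for s' a g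
      using that unfolding ok_def by auto
    have ok_n: "s' 3 0 = n" "s' 0 0 = n * n" if "ok s'" for s'
      using loadedD(2,3)[OF ok_loaded[OF that]] .

    \<comment> \<open>The marks are cleared explicitly: nothing is known about the initial contents
      of the arrays from \<open>m\<close> on, which may stem from earlier runs.\<close>
    define I1 where "I1 x s' \<longleftrightarrow> (\<forall>a<m. a \<noteq> 2 \<longrightarrow> s' a = s a) \<and> (\<exists>w<n. s' 2 = (s 2)(i := w)) \<and>
      s' (m + 2) 0 = s 2 i \<and> (\<forall>y<x. (s' (m + 3) y \<noteq> 0 \<longleftrightarrow> sem n E f ((s 2)(i := y))) \<and> s' (m + 4) y = 0)" for x s'
    have eval: "runs (For (m + 5) (scalar 3) ?eval) s' (?Beval n) (I1 n)"
      if "I1 0 (s'(m + 5 := (s' (m + 5))(0 := 0)))" for s'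
    proof (rule runs_For[where I = I1, OF that])
      show "I1 x s' \<Longrightarrow> val (scalar 3) s' = n" for x s'
        using m loadedD(2)[OF s] unfolding I1_def by auto
      fix x s1 assume x: "x < n" "s1 (m + 5) 0 = x" and I: "I1 x s1"
      then have I1: "\<And>a. a < m \<Longrightarrow> a \<noteq> 2 \<Longrightarrow> s1 a = s a" "s1 (m + 2) 0 = s 2 i"
        "\<And>y. y < x \<Longrightarrow> (s1 (m + 3) y \<noteq> 0 \<longleftrightarrow> sem n E f ((s 2)(i := y))) \<and> s1 (m + 4) y = 0"
        "(s1 2)(i := x) = (s 2)(i := x)"
        unfolding I1_def by auto
      let ?post = "\<lambda>s'. s' (m + 5) 0 = x \<and> I1 (Suc x) (s'(m + 5 := (s' (m + 5))(0 := Suc x)))"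
      show "runs ?eval s1 (Suc (B n + Suc 1)) ?post"
      proof (rule runs_Assign_Seq)
        let ?s = "s1(2 := (s1 2)(val (Const i) s1 := val (scalar (m + 5)) s1))"
        have s2: "?s 2 = (s 2)(i := x)" using x I1 by simp
        have "loaded ?s n E"
          by (rule loaded_cong[OF s]) (use I1(1) m s2 x(1) loadedD(1)[OF s] in auto)
        note run = decidesD[OF f(2) this, unfolded s2]
        show "runs (Seq c (Seq (Assign (m + 3) (scalar (m + 5)) (scalar (m + 7)))
          (Assign (m + 4) (scalar (m + 5)) (Const 0)))) ?s (B n + Suc 1) ?post"
        proof (rule runs_Seq[OF run])
          fix s2 assume s2: "(\<forall>a<m + 7. s2 a = ?s a) \<and> (s2 (m + 7) 0 \<noteq> 0 \<longleftrightarrow> sem n E f ((s 2)(i := x)))"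
          then have eq: "\<And>a. a < m \<Longrightarrow> a \<noteq> 2 \<Longrightarrow> s2 a = s a" "s2 2 = (s 2)(i := x)" "s2 (m + 2) 0 = s 2 i"
            "s2 (m + 5) 0 = x"
            "\<And>y. y < x \<Longrightarrow> (s2 (m + 3) y \<noteq> 0 \<longleftrightarrow> sem n E f ((s 2)(i := y))) \<and> s2 (m + 4) y = 0"
            using I1 m x by auto
          show "runs (Seq (Assign (m + 3) (scalar (m + 5)) (scalar (m + 7)))
            (Assign (m + 4) (scalar (m + 5)) (Const 0))) s2 (Suc 1) ?post"
            by (intro runs_Assign_Seq runs_Assign)
              (use eq s2 x(1) m in \<open>auto simp: I1_def less_Suc_eq\<close>)
        qed
      qed
    qed

    have row: "runs ?row s2 (?Brow n) (\<lambda>s'. (\<forall>a. a \<noteq> m + 4 \<and> a \<noteq> m + 6 \<longrightarrow> s' a = s2 a) \<and>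
        marks s2 \<subseteq> marks s' \<and> marks s' \<subseteq> R \<and> (\<forall>y<n. x \<in> marks s2 \<longrightarrow> r x y \<longrightarrow> y \<in> marks s'))"
      if s2: "ok s2" "s2 (m + 5) 0 = x" "x < n" "marks s2 \<subseteq> R" for s2 x
    proof (rule runs_For[where I = "\<lambda>y s'. (\<forall>a. a \<noteq> m + 4 \<and> a \<noteq> m + 6 \<longrightarrow> s' a = s2 a) \<and>
        marks s2 \<subseteq> marks s' \<and> marks s' \<subseteq> R \<and> (\<forall>y'<y. x \<in> marks s2 \<longrightarrow> r x y' \<longrightarrow> y' \<in> marks s')"])
      show "(\<forall>a. a \<noteq> m + 4 \<and> a \<noteq> m + 6 \<longrightarrow> (s2(m + 6 := (s2 (m + 6))(0 := 0))) a = s2 a) \<and>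
        marks s2 \<subseteq> marks (s2(m + 6 := (s2 (m + 6))(0 := 0))) \<and> marks (s2(m + 6 := (s2 (m + 6))(0 := 0))) \<subseteq> R \<and>
        (\<forall>y'<0. x \<in> marks s2 \<longrightarrow> r x y' \<longrightarrow> y' \<in> marks (s2(m + 6 := (s2 (m + 6))(0 := 0))))"
        using s2(4) by (auto simp: marks_def)
    next
      fix y s3
      assume y: "y < n" "s3 (m + 6) 0 = y" and
        "(\<forall>a. a \<noteq> m + 4 \<and> a \<noteq> m + 6 \<longrightarrow> s3 a = s2 a) \<and>
        marks s2 \<subseteq> marks s3 \<and> marks s3 \<subseteq> R \<and> (\<forall>y'<y. x \<in> marks s2 \<longrightarrow> r x y' \<longrightarrow> y' \<in> marks s3)"
      then have I: "\<And>a. a \<noteq> m + 4 \<Longrightarrow> a \<noteq> m + 6 \<Longrightarrow> s3 a = s2 a" "marks s2 \<subseteq> marks s3" "marks s3 \<subseteq> R"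
        "\<And>y'. y' < y \<Longrightarrow> x \<in> marks s2 \<Longrightarrow> r x y' \<Longrightarrow> y' \<in> marks s3" by auto
      have s3: "ok s3" "s3 (m + 5) 0 = x" using s2(1,2) I(1) unfolding ok_def by auto
      define J where "J s' \<longleftrightarrow> s' (m + 6) 0 = y \<and> (\<forall>a. a \<noteq> m + 4 \<and> a \<noteq> m + 6 \<longrightarrow> s' a = s2 a) \<and>
        marks s2 \<subseteq> marks s' \<and> marks s' \<subseteq> R \<and> (\<forall>y'<Suc y. x \<in> marks s2 \<longrightarrow> r x y' \<longrightarrow> y' \<in> marks s')" for s'
      have e: "val (edge_expr (scalar (m + 5)) (scalar (m + 6))) s3 \<noteq> 0 \<longleftrightarrow> E x y"
        using val_edge_expr[OF ok_loaded[OF s3(1)], of "scalar (m + 5)" "scalar (m + 6)"] s3(2) y s2(3) by simp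
      have skip: "J s3" if "\<not> (x \<in> marks s3 \<and> r x y)"
        unfolding J_def using that I y(2) by (auto simp: less_Suc_eq)
      have set: "J (s3(m + 4 := (s3 (m + 4))(y := 1)))" if "x \<in> marks s3" "r x y"
      proof -
        have "marks (s3(m + 4 := (s3 (m + 4))(y := 1))) = insert y (marks s3)"
          using y(1) by (auto simp: marks_def)
        then show ?thesis unfolding J_def using I y(2) R_step[of x y] that by (auto simp: less_Suc_eq)
      qed
      have M: "val (Cell (m + 4) (scalar (m + 5))) s3 \<noteq> 0 \<longleftrightarrow> x \<in> marks s3"
        using s3(2) s2(3) by (simp add: marks_def)
      have P: "val (Cell (m + 3) (scalar (m + 6))) s3 \<noteq> 0 \<longleftrightarrow> y \<in> U"
        using s3(1) y by (simp add: ok_def)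
      have J: "runs ?step s3 (Suc (Suc (Suc 1))) J"
      proof (rule runs_Cond)
        assume "val (Cell (m + 4) (scalar (m + 5))) s3 \<noteq> 0"
        then have x: "x \<in> marks s3" using M by blast
        show "runs (Cond (edge_expr (scalar (m + 5)) (scalar (m + 6)))
          (Cond (Cell (m + 3) (scalar (m + 6))) (Assign (m + 4) (scalar (m + 6)) (Const 1)) Skip) Skip) s3 (Suc (Suc 1)) J"
        proof (rule runs_Cond)
          assume "val (edge_expr (scalar (m + 5)) (scalar (m + 6))) s3 \<noteq> 0"
          then have E: "E x y" using e by blast
          show "runs (Cond (Cell (m + 3) (scalar (m + 6))) (Assign (m + 4) (scalar (m + 6)) (Const 1)) Skip) s3 (Suc 1) J"
          proof (rule runs_Cond)
            assume "val (Cell (m + 3) (scalar (m + 6))) s3 \<noteq> 0"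
            \<comment> \<open>The program tests membership in \<open>U\<close> for \<open>y\<close>
              only: a marked \<open>x\<close> lies in \<open>R\<close> and hence in
              \<open>U\<close>.\<close>
            then have "r x y" unfolding r_def using P E x I(3) R_U by blast
            from set[OF x this] show "runs (Assign (m + 4) (scalar (m + 6)) (Const 1)) s3 1 J"
              using y(2) by (intro runs_Assign) simp
          next
            assume "val (Cell (m + 3) (scalar (m + 6))) s3 = 0"
            then show "runs Skip s3 1 J" by (intro runs_Skip skip) (use P r_def in blast)
          qed
        next
          assume "val (edge_expr (scalar (m + 5)) (scalar (m + 6))) s3 = 0"
          then show "runs Skip s3 (Suc 1) J" by (intro runs_Skip_Suc skip) (use e r_def in blast)
        qed
      next
        assume "val (Cell (m + 4) (scalar (m + 5))) s3 = 0"
        then show "runs Skip s3 (Suc (Suc 1)) J" by (intro runs_Skip_Suc skip) (use M in blast)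
      qed
      show "runs ?step s3 4 (\<lambda>s'. s' (m + 6) 0 = y \<and>
        (\<forall>a. a \<noteq> m + 4 \<and> a \<noteq> m + 6 \<longrightarrow> (s'(m + 6 := (s' (m + 6))(0 := Suc y))) a = s2 a) \<and>
        marks s2 \<subseteq> marks (s'(m + 6 := (s' (m + 6))(0 := Suc y))) \<and> marks (s'(m + 6 := (s' (m + 6))(0 := Suc y))) \<subseteq> R \<and>
        (\<forall>y'<Suc y. x \<in> marks s2 \<longrightarrow> r x y' \<longrightarrow> y' \<in> marks (s'(m + 6 := (s' (m + 6))(0 := Suc y)))))"
        by (rule runs_mono[OF J]) (auto simp: J_def marks_def)
    next
      fix y s3
      assume "(\<forall>a. a \<noteq> m + 4 \<and> a \<noteq> m + 6 \<longrightarrow> s3 a = s2 a) \<and>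
        marks s2 \<subseteq> marks s3 \<and> marks s3 \<subseteq> R \<and> (\<forall>y'<y. x \<in> marks s2 \<longrightarrow> r x y' \<longrightarrow> y' \<in> marks s3)"
      then show "val (scalar 3) s3 = n" using ok_n(1)[OF s2(1)] m by simp
    qed

    have pass: "runs ?pass s1 (?Bpass n) (\<lambda>s'. (\<forall>a. a \<noteq> m + 4 \<and> a \<noteq> m + 5 \<and> a \<noteq> m + 6 \<longrightarrow> s' a = s1 a) \<and>
        W (Suc p) \<subseteq> marks s' \<and> marks s' \<subseteq> R)"
      if s1: "ok s1" "W p \<subseteq> marks s1" "marks s1 \<subseteq> R" for s1 p
    proof -
      define I2 where "I2 x s' \<longleftrightarrow> (\<forall>a. a \<noteq> m + 4 \<and> a \<noteq> m + 5 \<and> a \<noteq> m + 6 \<longrightarrow> s' a = s1 a) \<and>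
        W p \<subseteq> marks s' \<and> marks s' \<subseteq> R \<and> (\<forall>x'<x. \<forall>y<n. x' \<in> W p \<longrightarrow> r x' y \<longrightarrow> y \<in> marks s')" for x s'
      have "runs ?pass s1 (?Bpass n) (I2 n)"
      proof (rule runs_For[where I = I2])
        show "I2 0 (s1(m + 5 := (s1 (m + 5))(0 := 0)))"
          using s1 by (auto simp: I2_def marks_def)
        show "I2 x s' \<Longrightarrow> val (scalar 3) s' = n" for x s'
          using ok_n(1)[OF s1(1)] m by (simp add: I2_def)
        fix x s2 assume x: "x < n" "s2 (m + 5) 0 = x" "I2 x s2"
        then have I: "\<And>a. a \<noteq> m + 4 \<Longrightarrow> a \<noteq> m + 5 \<Longrightarrow> a \<noteq> m + 6 \<Longrightarrow> s2 a = s1 a"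
          "W p \<subseteq> marks s2" "marks s2 \<subseteq> R"
          "\<And>x' y. x' < x \<Longrightarrow> y < n \<Longrightarrow> x' \<in> W p \<Longrightarrow> r x' y \<Longrightarrow> y \<in> marks s2" unfolding I2_def by auto
        have ok2: "ok s2" using s1(1) I(1) unfolding ok_def by auto
        show "runs ?row s2 (?Brow n) (\<lambda>s'. s' (m + 5) 0 = x \<and> I2 (Suc x) (s'(m + 5 := (s' (m + 5))(0 := Suc x))))"
        proof (rule runs_mono[OF row[OF ok2 x(2,1) I(3)] order_refl])
          fix s' assume s': "(\<forall>a. a \<noteq> m + 4 \<and> a \<noteq> m + 6 \<longrightarrow> s' a = s2 a) \<and>
            marks s2 \<subseteq> marks s' \<and> marks s' \<subseteq> R \<and> (\<forall>y<n. x \<in> marks s2 \<longrightarrow> r x y \<longrightarrow> y \<in> marks s')"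
          have mk: "marks (s'(m + 5 := (s' (m + 5))(0 := Suc x))) = marks s'" by (simp add: marks_def)
          have "I2 (Suc x) (s'(m + 5 := (s' (m + 5))(0 := Suc x)))"
            unfolding I2_def mk using s' I by (auto simp: less_Suc_eq subset_iff)
          moreover have "s' (m + 5) 0 = x" using s' x(2) by simp
          ultimately show "s' (m + 5) 0 = x \<and> I2 (Suc x) (s'(m + 5 := (s' (m + 5))(0 := Suc x)))" by blast
        qed
      qed
      then show ?thesis
      proof (rule runs_mono)
        fix s' assume I: "I2 n s'"
        have 1: "y \<in> marks s'" if "x \<in> W p" "r x y" for x y
        proof -
          have "x < n" "y < n" using that W_R[of p] R_U U_less unfolding r_def by blast+
          then show ?thesis using I that unfolding I2_def by simp
        qed
        have "W p \<subseteq> marks s'" using I unfolding I2_def by (elim conjE)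
        then have "W (Suc p) \<subseteq> marks s'" by (intro subset_trans[OF W_Suc] Un_least) (auto intro: 1)
        then show "(\<forall>a. a \<noteq> m + 4 \<and> a \<noteq> m + 5 \<and> a \<noteq> m + 6 \<longrightarrow> s' a = s1 a) \<and> W (Suc p) \<subseteq> marks s' \<and> marks s' \<subseteq> R"
          using I unfolding I2_def by (elim conjE) (intro conjI)
      qed simp
    qed

    define I3 where "I3 p s' \<longleftrightarrow> ok s' \<and> W p \<subseteq> marks s' \<and> marks s' \<subseteq> R" for p s'
    have I3_upd: "I3 p (s'(a := g)) \<longleftrightarrow> I3 p s'" if "a = m + 1" for p s' a g
      using that unfolding I3_def ok_def marks_def by auto
    have search: "runs (For (m + 1) (scalar 0) ?pass) s1 (?Bsearch n) (I3 (n * n))" if "I3 0 s1" for s1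
    proof (rule runs_For[where I = I3])
      show "I3 0 (s1(m + 1 := (s1 (m + 1))(0 := 0)))" using that by (simp add: I3_upd)
      show "I3 p s' \<Longrightarrow> val (scalar 0) s' = n * n" for p s' using ok_n(2) by (simp add: I3_def)
      fix p s2 assume p: "p < n * n" "s2 (m + 1) 0 = p" "I3 p s2"
      then have I: "ok s2" "W p \<subseteq> marks s2" "marks s2 \<subseteq> R" unfolding I3_def by auto
      show "runs ?pass s2 (?Bpass n) (\<lambda>s'. s' (m + 1) 0 = p \<and> I3 (Suc p) (s'(m + 1 := (s' (m + 1))(0 := Suc p))))"
      proof (rule runs_mono[OF pass[OF I] order_refl])
        fix s' assume s': "(\<forall>a. a \<noteq> m + 4 \<and> a \<noteq> m + 5 \<and> a \<noteq> m + 6 \<longrightarrow> s' a = s2 a) \<and>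
          W (Suc p) \<subseteq> marks s' \<and> marks s' \<subseteq> R"
        then have "ok s'" using I(1) unfolding ok_def by simp
        then have "I3 (Suc p) s'" using s' unfolding I3_def by blast
        moreover have "s' (m + 1) 0 = p" using s' p(2) by simp
        ultimately show "s' (m + 1) 0 = p \<and> I3 (Suc p) (s'(m + 1 := (s' (m + 1))(0 := Suc p)))"
          by (simp add: I3_upd)
      qed
    qed

    have sem_eq: "sem n E (Reach i f u v) (s 2) \<longleftrightarrow> s 2 v \<in> R"
      unfolding R_def r_def U_def by (simp add: Let_def)
    show "runs ?c s (?B n) (\<lambda>s'. (\<forall>a<m. s' a = s a) \<and> (s' m 0 \<noteq> 0 \<longleftrightarrow> sem n E (Reach i f u v) (s 2)))"
    proof (rule runs_Assign_Seq, rule runs_Seq[OF eval])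
      show "I1 0 ((\<lambda>s'. s'(m + 5 := (s' (m + 5))(0 := 0))) (s(m + 2 := (s (m + 2))(val (Const 0) s := val (var i) s))))"
        using m loadedD(1)[OF s] unfolding I1_def by (auto intro!: exI[of _ "s 2 i"])
      fix s1 assume I: "I1 n s1"
      let ?s = "s1(2 := (s1 2)(val (Const i) s1 := val (scalar (m + 2)) s1))"
      have ok: "ok ?s" "\<And>y. y < n \<Longrightarrow> ?s (m + 4) y = 0"
        using I m unfolding I1_def ok_def U_def by auto
      show "runs (Seq (Assign 2 (Const i) (scalar (m + 2))) (Seq ?start
        (Seq (For (m + 1) (scalar 0) ?pass) (set_scalar m (Cell (m + 4) (var v)))))) s1
        (Suc (Suc 1 + (?Bsearch n + 1)))
        (\<lambda>s'. (\<forall>a<m. s' a = s a) \<and> (s' m 0 \<noteq> 0 \<longleftrightarrow> sem n E (Reach i f u v) (s 2)))"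
      proof (rule runs_Assign_Seq, rule runs_Seq[where R = "I3 0"])
        have "2 < m" using m by simp
        then have "?s 2 = s 2" using ok(1) unfolding ok_def by blast
        then have eu: "?s 2 u = s 2 u" "s 2 u < n" using loadedD(1)[OF s] by simp_all
        have c: "val (Cell (m + 3) (var u)) ?s \<noteq> 0 \<longleftrightarrow> s 2 u \<in> U"
          using ok(1) eu unfolding ok_def by simp
        have m0: "marks ?s = {}" using ok(2) unfolding marks_def by auto
        have m1: "marks (?s(m + 4 := (?s (m + 4))(s 2 u := 1))) = {s 2 u}"
          using ok(2) eu(2) unfolding marks_def by auto
        have in_R: "s 2 u \<in> U \<Longrightarrow> s 2 u \<in> R" unfolding R_def by simp
        show "runs ?start ?s (Suc 1) (I3 0)"
        proof (rule runs_Cond)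
          assume "val (Cell (m + 3) (var u)) ?s \<noteq> 0"
          then have uU: "s 2 u \<in> U" using c by blast
          have "ok (?s(m + 4 := (?s (m + 4))(s 2 u := 1)))"
            by (subst ok_upd) (simp, rule ok(1))
          then have "I3 0 (?s(m + 4 := (?s (m + 4))(s 2 u := 1)))"
            unfolding I3_def m1 W0 using in_R[OF uU] by blast
          then show "runs (Assign (m + 4) (var u) (Const 1)) ?s 1 (I3 0)"
            using eu(1) by (intro runs_Assign) simp
        next
          assume "val (Cell (m + 3) (var u)) ?s = 0"
          then have "s 2 u \<notin> U" using c by blast
          then have "I3 0 ?s"
            unfolding I3_def W0 m0 by (intro conjI ok(1)) auto
          then show "runs Skip ?s 1 (I3 0)" by (rule runs_Skip[of "I3 0"])
        qed
        fix s2 assume "I3 0 s2"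
        then show "runs (Seq (For (m + 1) (scalar 0) ?pass) (set_scalar m (Cell (m + 4) (var v)))) s2 (?Bsearch n + 1)
          (\<lambda>s'. (\<forall>a<m. s' a = s a) \<and> (s' m 0 \<noteq> 0 \<longleftrightarrow> sem n E (Reach i f u v) (s 2)))"
        proof (rule runs_Seq[OF search])
          fix s3 assume I: "I3 (n * n) s3"
          have "marks s3 = R" using I R_W unfolding I3_def by blast
          moreover have "s3 2 v = s 2 v" "s 2 v < n" using I m loadedD(1)[OF s] unfolding I3_def ok_def by auto
          ultimately have "s3 (m + 4) (s3 2 v) \<noteq> 0 \<longleftrightarrow> s 2 v \<in> R" unfolding marks_def by auto
          then show "runs (set_scalar m (Cell (m + 4) (var v))) s3 1
            (\<lambda>s'. (\<forall>a<m. s' a = s a) \<and> (s' m 0 \<noteq> 0 \<longleftrightarrow> sem n E (Reach i f u v) (s 2)))"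
            using I unfolding sem_eq by (intro runs_Assign) (auto simp: I3_def ok_def)
        qed
      qed
    qed
  qed
qed (intro polyb_intros f(1))

lemma decides_all:
  assumes "m \<ge> 5"
  shows "\<exists>c B. polyb B \<and> decides m c B f"
  using assms
proof (induction f arbitrary: m)
  case (Neg f)
  then show ?case using decides_Neg by metis
next
  case (And f g)
  have "Suc m \<ge> 5" using And.prems by simp
  then show ?case using And decides_And by metis
next
  case (ExV i f)
  have "m + 3 \<ge> 5" using ExV.prems by simp
  then show ?case using ExV decides_Ex by metis
next
  case (Reach i f u v)
  have "m + 7 \<ge> 5" using Reach.prems by simp
  then show ?case using Reach decides_Reach by metis
qed (simp_all add: decides_Edge decides_Eq)

section \<open>The formula for \<open>F2\<close>\<close>

definition AllV :: "nat \<Rightarrow> fm \<Rightarrow> fm" where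
  "AllV i f = Neg (ExV i (Neg f))"

definition far_fm :: "nat \<Rightarrow> nat \<Rightarrow> nat \<Rightarrow> nat \<Rightarrow> fm" where
  "far_fm x v s t = And (Neg (Eq x v)) (And (Neg (Edge v x)) (And (Neg (Eq x s)) (Neg (Eq x t))))"

text \<open>The right-hand side of \<open>linked_cmp_iff\<close>, with 4, 5 and 6 for
  \<open>c\<close>, \<open>k\<close> and \<open>l\<close>. The membership of \<open>k\<close> in
  \<open>U - {c}\<close> is part of the second \<open>Reach\<close>.\<close>

definition linked_fm :: "(nat \<Rightarrow> fm) \<Rightarrow> nat \<Rightarrow> (nat \<Rightarrow> fm) \<Rightarrow> (nat \<Rightarrow> fm) \<Rightarrow> fm" where
  "linked_fm U y S T = AllV 4 (ExV 5 (ExV 6 (And (Reach 7 (U 7) y 5) (And (S 5) (And (T 6)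
     (Reach 7 (And (U 7) (Neg (Eq 7 4))) 5 6))))))"

text \<open>The variables 0, 1, 2, 3 stand for \<open>v\<close>, \<open>s\<close>, \<open>t\<close> (or \<open>q\<close>) and \<open>y\<close> of the two kinds of witnesses;
  \<open>linked_fm\<close> binds 4, 5, 6, and 7 is bound by reachability inside a definable set.\<close>

definition long_fm :: fm where
  "long_fm = And (Edge 0 1) (And (Neg (Eq 2 0)) (And (Neg (Eq 2 1)) (And (Neg (Edge 1 2))
     (And (far_fm 3 0 1 2) (And (linked_fm (\<lambda>x. far_fm x 0 1 2) 3 (\<lambda>k. Edge k 1) (\<lambda>l. Edge l 2))
     (ExV 10 (And (Edge 10 2) (Reach 8 (And (Neg (Reach 7 (far_fm 7 0 1 2) 3 8))
        (Neg (ExV 9 (And (Edge 8 9) (Reach 7 (far_fm 7 0 1 2) 3 9))))) 0 10))))))))"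

definition fan_fm :: "nat \<Rightarrow> nat \<Rightarrow> nat \<Rightarrow> fm" where
  "fan_fm x v s = And (Edge v x) (And (Neg (Eq x s)) (Neg (Edge s x)))"

definition fan_witness_fm :: fm where
  "fan_witness_fm = And (Edge 0 1) (And (fan_fm 2 0 1) (And (far_fm 3 0 1 1)
     (linked_fm (\<lambda>x. far_fm x 0 1 1) 3 (\<lambda>k. Edge k 1) (\<lambda>l. ExV 8 (And (Edge l 8) (Reach 7 (fan_fm 7 0 1) 2 8))))))"

text \<open>Symmetry and irreflexivity are part of the formula, so that matrices that encode no
  graph are rejected by the same program.\<close>

definition F2_fm :: fm where
  "F2_fm = And (AllV 0 (AllV 1 (Neg (And (Edge 0 1) (Neg (Edge 1 0)))))) (And (AllV 0 (Neg (Edge 0 0)))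
     (ExV 0 (ExV 1 (ExV 2 (ExV 3 (Neg (And (Neg long_fm) (Neg fan_witness_fm))))))))"

lemma sem_All [simp]: "sem n E (AllV i f) e \<longleftrightarrow> (\<forall>x<n. sem n E f (e(i := x)))"
  by (simp add: AllV_def)

declare One_nat_def [simp del]

context
  fixes n :: nat and E :: "nat \<Rightarrow> nat \<Rightarrow> bool"
  assumes G: "sgraph E {..<n}"
begin

interpretation sgraph E "{..<n}" by (rule G)

lemma sem_Reach:
  "sem n E (Reach i f u v) e \<longleftrightarrow> (let U = {x. x < n \<and> sem n E f (e(i := x))} in e u \<in> U \<and> e v \<in> cmp U (e u))"
  by (simp add: cmp_def Let_def)

lemma sem_far_fm: "sem n E (far_fm x v s t) e \<and> e x < n \<longleftrightarrow> e x \<in> far (e v) (e s) (e t)"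
  by (auto simp: far_fm_def far_def)

lemma sem_far_set:
  assumes "v \<noteq> 7" "s \<noteq> 7" "t \<noteq> 7"
  shows "{x. x < n \<and> sem n E (far_fm 7 v s t) (e(7 := x))} = far (e v) (e s) (e t)"
  using sem_far_fm[of 7 v s t "e(7 := _)"] assms by (auto simp: far_def far_fm_def)

lemma sem_fan_set:
  assumes "v \<noteq> 7" "s \<noteq> 7"
  shows "{x. x < n \<and> sem n E (fan_fm 7 v s) (e(7 := x))} = fan (e v) (e s)"
  using assms E_V E_sym by (auto simp: fan_def fan_fm_def)

text \<open>The quantifiers inside change only variables from 4 on, so the parameters are
  interpreted under every assignment that agrees with \<open>e\<close> on the four witness
  variables.\<close>

lemma sem_linked_fm:
  assumes U: "\<And>e'. (\<And>i. i < 4 \<Longrightarrow> e' i = e i) \<Longrightarrow> {x. x < n \<and> sem n E (Uf 7) (e'(7 := x))} = U"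
    and S: "\<And>e'. (\<And>i. i < 4 \<Longrightarrow> e' i = e i) \<Longrightarrow> sem n E (Sf 5) e' \<longleftrightarrow> touch {e' 5} S"
    and T: "\<And>e'. (\<And>i. i < 4 \<Longrightarrow> e' i = e i) \<Longrightarrow> sem n E (Tf 6) e' \<longleftrightarrow> touch {e' 6} T"
    and y: "e 3 \<in> U"
  shows "sem n E (linked_fm Uf 3 Sf Tf) e \<longleftrightarrow> linked (cmp U (e 3)) S T"
proof -
  have UV: "U \<subseteq> {..<n}" using U[of e] by blast
  have body: "sem n E (And (Reach 7 (Uf 7) 3 5) (And (Sf 5) (And (Tf 6)
      (Reach 7 (And (Uf 7) (Neg (Eq 7 4))) 5 6)))) (e(4 := c, 5 := k, 6 := l)) \<longleftrightarrow>
    k \<in> cmp U (e 3) \<and> touch {k} S \<and> touch {l} T \<and> k \<in> U - {c} \<and> l \<in> cmp (U - {c}) k" for c k l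
  proof -
    let ?e = "e(4 := c, 5 := k, 6 := l)"
    have e: "?e i = e i" if "i < 4" for i using that by simp
    have 1: "{x. x < n \<and> sem n E (Uf 7) (?e(7 := x))} = U" by (rule U) (rule e)
    then have 2: "{x. x < n \<and> sem n E (And (Uf 7) (Neg (Eq 7 4))) (?e(7 := x))} = U - {c}" by auto
    have 3: "sem n E (Sf 5) ?e \<longleftrightarrow> touch {?e 5} S" by (rule S) (rule e)
    have 4: "sem n E (Tf 6) ?e \<longleftrightarrow> touch {?e 6} T" by (rule T) (rule e)
    have r1: "sem n E (Reach 7 (Uf 7) 3 5) ?e \<longleftrightarrow> k \<in> cmp U (e 3)"
      unfolding sem_Reach 1 Let_def using y by simp
    have r2: "sem n E (Reach 7 (And (Uf 7) (Neg (Eq 7 4))) 5 6) ?e \<longleftrightarrow> k \<in> U - {c} \<and> l \<in> cmp (U - {c}) k"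
      unfolding sem_Reach 2 Let_def by simp
    show ?thesis
      unfolding sem.simps(4)[of _ _ "Reach 7 (Uf 7) 3 5"] sem.simps(4)[of _ _ "Sf 5"]
        sem.simps(4)[of _ _ "Tf 6"] r1 r2 3 4 by simp
  qed
  show ?thesis
    unfolding linked_cmp_iff[OF UV y] linked_fm_def sem_All sem.simps(5) body
    by (simp only: Ball_def Bex_def lessThan_iff)
qed

lemma sem_long_fm:
  assumes "e 2 < n" "e 3 < n"
  shows "sem n E long_fm e \<longleftrightarrow> long_witness (e 0) (e 1) (e 2) (e 3)"
proof (cases "e 3 \<in> far (e 0) (e 1) (e 2)")
  case False
  \<comment> \<open>This case is separated because \<open>Reach\<close> is false from a start
    outside its set, whereas \<open>cmp\<close> always contains its start.\<close>
  then have "\<not> sem n E (far_fm 3 0 1 2) e" using sem_far_fm assms by blast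
  then show ?thesis using False unfolding long_fm_def long_witness_def by simp
next
  case y: True
  let ?U = "far (e 0) (e 1) (e 2)"
  have far: "{x. x < n \<and> sem n E (far_fm 7 0 1 2) (e'(7 := x))} = ?U" if "\<And>i. i < 4 \<Longrightarrow> e' i = e i" for e'
    using sem_far_set[of 0 1 2 e'] that by simp
  have l: "sem n E (linked_fm (\<lambda>x. far_fm x 0 1 2) 3 (\<lambda>k. Edge k 1) (\<lambda>l. Edge l 2)) e \<longleftrightarrow>
    linked (cmp ?U (e 3)) {e 1} {e 2}"
  proof (rule sem_linked_fm)
    show "{x. x < n \<and> sem n E (far_fm 7 0 1 2) (e'(7 := x))} = ?U" if "\<And>i. i < 4 \<Longrightarrow> e' i = e i" for e'
      using that by (rule far)
  qed (use y in auto)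
  have K: "sem n E (Reach 7 (far_fm 7 0 1 2) 3 i) e' \<longleftrightarrow> e' i \<in> cmp ?U (e 3)" if "\<And>i. i < 4 \<Longrightarrow> e' i = e i" for e' i
  proof -
    have U: "{x. x < n \<and> sem n E (far_fm 7 0 1 2) (e'(7 := x))} = ?U" by (rule far) (rule that)
    show ?thesis unfolding sem_Reach U Let_def using y that by simp
  qed
  let ?K = "cmp ?U (e 3)"
  have KV: "?K \<subseteq> {..<n}" using cmp_subset[OF y] by (auto simp: far_def)
  have A: "{x. x < n \<and> sem n E (And (Neg (Reach 7 (far_fm 7 0 1 2) 3 8))
        (Neg (ExV 9 (And (Edge 8 9) (Reach 7 (far_fm 7 0 1 2) 3 9))))) (e'(8 := x))} = away ?K"
    if "\<And>i. i < 4 \<Longrightarrow> e' i = e i" for e'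
    using that KV by (auto simp: K away_def touch_def simp del: sem.simps(6))
  \<comment> \<open>For the same reason \<open>v\<close> has to lie in \<open>away ?K\<close> before
    \<open>Reach\<close> from \<open>v\<close> can be read as \<open>cmp\<close>.\<close>
  have v: "E (e 0) (e 1) \<Longrightarrow> e 0 \<in> away ?K"
    using cmp_subset[OF y] E_V unfolding away_def far_def touch_def by blast
  have f: "sem n E (far_fm 3 0 1 2) e" using y sem_far_fm by blast
  show ?thesis
  proof (cases "E (e 0) (e 1)")
    case True
    let ?A = "And (Neg (Reach 7 (far_fm 7 0 1 2) 3 8)) (Neg (ExV 9 (And (Edge 8 9) (Reach 7 (far_fm 7 0 1 2) 3 9))))"
    have R: "sem n E (Reach 8 ?A 0 10) (e(10 := x)) \<longleftrightarrow> x \<in> cmp (away ?K) (e 0)" for x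
    proof -
      have U: "{z. z < n \<and> sem n E ?A ((e(10 := x))(8 := z))} = away ?K" by (rule A) simp
      show ?thesis unfolding sem_Reach U Let_def using v[OF True] by simp
    qed
    have P: "sem n E (ExV 10 (And (Edge 10 2) (Reach 8 ?A 0 10))) e \<longleftrightarrow> touch (cmp (away ?K) (e 0)) {e 2}"
      unfolding sem.simps(4,5) R touch_def using E_V by auto
    show ?thesis unfolding long_fm_def long_witness_def sem.simps(4) P l using f assms y by auto
  next
    case False
    then show ?thesis unfolding long_fm_def long_witness_def by simp
  qed
qed

lemma sem_fan_witness_fm:
  assumes "e 2 < n" "e 3 < n"
  shows "sem n E fan_witness_fm e \<longleftrightarrow> fan_witness (e 0) (e 1) (e 2) (e 3)"
proof (cases "e 3 \<in> far (e 0) (e 1) (e 1) \<and> e 2 \<in> fan (e 0) (e 1)")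
  case False
  have "sem n E (far_fm 3 0 1 1) e \<longleftrightarrow> e 3 \<in> far (e 0) (e 1) (e 1)"
    using sem_far_fm assms by blast
  moreover have "sem n E (fan_fm 2 0 1) e \<longleftrightarrow> e 2 \<in> fan (e 0) (e 1)"
    by (simp add: fan_fm_def fan_def)
  ultimately show ?thesis using False unfolding fan_witness_fm_def fan_witness_def sem.simps(4) by blast
next
  case True
  then have y: "e 3 \<in> far (e 0) (e 1) (e 1)" and q: "e 2 \<in> fan (e 0) (e 1)" by auto
  let ?U = "far (e 0) (e 1) (e 1)"
  let ?Q = "cmp (fan (e 0) (e 1)) (e 2)"
  have far: "{x. x < n \<and> sem n E (far_fm 7 0 1 1) (e'(7 := x))} = ?U" if "\<And>i. i < 4 \<Longrightarrow> e' i = e i" for e'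
    using sem_far_set[of 0 1 1 e'] that by simp
  have fan: "{x. x < n \<and> sem n E (fan_fm 7 0 1) (e'(7 := x))} = fan (e 0) (e 1)" if "\<And>i. i < 4 \<Longrightarrow> e' i = e i" for e'
    using sem_fan_set[of 0 1 e'] that by simp
  have T: "sem n E (ExV 8 (And (Edge 6 8) (Reach 7 (fan_fm 7 0 1) 2 8))) e' \<longleftrightarrow> touch {e' 6} ?Q"
    if "\<And>i. i < 4 \<Longrightarrow> e' i = e i" for e'
  proof -
    have "E a b \<Longrightarrow> b < n" for a b using E_V E_sym by blast
    then show ?thesis
      unfolding sem.simps(4,5) sem_Reach using q that
      by (auto simp: fan Let_def touch_def simp del: sem.simps(6))
  qed
  have l: "sem n E (linked_fm (\<lambda>x. far_fm x 0 1 1) 3 (\<lambda>k. Edge k 1)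
      (\<lambda>l. ExV 8 (And (Edge l 8) (Reach 7 (fan_fm 7 0 1) 2 8)))) e \<longleftrightarrow> linked (cmp ?U (e 3)) {e 1} ?Q"
  proof (rule sem_linked_fm)
    show "{x. x < n \<and> sem n E (far_fm 7 0 1 1) (e'(7 := x))} = ?U" if "\<And>i. i < 4 \<Longrightarrow> e' i = e i" for e'
      using that by (rule far)
    show "sem n E (ExV 8 (And (Edge 6 8) (Reach 7 (fan_fm 7 0 1) 2 8))) e' \<longleftrightarrow> touch {e' 6} ?Q"
      if "\<And>i. i < 4 \<Longrightarrow> e' i = e i" for e'
      using that by (rule T)
  qed (use y in auto)
  have "sem n E (far_fm 3 0 1 1) e" using y sem_far_fm by blast
  moreover have "sem n E (fan_fm 2 0 1) e" using q by (simp add: fan_def fan_fm_def)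
  ultimately show ?thesis
    unfolding fan_witness_fm_def fan_witness_def sem.simps(4) l using y q by simp
qed

lemma sem_F2_fm_sgraph: "sem n E F2_fm e \<longleftrightarrow> (\<exists>S T P K. quad S T P K)"
proof -
  have long: "v < n \<and> s < n \<and> t < n \<and> y < n" if "long_witness v s t y" for v s t y
    using that E_V E_sym unfolding long_witness_def far_def by blast
  have fan: "v < n \<and> s < n \<and> t < n \<and> y < n" if "fan_witness v s t y" for v s t y
    using that E_V E_sym unfolding fan_witness_def far_def fan_def by blast
  have "(\<exists>S T P K. quad S T P K) \<longleftrightarrow> (\<exists>v<n. \<exists>s<n. \<exists>t<n. \<exists>y<n. long_witness v s t y \<or> fan_witness v s t y)"
    (is "_ = ?R")
  proof
    assume "\<exists>S T P K. quad S T P K"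
    then obtain v s t y where w: "long_witness v s t y \<or> fan_witness v s t y"
      unfolding quad_iff_witness by blast
    then have "v < n" "s < n" "t < n" "y < n" using long fan by blast+
    with w show ?R by blast
  next
    assume ?R
    then show "\<exists>S T P K. quad S T P K" unfolding quad_iff_witness by blast
  qed
  moreover have "sem n E (Neg (And (Neg long_fm) (Neg fan_witness_fm))) (e(0 := v, 1 := s, 2 := t, 3 := y)) \<longleftrightarrow>
      long_witness v s t y \<or> fan_witness v s t y" if "t < n" "y < n" for v s t y
  proof -
    let ?e = "e(0 := v, 1 := s, 2 := t, 3 := y)"
    have e: "?e 0 = v" "?e 1 = s" "?e 2 = t" "?e 3 = y" by simp_all
    show ?thesis
      using sem_long_fm[of ?e, unfolded e, OF that] sem_fan_witness_fm[of ?e, unfolded e, OF that]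
      unfolding sem.simps(3,4) by blast
  qed
  then have "sem n E (ExV 0 (ExV 1 (ExV 2 (ExV 3 (Neg (And (Neg long_fm) (Neg fan_witness_fm))))))) e \<longleftrightarrow>
      (\<exists>v<n. \<exists>s<n. \<exists>t<n. \<exists>y<n. long_witness v s t y \<or> fan_witness v s t y)"
    unfolding sem.simps(5) by (intro ex_cong1 conj_cong refl)
  moreover have "sem n E (AllV 0 (AllV 1 (Neg (And (Edge 0 1) (Neg (Edge 1 0)))))) e" "sem n E (AllV 0 (Neg (Edge 0 0))) e"
    using E_sym E_irrefl by auto
  ultimately show ?thesis
    unfolding F2_fm_def sem.simps(4) by blast
qed

end

declare One_nat_def [simp]

lemma sem_F2_fm:
  assumes "\<And>i j. E i j \<Longrightarrow> i < n \<and> j < n"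
  shows "sem n E F2_fm e \<longleftrightarrow> sgraph E {..<n} \<and> (\<exists>S T P K. sgraph.quad E {..<n} S T P K)"
proof -
  have "sgraph E {..<n}" if "sem n E F2_fm e"
  proof -
    note c = that[unfolded F2_fm_def sem.simps(4)]
    have "\<forall>i<n. \<forall>j<n. E i j \<longrightarrow> E j i" using conjunct1[OF c] by simp
    moreover have "\<forall>i<n. \<not> E i i" using conjunct1[OF conjunct2[OF c]] by simp
    ultimately show ?thesis using assms by unfold_locales blast+
  qed
  note sg = this
  show ?thesis
  proof
    assume s: "sem n E F2_fm e"
    show "sgraph E {..<n} \<and> (\<exists>S T P K. sgraph.quad E {..<n} S T P K)"
      using sg[OF s] iffD1[OF sem_F2_fm_sgraph[OF sg[OF s]] s] by (rule conjI)
  next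
    assume q: "sgraph E {..<n} \<and> (\<exists>S T P K. sgraph.quad E {..<n} S T P K)"
    show "sem n E F2_fm e" by (rule iffD2[OF sem_F2_fm_sgraph[OF conjunct1[OF q]] conjunct2[OF q]])
  qed
qed

section \<open>Adjacency matrices\<close>

text \<open>False outside the matrix, since the edges of an \<open>sgraph\<close> join elements of
  its vertex set.\<close>

definition entry :: "bool list \<Rightarrow> nat \<Rightarrow> nat \<Rightarrow> nat \<Rightarrow> bool" where
  "entry x n i j \<longleftrightarrow> i < n \<and> j < n \<and> x ! (i * n + j)"

lemma index_less: "i < n \<Longrightarrow> j < n \<Longrightarrow> i * n + j < n * (n :: nat)"
  by (metis add.commute add_less_mono1 less_le_trans mult.commute mult_Suc mult_le_mono1 Suc_leI)

text \<open>The empty graph has no nonempty bag and can be excluded. It has to be, because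
  \<open>loaded\<close> gives every variable a vertex as its value.\<close>

lemma induced_minor_problem_F2_iff:
  "x \<in> induced_minor_problem F2 \<longleftrightarrow> (\<exists>n>0. length x = n * n \<and> sem n (entry x n) F2_fm e)"
proof
  assume "x \<in> induced_minor_problem F2"
  then obtain G where x: "x = adjacency_string G" and G: "input_graph G" and c: "contains_induced_minor G F2"
    unfolding induced_minor_problem_def by blast
  define n where "n = card (verts G)"
  have sG: "simple_graph G" and V: "verts G = {..<n}"
    using G unfolding input_graph_def n_def lessThan_atLeast0 by blast+
  obtain S T P K where q: "sgraph.quad (adj G) (verts G) S T P K"
    using c contains_F2_iff_quad[OF sG] by blast
  have "S \<subseteq> {..<n}" "S \<noteq> {}"
    using sgraph.quadD(1,5)[OF sgraph_adj[OF sG] q] sgraph.conn_nonempty[OF sgraph_adj[OF sG], of S] V by auto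
  then have n: "n > 0" by auto
  have len: "length x = n * n" by (simp add: x adjacency_string_def Let_def n_def)
  have "entry x n i j \<longleftrightarrow> adj G i j" for i j
  proof (cases "i < n \<and> j < n")
    case True
    then show ?thesis using index_less[of i n j]
      by (simp add: x adjacency_string_def Let_def entry_def flip: n_def)
  next
    case False
    then show ?thesis using simple_graph_edge[OF sG] V by (auto simp: entry_def)
  qed
  then have eq: "entry x n = adj G" by blast
  have "sgraph (entry x n) {..<n}" "sgraph.quad (entry x n) {..<n} S T P K"
    unfolding eq using sgraph_adj[OF sG] q V by simp_all
  moreover have "entry x n i j \<Longrightarrow> i < n \<and> j < n" for i j by (simp add: entry_def)
  ultimately have "sem n (entry x n) F2_fm e"
    using sem_F2_fm[of "entry x n" n e] by blast
  then show "\<exists>n>0. length x = n * n \<and> sem n (entry x n) F2_fm e"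
    using n len by (intro exI[of _ n] conjI)
next
  assume "\<exists>n>0. length x = n * n \<and> sem n (entry x n) F2_fm e"
  then obtain n where n: "n > 0" and len: "length x = n * n" and s: "sem n (entry x n) F2_fm e" by blast
  let ?E = "entry x n"
  have sg: "sgraph ?E {..<n}" and q: "\<exists>S T P K. sgraph.quad ?E {..<n} S T P K"
    using s sem_F2_fm[of ?E n e] by (auto simp: entry_def)
  interpret sgraph ?E "{..<n}" by (rule sg)
  define G where "G = \<lparr>verts = {..<n}, edges = {{i, j} | i j. ?E i j}\<rparr>"
  have adj: "adj G = ?E"
    unfolding G_def using E_sym by (auto simp: fun_eq_iff doubleton_eq_iff)
  have ne: "?E i j \<Longrightarrow> i \<noteq> j" for i j using E_irrefl by blast
  have sG: "simple_graph G"
    unfolding simple_graph_def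
  proof (intro conjI ballI)
    show "finite (verts G)" by (simp add: G_def)
    fix a assume "a \<in> edges G"
    then obtain i j where a: "a = {i, j}" "?E i j" unfolding G_def by auto
    then show "a \<subseteq> verts G" "card a = 2" using ne[OF a(2)] by (auto simp: G_def entry_def)
  qed
  have V: "verts G = {..<n}" by (simp add: G_def)
  have "contains_induced_minor G F2"
    unfolding contains_F2_iff_quad[OF sG] adj V by (rule q)
  moreover have "input_graph G" using sG by (auto simp: input_graph_def V)
  moreover have "x = adjacency_string G"
  proof (rule nth_equalityI)
    show "length x = length (adjacency_string G)" by (simp add: adjacency_string_def Let_def V len)
    fix k assume "k < length x"
    then have k: "k < n * n" using len by simp
    then have "k div n < n" "k mod n < n" using n by (auto simp: less_mult_imp_div_less)
    then show "x ! k = adjacency_string G ! k"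
      using k fun_cong[OF fun_cong[OF adj], of "k div n" "k mod n"]
      by (simp add: adjacency_string_def Let_def V entry_def)
  qed
  ultimately show "x \<in> induced_minor_problem F2" unfolding induced_minor_problem_def by blast
qed

section \<open>Preprocessing and the decision program\<close>

text \<open>Cell 0 of array 5 runs through the squares by adding \<open>2 * k + 1\<close>, which
  avoids multiplication. The result is the least \<open>k\<close> whose square is at least the input
  length.\<close>

definition square_root :: com where
  "square_root = Loop (Sub (scalar 0) (scalar 5))
     (Seq (set_scalar 5 (Add (Add (scalar 5) (Add (scalar 3) (scalar 3))) (Const 1)))
        (set_scalar 3 (Add (scalar 3) (Const 1))))"

text \<open>Round \<open>i\<close> writes cell \<open>i + 1\<close>; cell 0 has the right value from
  the start, since array 4 is still zero. The last round fills cell \<open>n\<close>, one beyond the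
  cells that are read.\<close>

definition row_offsets :: com where
  "row_offsets = For 5 (scalar 3) (Assign 4 (Add (scalar 5) (Const 1)) (Add (Cell 4 (scalar 5)) (scalar 3)))"

lemma runs_square_root:
  "runs square_root (input_memory x) (length x * 3 + 1) (\<lambda>s. s 0 = input_memory x 0 \<and> s 1 = (\<lambda>_. 0) \<and>
     s 2 = (\<lambda>_. 0) \<and> s 4 = (\<lambda>_. 0) \<and> s 5 0 = s 3 0 * s 3 0 \<and> s 3 0 \<le> length x \<and>
     (\<forall>k<s 3 0. k * k < length x) \<and> length x \<le> s 3 0 * s 3 0)"
proof -
  define P where "P s \<longleftrightarrow> s 0 = input_memory x 0 \<and> s 1 = (\<lambda>_. 0) \<and> s 2 = (\<lambda>_. 0) \<and> s 4 = (\<lambda>_. 0) \<and>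
     s 5 0 = s 3 0 * s 3 0 \<and> s 3 0 \<le> length x \<and> (\<forall>k<s 3 0. k * k < length x)" for s :: memory
  have in0: "input_memory x 0 0 = length x" by (simp add: input_memory_def)
  have "runs square_root (input_memory x) ((\<lambda>s. length x - s 3 0) (input_memory x) * (2 + 1) + 1)
    (\<lambda>s. P s \<and> val (Sub (scalar 0) (scalar 5)) s = 0)"
    unfolding square_root_def
  proof (rule runs_Loop)
    show "P (input_memory x)" by (auto simp: P_def input_memory_def fun_eq_iff)
    fix s assume s: "P s" "val (Sub (scalar 0) (scalar 5)) s \<noteq> 0"
    \<comment> \<open>From \<open>k <= k * k < length x\<close> it follows that \<open>k\<close>
      stays below the length, which serves as the bound on the number of rounds.\<close>
    then have less: "s 3 0 * s 3 0 < length x" by (simp add: P_def in0)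
    moreover have "s 3 0 \<le> s 3 0 * s 3 0" by (cases "s 3 0") auto
    ultimately have "s 3 0 < length x" by linarith
    then show "runs (Seq (set_scalar 5 (Add (Add (scalar 5) (Add (scalar 3) (scalar 3))) (Const 1)))
        (set_scalar 3 (Add (scalar 3) (Const 1)))) s 2 (\<lambda>s'. P s' \<and> length x - s' 3 0 < length x - s 3 0)"
      unfolding numeral_2_eq_2
      by (intro runs_Assign_Seq runs_Assign[unfolded One_nat_def])
        (use s less in \<open>auto simp: P_def less_Suc_eq\<close>)
  qed
  then show ?thesis
    by (rule runs_mono) (auto simp: P_def in0 input_memory_def)
qed

lemma runs_row_offsets:
  assumes "s 4 0 = 0" "s 3 0 = n"
  shows "runs row_offsets s (n * (1 + 2) + 2) (\<lambda>s'. (\<forall>a<4. s' a = s a) \<and> (\<forall>i<n. s' 4 i = i * n))"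
proof -
  have "runs row_offsets s (n * (1 + 2) + 2) (\<lambda>s'. (\<forall>a<4. s' a = s a) \<and> (\<forall>i\<le>n. s' 4 i = i * n))"
    unfolding row_offsets_def
  proof (rule runs_For[where I = "\<lambda>j s'. (\<forall>a<4. s' a = s a) \<and> (\<forall>i\<le>j. s' 4 i = i * n)"])
    fix j s1 assume j: "j < n" "s1 5 0 = j" and I: "(\<forall>a<4. s1 a = s a) \<and> (\<forall>i\<le>j. s1 4 i = i * n)"
    then have "s1 3 0 = n" using assms(2) by simp
    then show "runs (Assign 4 (Add (scalar 5) (Const 1)) (Add (Cell 4 (scalar 5)) (scalar 3))) s1 1
      (\<lambda>s'. s' 5 0 = j \<and> (\<forall>a<4. (s'(5 := (s' 5)(0 := Suc j))) a = s a) \<and>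
        (\<forall>i\<le>Suc j. (s'(5 := (s' 5)(0 := Suc j))) 4 i = i * n))"
      by (intro runs_Assign) (use j I in \<open>auto simp: le_Suc_eq\<close>)
  qed (use assms in auto)
  then show ?thesis by (rule runs_mono) auto
qed

lemma loaded_input:
  assumes s: "s 0 = input_memory x 0" "s 2 = (\<lambda>_. 0)" "s 3 0 = n" "\<forall>i<n. s 4 i = i * n"
    and n: "n > 0" "length x = n * n"
  shows "loaded s n (entry x n)"
proof -
  have "s 0 (i * n + j + 1) \<noteq> 0 \<longleftrightarrow> entry x n i j" if "i < n" "j < n" for i j
    using index_less[OF that] that by (simp add: s(1) input_memory_def n(2) entry_def)
  then show ?thesis unfolding loaded_def using s n by (simp add: input_memory_def)
qed

theorem theorem11: "polytime_decidable (induced_minor_problem F2)"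
proof -
  obtain c B where B: "polyb B" and c: "decides 5 c B F2_fm"
    using decides_all[of 5 F2_fm] by auto
  from B obtain d where d: "\<And>n. B n \<le> (n + 2) ^ d" unfolding polyb_def by blast
  let ?main = "Seq row_offsets (Seq c (set_scalar 1 (scalar 5)))"
  \<comment> \<open>A positive difference means that the length is not a square, and root 0 means
    the empty input. Both are rejected by doing nothing, as the answer cell is still 0.\<close>
  let ?c = "Seq square_root (Cond (Sub (scalar 5) (scalar 0)) Skip (Cond (scalar 3) ?main Skip))"
  \<comment> \<open>The bounds in \<open>n\<close> are taken at the input length \<open>L\<close>,
    which is at least \<open>n\<close>.\<close>
  define T where "T L = L * 3 + 1 + Suc (Suc (L * (1 + 2) + 2 + ((L + 2) ^ d + 1)))" for L :: nat
  have "polyb (\<lambda>L. (L + 2) ^ d)" unfolding polyb_def by blast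
  then have "polyb T" unfolding T_def by (intro polyb_intros)
  then obtain D where D: "\<And>L. T L \<le> (L + 2) ^ D" unfolding polyb_def by blast
  have main: "runs ?c (input_memory x) (T (length x)) (\<lambda>s. s 1 0 \<noteq> 0 \<longleftrightarrow> x \<in> induced_minor_problem F2)" for x
    unfolding T_def
  proof (rule runs_Seq[OF runs_square_root])
    fix s :: memory
    assume "s 0 = input_memory x 0 \<and> s 1 = (\<lambda>_. 0) \<and> s 2 = (\<lambda>_. 0) \<and> s 4 = (\<lambda>_. 0) \<and>
      s 5 0 = s 3 0 * s 3 0 \<and> s 3 0 \<le> length x \<and> (\<forall>k<s 3 0. k * k < length x) \<and> length x \<le> s 3 0 * s 3 0"
    then have s: "s 0 = input_memory x 0" "s 1 = (\<lambda>_. 0)" "s 2 = (\<lambda>_. 0)" "s 4 = (\<lambda>_. 0)"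
      "s 5 0 = s 3 0 * s 3 0" "s 3 0 \<le> length x" "\<forall>k<s 3 0. k * k < length x" "length x \<le> s 3 0 * s 3 0"
      by simp_all
    let ?n = "s 3 0"
    let ?Q = "\<lambda>s. s 1 0 \<noteq> (0 :: nat) \<longleftrightarrow> x \<in> induced_minor_problem F2"
    have root: "n = ?n" if "length x = n * n" for n
    proof (rule ccontr)
      assume "n \<noteq> ?n"
      moreover have "\<not> n < ?n" using s(7) that by auto
      ultimately have "?n < n" by simp
      then have "?n * ?n < n * n" by (intro mult_strict_mono) auto
      then show False using s(8) that by simp
    qed
    have no: "runs Skip s (Suc b) ?Q" if "\<not> (?n > 0 \<and> length x = ?n * ?n)" for b
    proof -
      have "x \<notin> induced_minor_problem F2"
        using that root unfolding induced_minor_problem_F2_iff[of x "\<lambda>_. 0"] by blast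
      then show ?thesis using s(2) by (intro runs_Skip_Suc) simp
    qed
    show "runs (Cond (Sub (scalar 5) (scalar 0)) Skip (Cond (scalar 3) ?main Skip)) s
      (Suc (Suc (length x * (1 + 2) + 2 + ((length x + 2) ^ d + 1)))) ?Q"
    proof (rule runs_Cond)
      assume "val (Sub (scalar 5) (scalar 0)) s \<noteq> 0"
      then have "length x \<noteq> ?n * ?n" by (simp add: s input_memory_def)
      then show "runs Skip s (Suc (length x * (1 + 2) + 2 + ((length x + 2) ^ d + 1))) ?Q" by (intro no) simp
    next
      assume "val (Sub (scalar 5) (scalar 0)) s = 0"
      then have len: "length x = ?n * ?n" using s(5,8) by (simp add: s(1) input_memory_def)
      show "runs (Cond (scalar 3) ?main Skip) s (Suc (length x * (1 + 2) + 2 + ((length x + 2) ^ d + 1))) ?Q"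
      proof (rule runs_Cond)
        assume "val (scalar 3) s = 0"
        then have "\<not> ?n > 0" by simp
        then show "runs Skip s (length x * (1 + 2) + 2 + ((length x + 2) ^ d + 1)) ?Q"
          using no[of "length x * (1 + 2) + 2 + (length x + 2) ^ d"] by simp
      next
        assume "val (scalar 3) s \<noteq> 0"
        then have n: "?n > 0" by simp
        have "s 4 0 = 0" using s(4) by simp
        from runs_row_offsets[of s ?n, OF this refl]
        have rows: "runs row_offsets s (length x * (1 + 2) + 2)
          (\<lambda>s'. (\<forall>a<4. s' a = s a) \<and> (\<forall>i<?n. s' 4 i = i * ?n))"
          by (rule runs_mono) (use s(6) in simp_all)
        show "runs ?main s (length x * (1 + 2) + 2 + ((length x + 2) ^ d + 1)) ?Q"
        proof (rule runs_Seq[OF rows])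
          fix s1 assume s1: "(\<forall>a<4. s1 a = s a) \<and> (\<forall>i<?n. s1 4 i = i * ?n)"
          have ld: "loaded s1 ?n (entry x ?n)"
            by (rule loaded_input) (use s1 s n len in auto)
          have "B ?n \<le> (length x + 2) ^ d"
            using d[of ?n] power_mono[of "?n + 2" "length x + 2" d] s(6) by simp
          then have run: "runs c s1 ((length x + 2) ^ d)
            (\<lambda>s'. (\<forall>a<5. s' a = s1 a) \<and> (s' 5 0 \<noteq> 0 \<longleftrightarrow> sem ?n (entry x ?n) F2_fm (s1 2)))"
            by (rule runs_mono[OF decidesD[OF c ld]])
          show "runs (Seq c (set_scalar 1 (scalar 5))) s1 ((length x + 2) ^ d + 1) ?Q"
          proof (rule runs_Seq[OF run], rule runs_Assign)
            fix s2 assume "(\<forall>a<5. s2 a = s1 a) \<and> (s2 5 0 \<noteq> 0 \<longleftrightarrow> sem ?n (entry x ?n) F2_fm (s1 2))"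
            moreover have "x \<in> induced_minor_problem F2 \<longleftrightarrow> sem ?n (entry x ?n) F2_fm (s1 2)"
              unfolding induced_minor_problem_F2_iff[of x "s1 2"] using root n len by blast
            ultimately show "(s2(1 := (s2 1)(val (Const 0) s2 := val (scalar 5) s2))) 1 0 \<noteq> 0 \<longleftrightarrow>
              x \<in> induced_minor_problem F2" by simp
          qed
        qed
      qed
    qed
  qed
  show ?thesis
    unfolding polytime_decidable_def
  \<comment> \<open>\<open>[:2, 1:]\<close> is the polynomial with value \<open>L + 2\<close> at
    \<open>L\<close>.\<close>
  proof (rule exI[of _ ?c], rule exI[of _ "[:2, 1:] ^ D"], rule allI)
    fix x
    obtain t s where ts: "exec ?c (input_memory x) t s" "t \<le> T (length x)"
      "s 1 0 \<noteq> 0 \<longleftrightarrow> x \<in> induced_minor_problem F2"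
      using main[of x] unfolding runs_def by blast
    have "t \<le> poly ([:2, 1:] ^ D) (length x)"
      using ts(2) D[of "length x"] by (simp add: add.commute)
    then show "\<exists>t s. exec ?c (input_memory x) t s \<and> t \<le> poly ([:2, 1:] ^ D) (length x) \<and>
      (s 1 0 \<noteq> 0 \<longleftrightarrow> x \<in> induced_minor_problem F2)"
      using ts by blast
  qed
qed

end
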